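(* Consider a constant product market maker, with invariant $f(x,y)=\sqrt{xy}=L$, $L>0$. In the model described in the context, with initial price $P_0=P>0$ and $z_{0^-}$ distributed according to the stationary distribution $\pi$, the intensities per dollar value in the pool of arbitrage profits and fees are given by $$ \frac{\overline{\mathsf{ARB}}}{V(P)}=\begin{cases}\displaystyle\frac{\sigma^2}{8}\times\mathsf{P}_{\mathsf{trade}}\times\frac{e^{+\gamma/2}}{1-\sigma^2/(8\lambda)} & \text{if } \sigma^2/8<\lambda,\\ +\infty & \text{otherwise,}\end{cases} $$ $$ \frac{\overline{\mathsf{FEE}}}{V(P)}=\frac{\sigma^2}{8}\times\frac{e^{+\gamma/2}-e^{-\gamma/2}}{\gamma}\times\frac{1}{\left(1+\sigma/(\sqrt{2\lambda}\,\gamma)\right)\left(1+\sigma/(2\sqrt{2\lambda})\right)}, $$ where the right-hand sides do not depend on the value of $P_0=P$.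
   Context: Model. Fix $\sigma,\lambda,\gamma>0$. The external price satisfies $dP_t/P_t=\mu\,dt+\sigma\,dB_t$ with $\mu=\frac12\sigma^2$, $B$ a standard Brownian motion. Arbitrageurs arrive at the arrival times $0<\tau_1<\tau_2<\cdots$ of a Poisson process $N_t$ of rate $\lambda$, independent of $B$. The mispricing process $z_t$ satisfies $dz_t=\sigma\,dB_t$ between arrivals and $z_{\tau_i}=\max(\min(z_{\tau_i^-},\gamma),-\gamma)$ at arrivals; $z_{0^-}$ is independent of $(B,N)$. Stationary distribution. With $\eta=\sqrt{2\lambda}\gamma/\sigma$, the unique invariant distribution $\pi$ of $z_t$ is uniform on $[-\gamma,\gamma]$ with total mass $\eta/(1+\eta)$, and $z-\gamma$ given $z>\gamma$, and $-\gamma-z$ given $z<-\gamma$, are exponential with parameter $\sqrt{2\lambda}/\sigma$, each of these two regions having mass $\frac12\frac1{1+\eta}$. Set $\mathsf{P}_{\mathsf{trade}}=\frac{1}{1+\sqrt{2\lambda}\gamma/\sigma}$. Pool. For $P>0$, $V(P)=\min\{Px+y:(x,y)\in\mathbb{R}^2_+,\ f(x,y)=L\}$ with minimizer $(x^*(P),y^*(P))$. Profits and fees ($\mathbb{I}$ denotes an indicator): $A_+(P,z)=\big[P\{x^*(Pe^{-z})-x^*(Pe^{-\gamma})\}+e^{\gamma}\{y^*(Pe^{-z})-y^*(Pe^{-\gamma})\}\big]\mathbb{I}_{\{z>\gamma\}}$, $A_-(P,z)=\big[e^{\gamma}P\{x^*(Pe^{-z})-x^*(Pe^{\gamma})\}+\{y^*(Pe^{-z})-y^*(Pe^{\gamma})\}\big]\mathbb{I}_{\{z<-\gamma\}}$,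 $F_+(P,z)=-(e^{\gamma}-1)\big[y^*(Pe^{-z})-y^*(Pe^{-\gamma})\big]\mathbb{I}_{\{z>\gamma\}}$, $F_-(P,z)=-(e^{\gamma}-1)P\big[x^*(Pe^{-z})-x^*(Pe^{\gamma})\big]\mathbb{I}_{\{z<-\gamma\}}$. With $A=A_++A_-$, $F=F_++F_-$: $\mathsf{ARB}_T=\sum_{i=1}^{N_T}A(P_{\tau_i},z_{\tau_i^-})$, $\mathsf{FEE}_T=\sum_{i=1}^{N_T}F(P_{\tau_i},z_{\tau_i^-})$, $\overline{\mathsf{ARB}}=\lim_{T\to0}\mathsf{E}[\mathsf{ARB}_T]/T$ (equal to $\lambda\mathsf{E}_\pi[A(P,z)]$) and $\overline{\mathsf{FEE}}=\lim_{T\to0}\mathsf{E}[\mathsf{FEE}_T]/T$ (equal to $\lambda\mathsf{E}_\pi[F(P,z)]$). *)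

theory Defs
  imports "HOL-Probability.Probability"
begin

text \<open>
  Processes have index type \<^typ>\<open>real\<close>; only indices \<open>t \<ge> 0\<close> are constrained.
  \<open>F\<close> is a filtration to which the Brownian motion \<open>B\<close> and the price are adapted,
  for instance the (completed) filtration generated by \<open>B\<close>.
\<close>

definition brownian_motion ::
  "'a measure \<Rightarrow> (real \<Rightarrow> 'a measure) \<Rightarrow> (real \<Rightarrow> 'a \<Rightarrow> real) \<Rightarrow> bool" where
  "brownian_motion M F B \<longleftrightarrow>
     (\<forall>t\<ge>0. subalgebra M (F t)) \<and>
     (\<forall>s\<ge>0. \<forall>t\<ge>s. subalgebra (F t) (F s)) \<and>
     (\<forall>t\<ge>0. B t \<in> borel_measurable (F t)) \<and>
     (\<forall>w\<in>space M. B 0 w = 0 \<and> continuous_on {0..} (\<lambda>t. B t w)) \<and>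
     (\<forall>s\<ge>0. \<forall>t>s.
        distributed M lborel (\<lambda>w. B t w - B s w) (\<lambda>x. ennreal (normal_density 0 (sqrt (t - s)) x)) \<and>
        prob_space.indep_set M (sets (F s))
          (sets (vimage_algebra (space M) (\<lambda>w. B t w - B s w) borel)))"

text \<open>The library's \<open>indep_var\<close> needs both variables to have the same type.\<close>

definition indep_rvs ::
  "'a measure \<Rightarrow> ('a \<Rightarrow> 'b) \<Rightarrow> 'b measure \<Rightarrow> ('a \<Rightarrow> 'c) \<Rightarrow> 'c measure \<Rightarrow> bool" where
  "indep_rvs M X S Y T \<longleftrightarrow>
     X \<in> measurable M S \<and> Y \<in> measurable M T \<and>
     prob_space.indep_set M
       (sets (vimage_algebra (space M) X S)) (sets (vimage_algebra (space M) Y T))"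

definition poisson_process :: "'a measure \<Rightarrow> real \<Rightarrow> (real \<Rightarrow> 'a \<Rightarrow> nat) \<Rightarrow> bool" where
  "poisson_process M lam N \<longleftrightarrow>
     (\<forall>t\<ge>0. N t \<in> measurable M (count_space UNIV)) \<and>
     (\<forall>w\<in>space M. N 0 w = 0 \<and> mono_on {0..} (\<lambda>t. N t w) \<and>
        (\<forall>t\<ge>0. continuous (at_right t) (\<lambda>u. N u w))) \<and>
     (\<forall>s\<ge>0. \<forall>t>s.
        distr M (count_space UNIV) (\<lambda>w. N t w - N s w) = measure_pmf (poisson_pmf (lam * (t - s))) \<and>
        indep_rvs M
          (\<lambda>w. \<lambda>u\<in>{0..s}. N u w) (PiM {0..s} (\<lambda>_. count_space UNIV))
          (\<lambda>w. N t w - N s w) (count_space UNIV))"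

text \<open>The arrival times are indexed from 1; \<open>\<tau> 0\<close> is irrelevant.\<close>

definition arrival_times ::
  "'a measure \<Rightarrow> (real \<Rightarrow> 'a \<Rightarrow> nat) \<Rightarrow> (nat \<Rightarrow> 'a \<Rightarrow> real) \<Rightarrow> bool" where
  "arrival_times M N \<tau> \<longleftrightarrow>
     (\<forall>w\<in>space M. 0 < \<tau> 1 w \<and> strict_mono_on {1..} (\<lambda>i. \<tau> i w) \<and>
        (\<forall>t\<ge>0. finite {i. 1 \<le> i \<and> \<tau> i w \<le> t} \<and> N t w = card {i. 1 \<le> i \<and> \<tau> i w \<le> t}))"

definition restricted_path :: "(real \<Rightarrow> 'a \<Rightarrow> 'b) \<Rightarrow> 'a \<Rightarrow> real \<Rightarrow> 'b" where
  "restricted_path X w = (\<lambda>t\<in>{0..}. X t w)"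

abbreviation real_paths :: "(real \<Rightarrow> real) measure" where
  "real_paths \<equiv> PiM {0..} (\<lambda>_. borel)"

abbreviation nat_paths :: "(real \<Rightarrow> nat) measure" where
  "nat_paths \<equiv> PiM {0..} (\<lambda>_. count_space UNIV)"

text \<open>
  \<open>X = \<integral>\<^sub>0\<^sup>t H dB\<close> as the limit in probability of left-endpoint Riemann sums as the mesh of
  the partition \<open>0 = p 0 \<le> \<dots> \<le> p n = t\<close> tends to 0. For continuous adapted \<open>H\<close>, the only case
  in which it is used, this is the Ito integral.
\<close>

definition has_ito_integral ::
  "'a measure \<Rightarrow> (real \<Rightarrow> 'a \<Rightarrow> real) \<Rightarrow> (real \<Rightarrow> 'a \<Rightarrow> real) \<Rightarrow> real \<Rightarrow> ('a \<Rightarrow> real) \<Rightarrow> bool" where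
  "has_ito_integral M H B t X \<longleftrightarrow>
     X \<in> borel_measurable M \<and>
     (\<forall>\<epsilon>>0. \<exists>\<delta>>0. \<forall>n p.
        p 0 = 0 \<and> p n = t \<and> (\<forall>k<n. p k \<le> p (Suc k) \<and> p (Suc k) - p k < \<delta>) \<longrightarrow>
        measure M {w \<in> space M.
          \<bar>(\<Sum>k<n. H (p k) w * (B (p (Suc k)) w - B (p k) w)) - X w\<bar> > \<epsilon>} < \<epsilon>)"

text \<open>\<open>dP\<^sub>t / P\<^sub>t = \<mu> dt + \<sigma> dB\<^sub>t\<close> with \<open>P\<close> positive, i.e. \<open>dP\<^sub>t = \<mu> P\<^sub>t dt + \<sigma> P\<^sub>t dB\<^sub>t\<close> in integral form.\<close>

definition external_price ::
  "'a measure \<Rightarrow> (real \<Rightarrow> 'a measure) \<Rightarrow> (real \<Rightarrow> 'a \<Rightarrow> real) \<Rightarrow> real \<Rightarrow> real \<Rightarrow>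
    (real \<Rightarrow> 'a \<Rightarrow> real) \<Rightarrow> bool" where
  "external_price M F B \<mu> \<sigma> P \<longleftrightarrow>
     (\<forall>t\<ge>0. P t \<in> borel_measurable (F t)) \<and>
     (\<forall>w\<in>space M. continuous_on {0..} (\<lambda>t. P t w) \<and> (\<forall>t\<ge>0. P t w > 0)) \<and>
     (\<forall>t\<ge>0. has_ito_integral M (\<lambda>s w. \<sigma> * P s w) B t
        (\<lambda>w. P t w - P 0 w - integral {0..t} (\<lambda>s. \<mu> * P s w)))"

definition left_limit :: "(real \<Rightarrow> 'a \<Rightarrow> real) \<Rightarrow> real \<Rightarrow> 'a \<Rightarrow> real" where
  "left_limit z t w = Lim (at_left t) (\<lambda>s. z s w)"

text \<open>\<open>z0\<close> is the value at time \<open>0\<^sup>-\<close>.\<close>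

definition mispricing ::
  "'a measure \<Rightarrow> real \<Rightarrow> real \<Rightarrow> (real \<Rightarrow> 'a \<Rightarrow> real) \<Rightarrow> (nat \<Rightarrow> 'a \<Rightarrow> real) \<Rightarrow> ('a \<Rightarrow> real) \<Rightarrow>
    (real \<Rightarrow> 'a \<Rightarrow> real) \<Rightarrow> bool" where
  "mispricing M \<sigma> \<gamma> B \<tau> z0 z \<longleftrightarrow>
     (\<forall>w\<in>space M.
        (\<forall>t. 0 \<le> t \<and> t < \<tau> 1 w \<longrightarrow> z t w = z0 w + \<sigma> * B t w) \<and>
        (\<forall>i\<ge>1. z (\<tau> i w) w = max (min (left_limit z (\<tau> i w) w) \<gamma>) (-\<gamma>)) \<and>
        (\<forall>i\<ge>1. \<forall>t. \<tau> i w \<le> t \<and> t < \<tau> (Suc i) w \<longrightarrow>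
           z t w = z (\<tau> i w) w + \<sigma> * (B t w - B (\<tau> i w) w)))"

definition p_trade :: "real \<Rightarrow> real \<Rightarrow> real \<Rightarrow> real" where
  "p_trade \<sigma> lam \<gamma> = 1 / (1 + sqrt (2 * lam) * \<gamma> / \<sigma>)"

definition stationary_density :: "real \<Rightarrow> real \<Rightarrow> real \<Rightarrow> real \<Rightarrow> real" where
  "stationary_density \<sigma> lam \<gamma> z =
     (let \<eta> = sqrt (2 * lam) * \<gamma> / \<sigma>; r = sqrt (2 * lam) / \<sigma> in
      if z > \<gamma> then 1/2 * (1 / (1 + \<eta>)) * exponential_density r (z - \<gamma>)
      else if z < -\<gamma> then 1/2 * (1 / (1 + \<eta>)) * exponential_density r (-\<gamma> - z)
      else \<eta> / (1 + \<eta>) * (1 / (2 * \<gamma>)))"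

definition on_curve :: "(real \<Rightarrow> real \<Rightarrow> real) \<Rightarrow> real \<Rightarrow> real \<times> real \<Rightarrow> bool" where
  "on_curve f L q \<longleftrightarrow> fst q \<ge> 0 \<and> snd q \<ge> 0 \<and> f (fst q) (snd q) = L"

definition pool_value :: "(real \<Rightarrow> real \<Rightarrow> real) \<Rightarrow> real \<Rightarrow> real \<Rightarrow> real" where
  "pool_value f L p = (LEAST v. \<exists>q. on_curve f L q \<and> v = p * fst q + snd q)"

definition x_opt :: "(real \<Rightarrow> real \<Rightarrow> real) \<Rightarrow> real \<Rightarrow> real \<Rightarrow> real" where
  "x_opt f L p = fst (arg_min (\<lambda>q. p * fst q + snd q) (on_curve f L))"

definition y_opt :: "(real \<Rightarrow> real \<Rightarrow> real) \<Rightarrow> real \<Rightarrow> real \<Rightarrow> real" where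
  "y_opt f L p = snd (arg_min (\<lambda>q. p * fst q + snd q) (on_curve f L))"

definition cpmm :: "real \<Rightarrow> real \<Rightarrow> real" where
  "cpmm x y = sqrt (x * y)"

definition arb_plus :: "(real \<Rightarrow> real \<Rightarrow> real) \<Rightarrow> real \<Rightarrow> real \<Rightarrow> real \<Rightarrow> real \<Rightarrow> real" where
  "arb_plus f L \<gamma> p z =
     (p * (x_opt f L (p * exp (-z)) - x_opt f L (p * exp (-\<gamma>)))
      + exp \<gamma> * (y_opt f L (p * exp (-z)) - y_opt f L (p * exp (-\<gamma>)))) * indicator {\<gamma><..} z"

definition arb_minus :: "(real \<Rightarrow> real \<Rightarrow> real) \<Rightarrow> real \<Rightarrow> real \<Rightarrow> real \<Rightarrow> real \<Rightarrow> real" where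
  "arb_minus f L \<gamma> p z =
     (exp \<gamma> * p * (x_opt f L (p * exp (-z)) - x_opt f L (p * exp \<gamma>))
      + (y_opt f L (p * exp (-z)) - y_opt f L (p * exp \<gamma>))) * indicator {..<-\<gamma>} z"

definition fee_plus :: "(real \<Rightarrow> real \<Rightarrow> real) \<Rightarrow> real \<Rightarrow> real \<Rightarrow> real \<Rightarrow> real \<Rightarrow> real" where
  "fee_plus f L \<gamma> p z =
     - (exp \<gamma> - 1) * (y_opt f L (p * exp (-z)) - y_opt f L (p * exp (-\<gamma>))) * indicator {\<gamma><..} z"

definition fee_minus :: "(real \<Rightarrow> real \<Rightarrow> real) \<Rightarrow> real \<Rightarrow> real \<Rightarrow> real \<Rightarrow> real \<Rightarrow> real" where
  "fee_minus f L \<gamma> p z =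
     - (exp \<gamma> - 1) * p * (x_opt f L (p * exp (-z)) - x_opt f L (p * exp \<gamma>)) * indicator {..<-\<gamma>} z"

definition arb :: "(real \<Rightarrow> real \<Rightarrow> real) \<Rightarrow> real \<Rightarrow> real \<Rightarrow> real \<Rightarrow> real \<Rightarrow> real" where
  "arb f L \<gamma> p z = arb_plus f L \<gamma> p z + arb_minus f L \<gamma> p z"

definition fee :: "(real \<Rightarrow> real \<Rightarrow> real) \<Rightarrow> real \<Rightarrow> real \<Rightarrow> real \<Rightarrow> real \<Rightarrow> real" where
  "fee f L \<gamma> p z = fee_plus f L \<gamma> p z + fee_minus f L \<gamma> p z"

definition cumulative ::
  "(real \<Rightarrow> real \<Rightarrow> real) \<Rightarrow> (real \<Rightarrow> 'a \<Rightarrow> nat) \<Rightarrow> (nat \<Rightarrow> 'a \<Rightarrow> real) \<Rightarrow>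
    (real \<Rightarrow> 'a \<Rightarrow> real) \<Rightarrow> (real \<Rightarrow> 'a \<Rightarrow> real) \<Rightarrow> real \<Rightarrow> 'a \<Rightarrow> real" where
  "cumulative g N \<tau> P z T w =
     (\<Sum>i=1..N T w. g (P (\<tau> i w) w) (left_limit z (\<tau> i w) w))"

text \<open>
  Quasi-integrability is part of the notion: \<open>\<infinity> - \<infinity> = \<infinity>\<close> in \<^typ>\<open>ereal\<close>,
  so the difference alone would yield \<open>\<infinity>\<close> when the expectation does not exist.
\<close>

definition has_expectation :: "'a measure \<Rightarrow> ('a \<Rightarrow> real) \<Rightarrow> ereal \<Rightarrow> bool" where
  "has_expectation M X e \<longleftrightarrow>
     X \<in> borel_measurable M \<and>
     ((\<integral>\<^sup>+w. ennreal (X w) \<partial>M) < \<infinity> \<or> (\<integral>\<^sup>+w. ennreal (- X w) \<partial>M) < \<infinity>) \<and>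
     e = enn2ereal (\<integral>\<^sup>+w. ennreal (X w) \<partial>M) - enn2ereal (\<integral>\<^sup>+w. ennreal (- X w) \<partial>M)"

definition has_intensity :: "'a measure \<Rightarrow> (real \<Rightarrow> 'a \<Rightarrow> real) \<Rightarrow> ereal \<Rightarrow> bool" where
  "has_intensity M X v \<longleftrightarrow>
     (\<exists>e. (\<forall>T>0. has_expectation M (X T) (e T)) \<and>
          ((\<lambda>T. e T / ereal T) \<longlongrightarrow> v) (at_right 0))"

end

theory Submission
  imports Defs "HOL-Real_Asymp.Real_Asymp"
begin

text \<open>
  The choice \<open>\<mu> = \<sigma>\<^sup>2 / 2\<close> makes \<open>P t = p exp (\<sigma> B t)\<close> the solution of the price equation. Since the
  stochastic integral is a limit of Riemann sums, uniqueness is shown at the discrete level: along a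
  coarse grid refined by a fine one, \<open>P t exp (- \<sigma> B t)\<close> changes by martingale differences with
  conditional variance \<open>O(h\<^sup>2)\<close> over a coarse step \<open>h\<close>, plus errors controlled by the modulus of
  continuity of \<open>P\<close>. Clipping the coefficients of these differences gives the needed \<open>L\<^sup>2\<close> bounds
  without stopping times, and the clipping is inactive on an event of large probability.

  For a constant product pool, profits and fees at an arrival are \<open>sqrt P\<close> times a function of the
  mispricing. Freezing the arrival times (they are independent of \<open>B\<close> and \<open>z0\<close>), the first arrival
  contributes \<open>\<phi> (\<tau> 1)\<close> with \<open>\<phi> t \<longrightarrow> \<phi> 0\<close> as \<open>t \<longrightarrow> 0\<close>, hence \<open>lam * \<phi> 0\<close> in the limit. From the
  second arrival on the mispricing starts in \<open>[- \<gamma>, \<gamma>]\<close> and only Gaussian exponential moments enter,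
  so those terms are bounded by a multiple of the expected number of arrivals after the first, which
  is \<open>O(T\<^sup>2)\<close>. If \<open>\<sigma>\<^sup>2 / 8 \<ge> lam\<close> the stationary law lacks the required exponential moment and
  already the first arrival has infinite expected profit.
\<close>

section \<open>Gaussian increments and martingale transforms\<close>

text \<open>The price equation gives the stochastic integral one time at a time and only as a limit
  in probability, and no moments of P are assumed, so an isometry for P itself is out of reach.
  Hence the two grids: with the coarse grid fixed, only finitely many instances of the limit occur,
  and a common fine mesh makes their errors small even after multiplication by the number of coarse
  steps.

  The condition on \<open>lam\<close> compares two exponents. Arbitrage profits grow like exp (|z| /
  2), because the holdings of the pool are powers 1/2 and -1/2 of the price, while the stationary
  tails decay like exp (- rate |z|) with \<open>rate = sqrt (2 * lam) / \<sigma>\<close>; and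
  \<open>1 / 2 < rate\<close> means \<open>\<sigma>\<^sup>2 / 8 < lam\<close>. The value of the pool
  is proportional to the square root of the price as well, so the initial price cancels in both
  quotients.\<close>

lemma normal_density_tilt:
  assumes "0 < s"
  shows "normal_density 0 s x * exp (a * x) = exp (a\<^sup>2 * s\<^sup>2 / 2) * normal_density (a * s\<^sup>2) s x"
proof -
  have "- x\<^sup>2 / (2 * s\<^sup>2) + a * x = a\<^sup>2 * s\<^sup>2 / 2 + - (x - a * s\<^sup>2)\<^sup>2 / (2 * s\<^sup>2)"
    using assms by (simp add: field_simps power2_eq_square)
  then have "exp (- x\<^sup>2 / (2 * s\<^sup>2)) * exp (a * x) = exp (a\<^sup>2 * s\<^sup>2 / 2) * exp (- (x - a * s\<^sup>2)\<^sup>2 / (2 * s\<^sup>2))"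
    by (metis exp_add)
  then show ?thesis
    by (simp add: normal_density_def field_simps)
qed

text \<open>The exponential factor moves the Gaussian mean from 0 to m, after which the moments of
  order 0, 1 and 2 about m suffice. Exponential times quadratic is the shape of all moments taken of
  a one-step change of the price ratio.\<close>

lemma has_bochner_integral_normal_exp_quadratic:
  fixes s a c0 c1 c2 :: real
  assumes "0 < s"
  defines "m \<equiv> a * s\<^sup>2"
  shows "has_bochner_integral lborel
     (\<lambda>x. normal_density 0 s x * (exp (a * x) * (c0 + c1 * x + c2 * x\<^sup>2)))
     (exp (a\<^sup>2 * s\<^sup>2 / 2) * (c0 + c1 * m + c2 * (s\<^sup>2 + m\<^sup>2)))"
proof -
  let ?d = "normal_density m s"
  have i0: "has_bochner_integral lborel ?d 1"
    using assms by (simp add: has_bochner_integral_iff)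
  have i1: "has_bochner_integral lborel (\<lambda>x. ?d x * (x - m)) 0"
    using normal_moment_odd[OF assms(1), of m 0] by simp
  have i2: "has_bochner_integral lborel (\<lambda>x. ?d x * (x - m)\<^sup>2) (s\<^sup>2)"
    using normal_moment_even[OF assms(1), of m 1] by simp
  have "has_bochner_integral lborel
     (\<lambda>x. exp (a\<^sup>2 * s\<^sup>2 / 2) * ((c0 + c1 * m + c2 * m\<^sup>2) * ?d x
        + (c1 + 2 * c2 * m) * (?d x * (x - m)) + c2 * (?d x * (x - m)\<^sup>2)))
     (exp (a\<^sup>2 * s\<^sup>2 / 2) * ((c0 + c1 * m + c2 * m\<^sup>2) * 1 + (c1 + 2 * c2 * m) * 0 + c2 * s\<^sup>2))"
    by (intro has_bochner_integral_mult_right has_bochner_integral_add i0 i1 i2)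
  moreover have "exp (a\<^sup>2 * s\<^sup>2 / 2) * ((c0 + c1 * m + c2 * m\<^sup>2) * ?d x
        + (c1 + 2 * c2 * m) * (?d x * (x - m)) + c2 * (?d x * (x - m)\<^sup>2)) =
     normal_density 0 s x * (exp (a * x) * (c0 + c1 * x + c2 * x\<^sup>2))" for x
  proof -
    have "normal_density 0 s x * (exp (a * x) * (c0 + c1 * x + c2 * x\<^sup>2)) =
       exp (a\<^sup>2 * s\<^sup>2 / 2) * ?d x * (c0 + c1 * x + c2 * x\<^sup>2)"
      using normal_density_tilt[OF assms(1), of x a] unfolding m_def by (simp add: mult.assoc[symmetric])
    then show ?thesis by (simp add: algebra_simps power2_eq_square)
  qed
  ultimately show ?thesis
    by (simp add: algebra_simps)
qed

lemma (in prob_space) has_bochner_integral_gaussian_exp_quadratic: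
  fixes s a c0 c1 c2 :: real
  assumes "0 < s" and X: "distributed M lborel X (\<lambda>x. ennreal (normal_density 0 s x))"
  defines "m \<equiv> a * s\<^sup>2"
  shows "has_bochner_integral M (\<lambda>w. exp (a * X w) * (c0 + c1 * X w + c2 * (X w)\<^sup>2))
     (exp (a\<^sup>2 * s\<^sup>2 / 2) * (c0 + c1 * m + c2 * (s\<^sup>2 + m\<^sup>2)))"
proof -
  let ?g = "\<lambda>x. exp (a * x) * (c0 + c1 * x + c2 * x\<^sup>2)"
  note h = has_bochner_integral_normal_exp_quadratic[OF assms(1), of a c0 c1 c2]
  have "integrable M (\<lambda>w. ?g (X w))"
    by (subst distributed_integrable[OF X, symmetric]) (use h in \<open>auto simp: has_bochner_integral_iff\<close>)
  moreover have "(\<integral>w. ?g (X w) \<partial>M) = (exp (a\<^sup>2 * s\<^sup>2 / 2) * (c0 + c1 * m + c2 * (s\<^sup>2 + m\<^sup>2)))"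
    unfolding m_def
    by (subst distributed_integral[OF X, symmetric]) (use h in \<open>auto dest: has_bochner_integral_integral_eq\<close>)
  ultimately show ?thesis by (simp add: has_bochner_integral_iff)
qed

text \<open>The preimages of Borel sets under \<open>X\<close> lie in \<open>sets F\<close>. This
  turns the independence clause of \<open>brownian_motion\<close> into a form that yields product
  formulas for expectations.\<close>

lemma (in prob_space) indep_var_of_subalgebra:
  assumes F: "subalgebra M F"
    and ind: "indep_set (sets F) (sets (vimage_algebra (space M) Y borel))"
    and X: "X \<in> borel_measurable F" and Y: "Y \<in> borel_measurable M"
  shows "indep_var borel X borel Y"
  unfolding indep_var_eq
proof (intro conjI)
  show "random_variable borel X" using measurable_from_subalg[OF F X] .
  show "random_variable borel Y" by fact
  have sF: "space F = space M" using F by (simp add: subalgebra_def)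
  have "{X -` A \<inter> space M |A. A \<in> sets borel} \<subseteq> sets F"
    using measurable_sets[OF X] by (auto simp: sF)
  then have 1: "sigma_sets (space M) {X -` A \<inter> space M |A. A \<in> sets borel} \<subseteq> sets F"
    using sets.sigma_sets_subset[of _ F] by (simp add: sF)
  have 2: "sigma_sets (space M) {Y -` A \<inter> space M |A. A \<in> sets borel} = sets (vimage_algebra (space M) Y borel)"
    by (simp add: sets_vimage_algebra)
  show "indep_set (sigma_sets (space M) {X -` A \<inter> space M |A. A \<in> sets borel})
     (sigma_sets (space M) {Y -` A \<inter> space M |A. A \<in> sets borel})"
    using ind 1 unfolding 2 indep_sets2_eq by blast
qed

text \<open>Orthogonality of martingale differences: the partial sum S times \<open>G n\<close> is
  measurable in \<open>F n\<close>, and integrable because \<open>G n\<close> is bounded, so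
  independence from the centred \<open>\<xi> n\<close> kills the cross term of the square. What
  remains is a sum of n second moments, each at most \<open>C\<^sup>2 * v\<close>.\<close>

lemma (in prob_space) martingale_transform_L2:
  fixes \<xi> G :: "nat \<Rightarrow> 'a \<Rightarrow> real" and F :: "nat \<Rightarrow> 'a measure"
  assumes sub: "\<And>k. k < n \<Longrightarrow> subalgebra M (F k)"
    and mono: "\<And>j k. j \<le> k \<Longrightarrow> k < n \<Longrightarrow> subalgebra (F k) (F j)"
    and G: "\<And>k. k < n \<Longrightarrow> G k \<in> borel_measurable (F k)"
    and \<xi>: "\<And>j k. j < k \<Longrightarrow> k < n \<Longrightarrow> \<xi> j \<in> borel_measurable (F k)"
    and bd: "\<And>k w. k < n \<Longrightarrow> w \<in> space M \<Longrightarrow> \<bar>G k w\<bar> \<le> C"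
    and ind: "\<And>k X. k < n \<Longrightarrow> X \<in> borel_measurable (F k) \<Longrightarrow> indep_var borel X borel (\<xi> k)"
    and int: "\<And>k. k < n \<Longrightarrow> integrable M (\<lambda>w. (\<xi> k w)\<^sup>2)"
    and mean: "\<And>k. k < n \<Longrightarrow> expectation (\<xi> k) = 0"
    and var: "\<And>k. k < n \<Longrightarrow> expectation (\<lambda>w. (\<xi> k w)\<^sup>2) \<le> v"
  shows "integrable M (\<lambda>w. (\<Sum>k<n. G k w * \<xi> k w)\<^sup>2) \<and>
    expectation (\<lambda>w. (\<Sum>k<n. G k w * \<xi> k w)\<^sup>2) \<le> real n * (C\<^sup>2 * v)"
  using assms
proof (induction n)
  case 0
  then show ?case by simp
next
  case (Suc n)
  define S where "S w = (\<Sum>k<n. G k w * \<xi> k w)" for w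
  have IH: "integrable M (\<lambda>w. (S w)\<^sup>2)" "expectation (\<lambda>w. (S w)\<^sup>2) \<le> real n * (C\<^sup>2 * v)"
    unfolding S_def by (rule Suc.IH[THEN conjunct1] Suc.IH[THEN conjunct2]; rule Suc.prems; simp)+
  have sn: "subalgebra M (F n)" by (rule Suc.prems) simp
  have Gj: "G k \<in> borel_measurable (F n)" if "k \<le> n" for k
    using measurable_from_subalg[OF Suc.prems(2)[of k n] Suc.prems(3)[of k]] that by simp
  have SF: "S \<in> borel_measurable (F n)"
    unfolding S_def using Gj Suc.prems(4) by (auto intro!: borel_measurable_sum borel_measurable_times)
  have SM: "S \<in> borel_measurable M" using measurable_from_subalg[OF sn SF] .
  have GM: "G n \<in> borel_measurable M" using measurable_from_subalg[OF sn Gj[of n]] by simp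
  have S1: "integrable M S" using square_integrable_imp_integrable[OF SM IH(1)] by simp
  have bd: "\<And>w. w \<in> space M \<Longrightarrow> \<bar>G n w\<bar> \<le> C" using Suc.prems(5)[of n] by auto
  have SG: "integrable M (\<lambda>w. S w * G n w)"
  proof (rule Bochner_Integration.integrable_bound[where f="\<lambda>w. C * S w"])
    show "AE w in M. norm (S w * G n w) \<le> norm (C * S w)"
    proof (rule AE_I2)
      fix w assume "w \<in> space M"
      then have "\<bar>S w\<bar> * \<bar>G n w\<bar> \<le> \<bar>S w\<bar> * \<bar>C\<bar>"
        by (intro mult_left_mono order_trans[OF bd abs_ge_self]) auto
      then show "norm (S w * G n w) \<le> norm (C * S w)" by (simp add: abs_mult mult.commute)
    qed
  qed (use S1 SM GM in auto)
  have \<xi>M: "\<xi> n \<in> borel_measurable M"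
    using Suc.prems(6)[OF lessI Gj[OF order_refl]] by (auto dest: indep_var_rv2)
  have \<xi>1: "integrable M (\<xi> n)"
    using square_integrable_imp_integrable[OF \<xi>M Suc.prems(7)[of n]] by simp
  have iv: "indep_var borel (\<lambda>w. S w * G n w) borel (\<xi> n)"
    by (rule Suc.prems(6)) (use SF Gj[of n] in auto)
  have cross: "integrable M (\<lambda>w. S w * G n w * \<xi> n w)" "expectation (\<lambda>w. S w * G n w * \<xi> n w) = 0"
    using indep_var_integrable[OF iv SG \<xi>1] indep_var_lebesgue_integral[OF iv SG \<xi>1] Suc.prems(8)[of n]
    by auto
  have le: "(G n w)\<^sup>2 * (\<xi> n w)\<^sup>2 \<le> C\<^sup>2 * (\<xi> n w)\<^sup>2" if "w \<in> space M" for w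
    using bd[OF that] by (intro mult_right_mono) (auto simp: abs_le_square_iff[symmetric])
  have sq: "integrable M (\<lambda>w. (G n w)\<^sup>2 * (\<xi> n w)\<^sup>2)"
    by (rule Bochner_Integration.integrable_bound[where f="\<lambda>w. C\<^sup>2 * (\<xi> n w)\<^sup>2"])
       (use le GM \<xi>M Suc.prems(7)[of n] in \<open>auto simp: abs_mult\<close>)
  have "expectation (\<lambda>w. (G n w)\<^sup>2 * (\<xi> n w)\<^sup>2) \<le> expectation (\<lambda>w. C\<^sup>2 * (\<xi> n w)\<^sup>2)"
    by (rule integral_mono) (use le sq Suc.prems(7)[of n] in auto)
  also have "\<dots> \<le> C\<^sup>2 * v" using Suc.prems(9)[of n] by (auto intro: mult_left_mono)
  finally have sqle: "expectation (\<lambda>w. (G n w)\<^sup>2 * (\<xi> n w)\<^sup>2) \<le> C\<^sup>2 * v" .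
  have eq: "(\<Sum>k<Suc n. G k w * \<xi> k w)\<^sup>2 = (S w)\<^sup>2 + 2 * (S w * G n w * \<xi> n w) + (G n w)\<^sup>2 * (\<xi> n w)\<^sup>2" for w
    by (simp add: S_def[symmetric] power2_eq_square algebra_simps)
  have "expectation (\<lambda>w. (\<Sum>k<Suc n. G k w * \<xi> k w)\<^sup>2) =
     expectation (\<lambda>w. (S w)\<^sup>2) + 2 * 0 + expectation (\<lambda>w. (G n w)\<^sup>2 * (\<xi> n w)\<^sup>2)"
    unfolding eq using IH(1) cross sq by simp
  moreover have "integrable M (\<lambda>w. (\<Sum>k<Suc n. G k w * \<xi> k w)\<^sup>2)"
    unfolding eq using IH(1) cross sq by auto
  ultimately show ?case using IH(2) sqle by (simp add: algebra_simps)
qed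

section \<open>Deterministic bounds and moduli of continuity for paths\<close>

lemma (in prob_space) exists_prob_gt_of_incseq:
  fixes A :: "nat \<Rightarrow> 'a set"
  assumes "incseq A" "\<And>n. A n \<in> events" "(\<Union>n. A n) = space M" "0 < \<zeta>"
  shows "\<exists>n. 1 - \<zeta> < prob (A n)"
proof -
  have "(\<lambda>n. prob (A n)) \<longlonglongrightarrow> 1"
    using finite_Lim_measure_incseq[of A] assms by (auto simp: prob_space)
  from order_tendstoD(1)[OF this, of "1 - \<zeta>"] assms(4) show ?thesis
    by (auto dest: eventually_happens simp: eventually_sequentially)
qed

lemma exists_rational_sequence:
  fixes t T :: real
  assumes "t \<in> {0..T}"
  obtains q where "\<And>n. q n \<in> \<rat> \<inter> {0..T}" "q \<longlonglongrightarrow> t"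
proof -
  \<comment> \<open>Rounding down keeps the sequence inside the interval even for t = T. At n = 0
    the division by zero gives 0, which lies there too.\<close>
  define q where "q n = of_int \<lfloor>real n * t\<rfloor> / real n" for n :: nat
  have "q n \<in> \<rat> \<inter> {0..T}" for n
  proof -
    have "q n \<le> t" 
      using assms by (cases "n = 0") (auto simp: q_def field_simps)
    moreover have "0 \<le> q n" using assms by (auto simp: q_def)
    ultimately show ?thesis using assms by (auto simp: q_def)
  qed
  moreover have "q \<longlonglongrightarrow> t"
    unfolding q_def by real_asymp
  ultimately show ?thesis by (rule that)
qed

text \<open>Restricting to rational times makes the event measurable; path continuity then extends
  the bound to the whole interval. The gain is a \<open>K\<close> that does not depend on the sample
  point, paid for by an exceptional event of probability below \<open>\<zeta>\<close>.\<close>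

lemma (in prob_space) continuous_process_bounded:
  fixes X :: "real \<Rightarrow> 'a \<Rightarrow> real"
  assumes X: "\<And>t. 0 \<le> t \<Longrightarrow> X t \<in> borel_measurable M"
    and cont: "\<And>w. w \<in> space M \<Longrightarrow> continuous_on {0..} (\<lambda>t. X t w)"
    and "0 < \<zeta>"
  obtains A K where "A \<in> events" "1 - \<zeta> < prob A" "0 < K"
    "\<And>w t. w \<in> A \<Longrightarrow> t \<in> {0..T} \<Longrightarrow> \<bar>X t w\<bar> \<le> K"
proof -
  define A where "A n = {w \<in> space M. \<forall>q\<in>\<rat> \<inter> {0..T}. \<bar>X q w\<bar> \<le> real (Suc n)}" for n
  have "A n \<in> events" for n
    unfolding A_def using X
    by (intro sets.sets_Collect_countable_All' countable_Int1 countable_rat) auto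
  moreover have "incseq A" by (auto simp: incseq_def A_def intro: order_trans)
  moreover have "(\<Union>n. A n) = space M"
  proof (intro equalityI subsetI)
    fix w assume w: "w \<in> space M"
    have "compact ((\<lambda>t. X t w) ` {0..T})"
      by (intro compact_continuous_image continuous_on_subset[OF cont[OF w]]) auto
    then obtain c where c: "\<And>t. t \<in> {0..T} \<Longrightarrow> \<bar>X t w\<bar> \<le> c"
      using compact_imp_bounded bounded_iff by (metis imageI real_norm_def)
    obtain n where "c \<le> real n" using real_arch_simple by blast
    then have "w \<in> A n" using c w by (force simp: A_def)
    then show "w \<in> (\<Union>n. A n)" by auto
  qed (auto simp: A_def)
  ultimately obtain n where n: "1 - \<zeta> < prob (A n)"
    using exists_prob_gt_of_incseq \<open>0 < \<zeta>\<close> by meson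
  show ?thesis
  proof (rule that[of "A n" "real (Suc n)"])
    fix w t assume w: "w \<in> A n" and t: "t \<in> {0..T}"
    obtain q where q: "\<And>n. q n \<in> \<rat> \<inter> {0..T}" "q \<longlonglongrightarrow> t"
      using exists_rational_sequence[OF t] by blast
    have "(\<lambda>k. X (q k) w) \<longlonglongrightarrow> X t w"
      by (rule continuous_on_tendsto_compose[OF cont q(2)]) (use w t q(1) in \<open>auto simp: A_def\<close>)
    then have "(\<lambda>k. \<bar>X (q k) w\<bar>) \<longlonglongrightarrow> \<bar>X t w\<bar>" by (rule tendsto_rabs)
    then show "\<bar>X t w\<bar> \<le> real (Suc n)"
      by (rule LIMSEQ_le_const2) (use w q(1) in \<open>auto simp: A_def\<close>)
  qed (use n \<open>A n \<in> events\<close> in auto)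
qed

text \<open>Each path is uniformly continuous on the compact interval, with a modulus of its own;
  the increasing events \<open>A n\<close> collect the paths that share the modulus 1 / (n +
  1).\<close>

lemma (in prob_space) continuous_process_modulus:
  fixes X :: "real \<Rightarrow> 'a \<Rightarrow> real"
  assumes X: "\<And>t. 0 \<le> t \<Longrightarrow> X t \<in> borel_measurable M"
    and cont: "\<And>w. w \<in> space M \<Longrightarrow> continuous_on {0..} (\<lambda>t. X t w)"
    and "0 < \<zeta>" "0 < \<epsilon>"
  obtains A \<delta> where "A \<in> events" "1 - \<zeta> < prob A" "0 < \<delta>"
    "\<And>w s t. w \<in> A \<Longrightarrow> s \<in> {0..T} \<Longrightarrow> t \<in> {0..T} \<Longrightarrow> \<bar>s - t\<bar> < \<delta> \<Longrightarrow> \<bar>X s w - X t w\<bar> \<le> \<epsilon>"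
proof -
  define A where "A n = {w \<in> space M. \<forall>s\<in>\<rat> \<inter> {0..T}. \<forall>t\<in>\<rat> \<inter> {0..T}.
     \<bar>s - t\<bar> < 1 / real (Suc n) \<longrightarrow> \<bar>X s w - X t w\<bar> \<le> \<epsilon>}" for n
  have "A n \<in> events" for n
    unfolding A_def using X
    by (intro sets.sets_Collect_countable_All' countable_Int1 countable_rat sets.sets_Collect_imp) auto
  moreover have "incseq A"
  proof (rule incseq_SucI)
    fix n
    have "1 / real (Suc (Suc n)) \<le> 1 / real (Suc n)" by (simp add: field_simps)
    then show "A n \<subseteq> A (Suc n)" unfolding A_def by (blast intro: less_le_trans)
  qed
  moreover have "(\<Union>n. A n) = space M"
  proof (intro equalityI subsetI)
    fix w assume w: "w \<in> space M"
    have "uniformly_continuous_on {0..T} (\<lambda>t. X t w)"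
      by (intro compact_uniformly_continuous continuous_on_subset[OF cont[OF w]]) auto
    then obtain d where d: "0 < d" "\<And>s t. s \<in> {0..T} \<Longrightarrow> t \<in> {0..T} \<Longrightarrow> \<bar>s - t\<bar> < d \<Longrightarrow> \<bar>X s w - X t w\<bar> < \<epsilon>"
      using \<open>0 < \<epsilon>\<close> unfolding uniformly_continuous_on_def dist_real_def by metis
    obtain n where "1 / real (Suc n) < d" using d(1) nat_approx_posE by blast
    then have "w \<in> A n" using d w by (fastforce simp: A_def intro: less_imp_le)
    then show "w \<in> (\<Union>n. A n)" by auto
  qed (auto simp: A_def)
  ultimately obtain n where n: "1 - \<zeta> < prob (A n)"
    using exists_prob_gt_of_incseq \<open>0 < \<zeta>\<close> by meson
  show ?thesis
  proof (rule that[of "A n" "1 / real (Suc n)"])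
    fix w s t assume w: "w \<in> A n" and s: "s \<in> {0..T}" and t: "t \<in> {0..T}" and st: "\<bar>s - t\<bar> < 1 / real (Suc n)"
    obtain q where q: "\<And>n. q n \<in> \<rat> \<inter> {0..T}" "q \<longlonglongrightarrow> t"
      using exists_rational_sequence[OF t] by blast
    obtain r where r: "\<And>n. r n \<in> \<rat> \<inter> {0..T}" "r \<longlonglongrightarrow> s"
      using exists_rational_sequence[OF s] by blast
    have "(\<lambda>k. X (q k) w) \<longlonglongrightarrow> X t w"
      by (rule continuous_on_tendsto_compose[OF cont q(2)]) (use w t q(1) in \<open>auto simp: A_def\<close>)
    moreover have "(\<lambda>k. X (r k) w) \<longlonglongrightarrow> X s w"
      by (rule continuous_on_tendsto_compose[OF cont r(2)]) (use w s r(1) in \<open>auto simp: A_def\<close>)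
    ultimately have "(\<lambda>k. \<bar>X (r k) w - X (q k) w\<bar>) \<longlonglongrightarrow> \<bar>X s w - X t w\<bar>"
      by (intro tendsto_intros)
    \<comment> \<open>The condition on \<open>\<bar>s - t\<bar>\<close> is open, so the rational
      approximants satisfy it from some index on; the bound by \<open>\<epsilon>\<close> is closed
      and survives the limit.\<close>
    moreover have "(\<lambda>k. \<bar>r k - q k\<bar>) \<longlonglongrightarrow> \<bar>s - t\<bar>"
      by (intro tendsto_intros q r)
    then have "eventually (\<lambda>k. \<bar>r k - q k\<bar> < 1 / real (Suc n)) sequentially"
      using st by (rule order_tendstoD(2))
    then have "eventually (\<lambda>k. \<bar>X (r k) w - X (q k) w\<bar> \<le> \<epsilon>) sequentially"
      by eventually_elim (use w q(1) r(1) in \<open>auto simp: A_def\<close>)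
    ultimately show "\<bar>X s w - X t w\<bar> \<le> \<epsilon>"
      by (intro tendsto_upperbound[OF _ _ sequentially_bot])
  qed (use n \<open>A n \<in> events\<close> in auto)
qed

section \<open>Increments of Brownian motion\<close>

locale bm_space = prob_space M for M :: "'a measure" +
  fixes F :: "real \<Rightarrow> 'a measure" and B :: "real \<Rightarrow> 'a \<Rightarrow> real"
  assumes bm: "brownian_motion M F B"
begin

lemma filtration_subalgebra: "0 \<le> t \<Longrightarrow> subalgebra M (F t)"
  and filtration_mono: "0 \<le> s \<Longrightarrow> s \<le> t \<Longrightarrow> subalgebra (F t) (F s)"
  and B_adapted: "0 \<le> t \<Longrightarrow> B t \<in> borel_measurable (F t)"
  and B_0: "w \<in> space M \<Longrightarrow> B 0 w = 0"
  and B_continuous: "w \<in> space M \<Longrightarrow> continuous_on {0..} (\<lambda>t. B t w)"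
  using bm unfolding brownian_motion_def by auto

lemma filtration_measurable_mono:
  "0 \<le> s \<Longrightarrow> s \<le> t \<Longrightarrow> X \<in> borel_measurable (F s) \<Longrightarrow> X \<in> borel_measurable (F t)"
  using measurable_from_subalg[OF filtration_mono] by blast

lemma filtration_measurable: "0 \<le> t \<Longrightarrow> X \<in> borel_measurable (F t) \<Longrightarrow> X \<in> borel_measurable M"
  using measurable_from_subalg[OF filtration_subalgebra] by blast

lemma B_measurable: "0 \<le> t \<Longrightarrow> B t \<in> borel_measurable M"
  using filtration_measurable B_adapted by blast

lemma increment_distributed:
  "0 \<le> s \<Longrightarrow> 0 < h \<Longrightarrow>
    distributed M lborel (\<lambda>w. B (s + h) w - B s w) (\<lambda>x. ennreal (normal_density 0 (sqrt h) x))"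
proof -
  assume h: "0 \<le> s" "0 < h"
  have *: "\<forall>s\<ge>0. \<forall>t>s. distributed M lborel (\<lambda>w. B t w - B s w) (\<lambda>x. ennreal (normal_density 0 (sqrt (t - s)) x))"
    using bm unfolding brownian_motion_def by blast
  show ?thesis using *[rule_format, OF h(1), of "s + h"] h by simp
qed

lemma increment_indep:
  assumes "0 \<le> s" "0 < h" "X \<in> borel_measurable (F s)"
  shows "indep_var borel X borel (\<lambda>w. B (s + h) w - B s w)"
proof (rule indep_var_of_subalgebra)
  show "indep_set (sets (F s)) (sets (vimage_algebra (space M) (\<lambda>w. B (s + h) w - B s w) borel))"
  proof -
    have "\<forall>s\<ge>0. \<forall>t>s. indep_set (sets (F s)) (sets (vimage_algebra (space M) (\<lambda>w. B t w - B s w) borel))"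
      using bm unfolding brownian_motion_def by blast
    then show ?thesis using assms by simp
  qed
qed (use assms filtration_subalgebra B_measurable in auto)

lemma increment_exp_quadratic:
  assumes "0 \<le> s" "0 < h"
  shows "has_bochner_integral M
     (\<lambda>w. exp (a * (B (s + h) w - B s w)) * (c0 + c1 * (B (s + h) w - B s w) + c2 * (B (s + h) w - B s w)\<^sup>2))
     (exp (a\<^sup>2 * h / 2) * (c0 + c1 * (a * h) + c2 * (h + (a * h)\<^sup>2)))"
  using has_bochner_integral_gaussian_exp_quadratic[OF _ increment_distributed[OF assms], of a c0 c1 c2] assms
  by simp

text \<open>On the coarse grid \<open>f\<close> will be the centred one-step factor
  \<open>step h\<close>, on the fine grid the identity. The grid may start at any nonnegative
  \<open>s 0\<close>, which also covers sums inside a single coarse interval.\<close>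

lemma increment_transform_L2:
  fixes G :: "nat \<Rightarrow> 'a \<Rightarrow> real" and f :: "real \<Rightarrow> real" and s :: "nat \<Rightarrow> real"
  assumes s0: "0 \<le> s 0" and h: "0 < h" and s: "\<And>k. s (Suc k) = s k + h"
    and f: "f \<in> borel_measurable borel"
    and G: "\<And>k. k < n \<Longrightarrow> G k \<in> borel_measurable (F (s k))"
    and bd: "\<And>k w. k < n \<Longrightarrow> w \<in> space M \<Longrightarrow> \<bar>G k w\<bar> \<le> C"
    and mean: "\<And>t. 0 \<le> t \<Longrightarrow> expectation (\<lambda>w. f (B (t + h) w - B t w)) = 0"
    and var: "\<And>t. 0 \<le> t \<Longrightarrow> has_bochner_integral M (\<lambda>w. (f (B (t + h) w - B t w))\<^sup>2) v"
  shows "integrable M (\<lambda>w. (\<Sum>k<n. G k w * f (B (s (Suc k)) w - B (s k) w))\<^sup>2) \<and>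
    expectation (\<lambda>w. (\<Sum>k<n. G k w * f (B (s (Suc k)) w - B (s k) w))\<^sup>2) \<le> real n * (C\<^sup>2 * v)"
proof -
  have sk: "s k = s 0 + real k * h" for k
    by (induction k) (auto simp: s algebra_simps)
  have sn: "0 \<le> s k" for k using s0 h by (simp add: sk[of k])
  have smono: "s j \<le> s k" if "j \<le> k" for j k
    using that h by (simp add: sk[of k] sk[of j] mult_right_mono)
  show ?thesis
  proof (rule martingale_transform_L2[where F = "\<lambda>k. F (s k)"])
    fix j k assume "j < k" "k < n"
    then have *: "s (Suc j) \<le> s k" by (intro smono) simp
    have "s j \<le> s k" using \<open>j < k\<close> by (intro smono) simp
    then have "(\<lambda>w. B (s (Suc j)) w - B (s j) w) \<in> borel_measurable (F (s k))"
      using filtration_measurable_mono[OF sn * B_adapted[OF sn]]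
        filtration_measurable_mono[OF sn _ B_adapted[OF sn]] by auto
    then show "(\<lambda>w. f (B (s (Suc j)) w - B (s j) w)) \<in> borel_measurable (F (s k))"
      using f by measurable
  next
    fix k and X :: "'a \<Rightarrow> real" assume X: "X \<in> borel_measurable (F (s k))"
    have "indep_var borel (id \<circ> X) borel (f \<circ> (\<lambda>w. B (s (Suc k)) w - B (s k) w))"
      using increment_indep[OF sn h X] f unfolding s by (intro indep_var_compose) auto
    then show "indep_var borel X borel (\<lambda>w. f (B (s (Suc k)) w - B (s k) w))"
      by (simp add: comp_def)
  qed (use filtration_subalgebra[OF sn] filtration_mono[OF sn smono] G bd mean[OF sn] var[OF sn] in
      \<open>auto simp: s has_bochner_integral_iff\<close>)
qed

end

definition clip :: "real \<Rightarrow> real \<Rightarrow> real" where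
  "clip c x = max (- c) (min c x)"

lemma clip_measurable [measurable]: "clip c \<in> borel_measurable borel"
  unfolding clip_def by measurable

lemma abs_clip_le: "0 \<le> c \<Longrightarrow> \<bar>clip c x\<bar> \<le> c"
  by (auto simp: clip_def)

lemma clip_eq: "\<bar>x\<bar> \<le> c \<Longrightarrow> clip c x = x"
  by (auto simp: clip_def)

section \<open>Moments of the price ratio over one step\<close>

locale price_space = bm_space M F B
  for M :: "'a measure" and F :: "real \<Rightarrow> 'a measure" and B :: "real \<Rightarrow> 'a \<Rightarrow> real" +
  fixes P :: "real \<Rightarrow> 'a \<Rightarrow> real" and \<sigma> \<mu> :: real
  assumes price: "external_price M F B \<mu> \<sigma> P"
    and \<mu>: "\<mu> = \<sigma>\<^sup>2 / 2" and \<sigma>: "0 < \<sigma>"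
begin

lemma P_adapted: "0 \<le> t \<Longrightarrow> P t \<in> borel_measurable (F t)"
  and P_continuous: "w \<in> space M \<Longrightarrow> continuous_on {0..} (\<lambda>t. P t w)"
  and P_pos: "w \<in> space M \<Longrightarrow> 0 \<le> t \<Longrightarrow> 0 < P t w"
  and P_ito: "0 \<le> t \<Longrightarrow> has_ito_integral M (\<lambda>s w. \<sigma> * P s w) B t
        (\<lambda>w. P t w - P 0 w - integral {0..t} (\<lambda>s. \<mu> * P s w))"
  using price unfolding external_price_def by auto

lemma P_measurable: "0 \<le> t \<Longrightarrow> P t \<in> borel_measurable M"
  using filtration_measurable P_adapted by blast

lemma P_integrable:
  assumes "w \<in> space M" "0 \<le> a"
  shows "(\<lambda>t. \<mu> * P t w) integrable_on {a..b}"
  by (intro integrable_continuous_interval continuous_intros continuous_on_subset[OF P_continuous])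
     (use assms in auto)

text \<open>Mean and variance of \<open>(1 + \<sigma> x + \<mu> h) exp (- \<sigma> x)\<close> for \<open>x\<close> a Brownian increment over
  time \<open>h\<close>, written in terms of \<open>u = \<sigma>\<^sup>2 h\<close>.\<close>

definition step_mean :: "real \<Rightarrow> real" where
  "step_mean u = exp (u / 2) * (1 - u / 2)"

definition step_var :: "real \<Rightarrow> real" where
  "step_var u = exp (2 * u) * (1 - 2 * u + 9 / 4 * u\<^sup>2) - (step_mean u)\<^sup>2"

text \<open>The bracket is one Euler step of the price equation and the exponential is the change of
  exp (- \<sigma> B); their product, centred, is the factor by which the ratio would move if the
  price followed the Euler scheme.\<close>

definition step :: "real \<Rightarrow> real \<Rightarrow> real" where
  "step h x = (1 + \<sigma> * x + \<mu> * h) * exp (- \<sigma> * x) - step_mean (\<sigma>\<^sup>2 * h)"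

text \<open>Here the value of \<open>\<mu>\<close> matters: the tilt by - \<sigma> contributes u / 2
  - u to the linear term of the mean, and \<mu> h = u / 2 cancels it. The mean is therefore 1 up to
  order \<open>u\<^sup>2\<close>, and the variance has order \<open>u\<^sup>2\<close> as
  well.\<close>

lemma step_moments:
  assumes "0 \<le> t" "0 < h"
  shows "has_bochner_integral M (\<lambda>w. step h (B (t + h) w - B t w)) 0"
    and "has_bochner_integral M (\<lambda>w. (step h (B (t + h) w - B t w))\<^sup>2) (step_var (\<sigma>\<^sup>2 * h))"
proof -
  define u where "u = \<sigma>\<^sup>2 * h"
  let ?x = "\<lambda>w. B (t + h) w - B t w"
  let ?f = "\<lambda>w. (1 + \<sigma> * ?x w + \<mu> * h) * exp (- \<sigma> * ?x w)"
  have one: "has_bochner_integral M (\<lambda>w. c) (c::real)" for c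
    by (simp add: has_bochner_integral_iff prob_space)
  have f1: "has_bochner_integral M ?f (step_mean u)"
  proof -
    have "exp ((- \<sigma>)\<^sup>2 * h / 2) * ((1 + u / 2) + \<sigma> * (- \<sigma> * h) + 0 * (h + (- \<sigma> * h)\<^sup>2)) = step_mean u"
      by (simp add: step_mean_def u_def power2_eq_square)
    moreover have "exp (- \<sigma> * ?x w) * ((1 + u / 2) + \<sigma> * ?x w + 0 * (?x w)\<^sup>2) = ?f w" for w
      by (simp add: u_def \<mu>)
    ultimately show ?thesis
      using increment_exp_quadratic[OF assms, of "- \<sigma>" "1 + u / 2" \<sigma> 0] by (simp only:)
  qed
  have f2: "has_bochner_integral M (\<lambda>w. (?f w)\<^sup>2) (exp (2 * u) * (1 - 2 * u + 9 / 4 * u\<^sup>2))"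
  proof -
    have "exp ((- 2 * \<sigma>)\<^sup>2 * h / 2) * ((1 + u / 2)\<^sup>2 + 2 * (1 + u / 2) * \<sigma> * (- 2 * \<sigma> * h) + \<sigma>\<^sup>2 * (h + (- 2 * \<sigma> * h)\<^sup>2))
       = exp (2 * u) * (1 - 2 * u + 9 / 4 * u\<^sup>2)"
    proof -
      have "(- 2 * \<sigma>)\<^sup>2 * h / 2 = 2 * u" by (simp add: u_def power2_eq_square)
      moreover have "(1 + u / 2)\<^sup>2 + 2 * (1 + u / 2) * \<sigma> * (- 2 * \<sigma> * h) + \<sigma>\<^sup>2 * (h + (- 2 * \<sigma> * h)\<^sup>2)
         = 1 - 2 * u + 9 / 4 * u\<^sup>2"
        by (simp add: u_def power2_eq_square algebra_simps)
      ultimately show ?thesis by simp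
    qed
    moreover have "exp (- 2 * \<sigma> * ?x w) * ((1 + u / 2)\<^sup>2 + 2 * (1 + u / 2) * \<sigma> * ?x w + \<sigma>\<^sup>2 * (?x w)\<^sup>2) = (?f w)\<^sup>2" for w
    proof -
      have "exp (- 2 * \<sigma> * ?x w) = (exp (- \<sigma> * ?x w))\<^sup>2"
        by (simp add: exp_double[symmetric] mult.assoc)
      then show ?thesis
        by (simp add: u_def \<mu> power2_eq_square algebra_simps)
    qed
    ultimately show ?thesis
      using increment_exp_quadratic[OF assms, of "- 2 * \<sigma>" "(1 + u / 2)\<^sup>2" "2 * (1 + u / 2) * \<sigma>" "\<sigma>\<^sup>2"] by simp
  qed
  show "has_bochner_integral M (\<lambda>w. step h (?x w)) 0"
    using has_bochner_integral_diff[OF f1 one[of "step_mean u"]] by (simp add: step_def u_def)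
  have "has_bochner_integral M (\<lambda>w. (?f w)\<^sup>2 - 2 * step_mean u * ?f w + (step_mean u)\<^sup>2)
     (exp (2 * u) * (1 - 2 * u + 9 / 4 * u\<^sup>2) - 2 * step_mean u * step_mean u + (step_mean u)\<^sup>2)"
    by (intro has_bochner_integral_diff has_bochner_integral_add has_bochner_integral_mult_right f1 f2 one)
  moreover have "exp (2 * u) * (1 - 2 * u + 9 / 4 * u\<^sup>2) - 2 * step_mean u * step_mean u + (step_mean u)\<^sup>2 = step_var u"
    by (simp add: step_var_def power2_eq_square)
  moreover have "(?f w)\<^sup>2 - 2 * step_mean u * ?f w + (step_mean u)\<^sup>2 = (step h (?x w))\<^sup>2" for w
    unfolding step_def u_def[symmetric] by (simp add: power2_diff)
  ultimately show "has_bochner_integral M (\<lambda>w. (step h (?x w))\<^sup>2) (step_var (\<sigma>\<^sup>2 * h))"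
    by (simp add: u_def)
qed

lemma exp_increment_moment:
  assumes "0 \<le> t" "0 < h"
  shows "has_bochner_integral M (\<lambda>w. (exp (- \<sigma> * (B (t + h) w - B t w)) - 1)\<^sup>2)
    (exp (2 * (\<sigma>\<^sup>2 * h)) - 2 * exp (\<sigma>\<^sup>2 * h / 2) + 1)"
proof -
  let ?x = "\<lambda>w. B (t + h) w - B t w"
  have one: "has_bochner_integral M (\<lambda>w. c) (c::real)" for c
    by (simp add: has_bochner_integral_iff prob_space)
  have 1: "has_bochner_integral M (\<lambda>w. exp (- \<sigma> * ?x w)) (exp (\<sigma>\<^sup>2 * h / 2))"
    using increment_exp_quadratic[OF assms, of "- \<sigma>" 1 0 0] by simp
  have 2: "has_bochner_integral M (\<lambda>w. exp (- 2 * \<sigma> * ?x w)) (exp (2 * (\<sigma>\<^sup>2 * h)))"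
    using increment_exp_quadratic[OF assms, of "- 2 * \<sigma>" 1 0 0] by (simp add: power_mult_distrib mult_ac)
  have "has_bochner_integral M (\<lambda>w. exp (- 2 * \<sigma> * ?x w) - 2 * exp (- \<sigma> * ?x w) + 1)
    (exp (2 * (\<sigma>\<^sup>2 * h)) - 2 * exp (\<sigma>\<^sup>2 * h / 2) + 1)"
    by (intro has_bochner_integral_diff has_bochner_integral_add has_bochner_integral_mult_right 1 2 one)
  moreover have "exp (- 2 * \<sigma> * x) - 2 * exp (- \<sigma> * x) + 1 = (exp (- \<sigma> * x) - 1)\<^sup>2" for x
    by (simp add: power2_diff exp_double[symmetric] mult.assoc)
  ultimately show ?thesis by simp
qed

lemma increment_second_moment:
  assumes "0 \<le> t" "0 < h"
  shows "has_bochner_integral M (\<lambda>w. (B (t + h) w - B t w)\<^sup>2) h"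
    and "has_bochner_integral M (\<lambda>w. B (t + h) w - B t w) 0"
  using increment_exp_quadratic[OF assms, of 0 0 0 1] increment_exp_quadratic[OF assms, of 0 0 1 0]
  by simp_all

end

section \<open>Pathwise telescoping and the size of one coarse step\<close>

lemma sum_blocks:
  fixes g :: "nat \<Rightarrow> real"
  shows "(\<Sum>l<n * m. g l) = (\<Sum>k<n. \<Sum>j<m. g (k * m + j))"
proof (induction n)
  case (Suc n)
  have "(\<Sum>l<n * m + i. g l) = (\<Sum>l<n * m. g l) + (\<Sum>j<i. g (n * m + j))" for i
    by (induction i) (auto simp: algebra_simps)
  from this[of m] Suc show ?case by (simp add: add.commute)
qed simp

text \<open>Here p and u stand for the price and exp (- \<sigma> B) along the coarse grid, J for the
  drift integral, e for the variation of the price inside a coarse interval, r for the Riemann-sum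
  error and \<open>M0\<close> for the mean of the Euler factor. The first two sums keep the absolute
  value outside, because they are small only through cancellation in \<open>L\<^sup>2\<close>; the
  rest is bounded term by term.\<close>

lemma ratio_telescope:
  fixes p u b J e r :: "nat \<Rightarrow> real" and \<sigma> \<mu> h \<epsilon> \<rho> K M0 :: real
  assumes p: "\<And>k. k < n \<Longrightarrow> p (Suc k) = p k + J k + \<sigma> * p k * b k + e k + r k"
    and u: "\<And>k. k < n \<Longrightarrow> u (Suc k) = u k * exp (- \<sigma> * b k)"
    and uK: "\<And>k. k \<le> n \<Longrightarrow> \<bar>u k\<bar> \<le> K" and pK: "\<And>k. k \<le> n \<Longrightarrow> \<bar>p k\<bar> \<le> K"
    and J: "\<And>k. k < n \<Longrightarrow> \<bar>J k - \<mu> * h * p k\<bar> \<le> \<mu> * h * \<epsilon>"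
    and r: "\<And>k. k < n \<Longrightarrow> \<bar>r k\<bar> \<le> \<rho>"
  shows "\<bar>p n * u n - p 0 * u 0\<bar> \<le>
    \<bar>\<Sum>k<n. p k * u k * ((1 + \<sigma> * b k + \<mu> * h) * exp (- \<sigma> * b k) - M0)\<bar>
    + \<bar>\<Sum>k<n. u k * e k\<bar> + K * (\<Sum>k<n. \<bar>exp (- \<sigma> * b k) - 1\<bar> * \<bar>e k\<bar>)
    + real n * (K\<^sup>2 * \<bar>M0 - 1\<bar>) + real n * (K * (\<mu> * h * \<epsilon> + \<rho>))"
proof -
  define E where "E k = exp (- \<sigma> * b k)" for k
  have K: "0 \<le> K" using uK[of 0] by simp
  \<comment> \<open>Splitting \<open>E k\<close> as 1 + (\<open>E k\<close> - 1) in front of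
    \<open>e k\<close> isolates \<open>u k * e k\<close>, whose coefficient is known at the start of
    the interval; the remainder is a product of two small factors.\<close>
  have step: "p (Suc k) * u (Suc k) - p k * u k =
     p k * u k * ((1 + \<sigma> * b k + \<mu> * h) * E k - M0) + u k * e k + u k * ((E k - 1) * e k)
     + p k * u k * (M0 - 1) + u (Suc k) * (J k - \<mu> * h * p k + r k)" if "k < n" for k
    unfolding u[OF that] p[OF that] E_def[symmetric] by (simp add: algebra_simps)
  have "p n * u n - p 0 * u 0 = (\<Sum>k<n. p (Suc k) * u (Suc k) - p k * u k)"
    by (rule sum_lessThan_telescope[symmetric])
  also have "\<dots> = (\<Sum>k<n. p k * u k * ((1 + \<sigma> * b k + \<mu> * h) * E k - M0)) + (\<Sum>k<n. u k * e k)
     + (\<Sum>k<n. u k * ((E k - 1) * e k)) + (\<Sum>k<n. p k * u k * (M0 - 1))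
     + (\<Sum>k<n. u (Suc k) * (J k - \<mu> * h * p k + r k))"
    unfolding sum.distrib[symmetric] by (intro sum.cong refl step) simp
  finally have eq: "p n * u n - p 0 * u 0 = \<dots>" .
  have 1: "\<bar>\<Sum>k<n. u k * ((E k - 1) * e k)\<bar> \<le> K * (\<Sum>k<n. \<bar>E k - 1\<bar> * \<bar>e k\<bar>)"
    unfolding sum_distrib_left
    by (intro order_trans[OF sum_abs] sum_mono) (auto simp: abs_mult intro!: mult_right_mono uK)
  have 2: "\<bar>\<Sum>k<n. p k * u k * (M0 - 1)\<bar> \<le> real n * (K\<^sup>2 * \<bar>M0 - 1\<bar>)"
  proof -
    have "\<bar>\<Sum>k<n. p k * u k * (M0 - 1)\<bar> \<le> (\<Sum>k<n. K\<^sup>2 * \<bar>M0 - 1\<bar>)"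
      by (intro order_trans[OF sum_abs] sum_mono)
         (auto simp: abs_mult power2_eq_square K intro!: mult_right_mono mult_mono uK pK)
    then show ?thesis by simp
  qed
  have 3: "\<bar>\<Sum>k<n. u (Suc k) * (J k - \<mu> * h * p k + r k)\<bar> \<le> real n * (K * (\<mu> * h * \<epsilon> + \<rho>))"
  proof -
    have "\<bar>\<Sum>k<n. u (Suc k) * (J k - \<mu> * h * p k + r k)\<bar> \<le> (\<Sum>k<n. K * (\<mu> * h * \<epsilon> + \<rho>))"
    proof (intro order_trans[OF sum_abs] sum_mono)
      fix k assume "k \<in> {..<n}"
      then have k: "k < n" by simp
      have "\<bar>J k - \<mu> * h * p k + r k\<bar> \<le> \<mu> * h * \<epsilon> + \<rho>"
        using J[OF k] r[OF k] by linarith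
      then show "\<bar>u (Suc k) * (J k - \<mu> * h * p k + r k)\<bar> \<le> K * (\<mu> * h * \<epsilon> + \<rho>)"
        unfolding abs_mult using k by (intro mult_mono uK K) auto
    qed
    then show ?thesis by simp
  qed
  show ?thesis unfolding E_def[symmetric] using eq 1 2 3 by linarith
qed

text \<open>With u = c / n, the first two quantities have order \<open>u\<^sup>2\<close> and
  disappear after summing n of them. The third is u to first order, so its n-fold sum stays bounded,
  and smallness has to come from another factor.\<close>

lemma step_asymptotics:
  fixes c :: real
  assumes "0 < c"
  shows "(\<lambda>n. real n * (exp (c / real n / 2) * (1 - c / real n / 2) - 1)) \<longlonglongrightarrow> 0"
    and "(\<lambda>n. real n * (exp (2 * (c / real n)) * (1 - 2 * (c / real n) + 9 / 4 * (c / real n)\<^sup>2)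
        - (exp (c / real n / 2) * (1 - c / real n / 2))\<^sup>2)) \<longlonglongrightarrow> 0"
    and "(\<lambda>n. real n * (exp (2 * (c / real n)) - 2 * exp (c / real n / 2) + 1)) \<longlonglongrightarrow> c"
  using assms by real_asymp+

section \<open>The price process\<close>

context price_space begin

text \<open>The constants count errors: each of the five terms of \<open>ratio_telescope\<close> is
  at most \<open>\<zeta>\<close> outside seven exceptional sets of probability at most
  \<open>\<zeta>\<close>. The parameters are fixed in the order \<open>K\<close>,
  \<open>\<epsilon>\<close>, \<open>n\<close>, \<open>\<eta>\<close>, fine mesh, each depending on
  the earlier ones.\<close>

lemma ratio_estimate:
  assumes T: "0 < T" and \<zeta>: "0 < \<zeta>"
  shows "prob {w \<in> space M. 5 * \<zeta> < \<bar>P T w * exp (- \<sigma> * B T w) - P 0 w\<bar>} \<le> 7 * \<zeta>"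
proof -
  define U where "U t w = exp (- \<sigma> * B t w)" for t w
  have U_adapted: "U t \<in> borel_measurable (F t)" if "0 \<le> t" for t
    using B_adapted[OF that] unfolding U_def by measurable
  have U_M: "U t \<in> borel_measurable M" if "0 \<le> t" for t
    using B_measurable[OF that] unfolding U_def by measurable
  have U_cont: "continuous_on {0..} (\<lambda>t. U t w)" if "w \<in> space M" for w
    unfolding U_def by (intro continuous_intros B_continuous that)
  obtain A1 K1 where A1: "A1 \<in> events" "1 - \<zeta> < prob A1" and K1: "0 < K1"
    "\<And>w t. w \<in> A1 \<Longrightarrow> t \<in> {0..T} \<Longrightarrow> \<bar>P t w\<bar> \<le> K1"
    using continuous_process_bounded[OF P_measurable P_continuous \<zeta>, of T] by metis
  obtain A2 K2 where A2: "A2 \<in> events" "1 - \<zeta> < prob A2" and K2: "0 < K2"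
    "\<And>w t. w \<in> A2 \<Longrightarrow> t \<in> {0..T} \<Longrightarrow> \<bar>U t w\<bar> \<le> K2"
    using continuous_process_bounded[OF U_M U_cont \<zeta>, of T] by metis
  define K where "K = max K1 K2"
  have K: "0 < K" using K1 by (simp add: K_def)
  have PK: "\<bar>P t w\<bar> \<le> K" if "w \<in> A1" "t \<in> {0..T}" for w t
    using K1(2)[OF that] by (simp add: K_def)
  have UK: "\<bar>U t w\<bar> \<le> K" if "w \<in> A2" "t \<in> {0..T}" for w t
    using K2(2)[OF that] by (simp add: K_def)
  have \<mu>0: "0 < \<mu>" using \<sigma> by (simp add: \<mu>)
  \<comment> \<open>The conditions control, in this order, drift and Riemann errors, the second
    moment of \<open>Z2\<close>, and the mean of \<open>Z3\<close>. The powers of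
    \<open>\<zeta>\<close> are those that leave probability \<open>\<zeta>\<close> after Chebyshev's
    inequality at threshold \<open>\<zeta>\<close> and Markov's inequality at threshold
    \<open>\<zeta> / K\<close>.\<close>
  obtain \<epsilon> where \<epsilon>: "0 < \<epsilon>" "K * (\<mu> * T + 2) * \<epsilon> < \<zeta>" "T * K\<^sup>2 * \<sigma>\<^sup>2 * \<epsilon>\<^sup>2 < \<zeta>^3"
    "2 * K * \<sigma>\<^sup>2 * T * \<epsilon> < \<zeta>\<^sup>2"
  proof -
    have "((\<lambda>\<epsilon>. K * (\<mu> * T + 2) * \<epsilon>) \<longlongrightarrow> 0) (at_right 0)"
      "((\<lambda>\<epsilon>. T * K\<^sup>2 * \<sigma>\<^sup>2 * \<epsilon>\<^sup>2) \<longlongrightarrow> 0) (at_right 0)"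
      "((\<lambda>\<epsilon>. 2 * K * \<sigma>\<^sup>2 * T * \<epsilon>) \<longlongrightarrow> 0) (at_right 0)"
      by (auto intro!: tendsto_eq_intros)
    then have "\<forall>\<^sub>F \<epsilon> in at_right 0. K * (\<mu> * T + 2) * \<epsilon> < \<zeta> \<and> T * K\<^sup>2 * \<sigma>\<^sup>2 * \<epsilon>\<^sup>2 < \<zeta>^3 \<and> 2 * K * \<sigma>\<^sup>2 * T * \<epsilon> < \<zeta>\<^sup>2"
      using \<zeta> by (intro eventually_conj order_tendstoD(2)) auto
    then have "\<forall>\<^sub>F \<epsilon> in at_right 0. 0 < \<epsilon> \<and> K * (\<mu> * T + 2) * \<epsilon> < \<zeta> \<and> T * K\<^sup>2 * \<sigma>\<^sup>2 * \<epsilon>\<^sup>2 < \<zeta>^3 \<and> 2 * K * \<sigma>\<^sup>2 * T * \<epsilon> < \<zeta>\<^sup>2"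
      by (intro eventually_conj[OF eventually_at_right_less])
    from eventually_happens'[OF trivial_limit_at_right_real this] show ?thesis using that by blast
  qed
  obtain A3 \<delta> where A3: "A3 \<in> events" "1 - \<zeta> < prob A3" and \<delta>: "0 < \<delta>"
    "\<And>w s t. w \<in> A3 \<Longrightarrow> s \<in> {0..T} \<Longrightarrow> t \<in> {0..T} \<Longrightarrow> \<bar>s - t\<bar> < \<delta> \<Longrightarrow> \<bar>P s w - P t w\<bar> \<le> \<epsilon>"
    using continuous_process_modulus[OF P_measurable P_continuous \<zeta> \<epsilon>(1), of T] by metis
  define c where "c = \<sigma>\<^sup>2 * T"
  have c: "0 < c" using \<sigma> T by (simp add: c_def)
  \<comment> \<open>After positivity: neighbouring coarse times fall within the modulus
    \<open>\<delta>\<close>, the deviation of \<open>step_mean\<close> from 1 is small in total, so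
    is the second moment of \<open>Z1\<close>, and the summed second moments of the exponential
    increments are below twice their limit.\<close>
  obtain n :: nat where n: "0 < n" "T / real n < \<delta>"
    "real n * (K\<^sup>2 * \<bar>step_mean (c / real n) - 1\<bar>) < \<zeta>"
    "real n * ((K\<^sup>2)\<^sup>2 * step_var (c / real n)) < \<zeta>^3"
    "real n * (exp (2 * (c / real n)) - 2 * exp (c / real n / 2) + 1) < 2 * c"
  proof -
    have "(\<lambda>n. K\<^sup>2 * \<bar>real n * (exp (c / real n / 2) * (1 - c / real n / 2) - 1)\<bar>) \<longlonglongrightarrow> K\<^sup>2 * \<bar>0\<bar>"
      by (intro tendsto_intros step_asymptotics c)
    then have 1: "(\<lambda>n. real n * (K\<^sup>2 * \<bar>step_mean (c / real n) - 1\<bar>)) \<longlonglongrightarrow> 0"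
      by (simp add: step_mean_def abs_mult mult_ac)
    have "(\<lambda>n. (K\<^sup>2)\<^sup>2 * (real n * step_var (c / real n))) \<longlonglongrightarrow> (K\<^sup>2)\<^sup>2 * 0"
      unfolding step_var_def step_mean_def by (intro tendsto_intros step_asymptotics c)
    then have 2: "(\<lambda>n. real n * ((K\<^sup>2)\<^sup>2 * step_var (c / real n))) \<longlonglongrightarrow> 0"
      by (simp add: mult_ac)
    have 3: "(\<lambda>n. T / real n) \<longlonglongrightarrow> 0" by real_asymp
    have "\<forall>\<^sub>F n in sequentially. 0 < n \<and> T / real n < \<delta> \<and>
      real n * (K\<^sup>2 * \<bar>step_mean (c / real n) - 1\<bar>) < \<zeta> \<and>
      real n * ((K\<^sup>2)\<^sup>2 * step_var (c / real n)) < \<zeta>^3 \<and>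
      real n * (exp (2 * (c / real n)) - 2 * exp (c / real n / 2) + 1) < 2 * c"
      using \<zeta> c \<delta>(1)
      by (intro eventually_conj order_tendstoD(2)[OF 1] order_tendstoD(2)[OF 2] order_tendstoD(2)[OF 3]
          order_tendstoD(2)[OF step_asymptotics(3)[OF c]] eventually_gt_at_top) auto
    then show ?thesis using that by (auto simp: eventually_sequentially)
  qed
  define h where "h = T / real n"
  have h: "0 < h" using T n(1) by (simp add: h_def)
  have ch: "c / real n = \<sigma>\<^sup>2 * h" by (simp add: c_def h_def)
  \<comment> \<open>Two counts are covered: n Riemann errors of size up to
    \<open>2 * \<eta>\<close>, and n + 1 events \<open>bad k\<close> of probability at most
    \<open>\<eta>\<close>.\<close>
  define \<eta> where "\<eta> = min (\<epsilon> / real n) (\<zeta> / real (Suc n))"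
  have \<eta>: "0 < \<eta>" "real n * \<eta> \<le> \<epsilon>" "real (Suc n) * \<eta> \<le> \<zeta>"
  proof -
    show "0 < \<eta>" using \<epsilon>(1) \<zeta> n(1) by (simp add: \<eta>_def)
    have "real n * \<eta> \<le> real n * (\<epsilon> / real n)" by (intro mult_left_mono) (simp_all add: \<eta>_def)
    then show "real n * \<eta> \<le> \<epsilon>" using n(1) by simp
    have "real (Suc n) * \<eta> \<le> real (Suc n) * (\<zeta> / real (Suc n))" by (intro mult_left_mono) (simp_all add: \<eta>_def)
    then show "real (Suc n) * \<eta> \<le> \<zeta>" by simp
  qed
  define X where "X t w = P t w - P 0 w - integral {0..t} (\<lambda>s. \<mu> * P s w)" for t w
  have X_M: "X t \<in> borel_measurable M" if "0 \<le> t" for t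
    using P_ito[OF that] by (simp add: has_ito_integral_def X_def[abs_def])
  define Q where "Q k d \<longleftrightarrow> (\<forall>N q. q 0 = 0 \<and> q N = real k * h \<and> (\<forall>j<N. q j \<le> q (Suc j) \<and> q (Suc j) - q j < d) \<longrightarrow>
      prob {w \<in> space M. \<bar>(\<Sum>j<N. \<sigma> * P (q j) w * (B (q (Suc j)) w - B (q j) w)) - X (real k * h) w\<bar> > \<eta>} < \<eta>)"
    for k :: nat and d :: real
  have "\<exists>d>0. Q k d" for k
  proof -
    have "0 \<le> real k * h" using h by simp
    from conjunct2[OF P_ito[OF this, unfolded has_ito_integral_def], THEN spec[of _ \<eta>], THEN mp, OF \<eta>(1)]
    show ?thesis unfolding X_def Q_def .
  qed
  then obtain d where d: "\<And>k. 0 < d k" "\<And>k. Q k (d k)" by metis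
  \<comment> \<open>The admissible mesh depends on the time at which the integral is taken; only n +
    1 coarse times occur, so the minimum is still positive.\<close>
  define d0 where "d0 = Min (d ` {..n})"
  have d0: "0 < d0" "\<And>k. k \<le> n \<Longrightarrow> d0 \<le> d k" using d(1) by (auto simp: d0_def)
  obtain m :: nat where m: "0 < m" "h / real m < d0"
  proof -
    have "(\<lambda>m. h / real m) \<longlonglongrightarrow> 0" by real_asymp
    then have "\<forall>\<^sub>F m in sequentially. 0 < m \<and> h / real m < d0"
      using d0(1) by (intro eventually_conj order_tendstoD(2) eventually_gt_at_top) auto
    then show ?thesis using that by (auto simp: eventually_sequentially)
  qed
  define dt where "dt = h / real m"
  have dt: "0 < dt" "real m * dt = h" using h m(1) by (simp_all add: dt_def)
  define s where "s l = real l * dt" for l :: nat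
  define t where "t k = real k * h" for k :: nat
  have s0: "0 \<le> s l" for l using dt by (simp add: s_def)
  have t0: "0 \<le> t l" for l using h by (simp add: t_def)
  have sS: "s (Suc l) = s l + dt" for l by (simp add: s_def algebra_simps)
  have tS: "t (Suc l) = t l + h" for l by (simp add: t_def algebra_simps)
  have st: "s (k * m) = t k" for k by (simp add: s_def t_def dt(2)[symmetric])
  have skm: "s (k * m + j) = t k + real j * dt" for k j
    by (simp add: st[symmetric]) (simp add: s_def algebra_simps)
  have tn: "t n = T" using n(1) by (simp add: t_def h_def)
  have tT: "t k \<in> {0..T}" if "k \<le> n" for k
    using that h t0[of k] unfolding tn[symmetric] by (auto simp: t_def intro!: mult_right_mono)
  have smono: "s i \<le> s j" if "i \<le> j" for i j
    using that dt by (auto simp: s_def intro!: mult_right_mono)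
  define D where "D l w = B (s (Suc l)) w - B (s l) w" for l w
  define Sr where "Sr j w = (\<Sum>l<j. \<sigma> * P (s l) w * D l w)" for j w
  define bad where "bad k = {w \<in> space M. \<bar>Sr (k * m) w - X (t k) w\<bar> > \<eta>}" for k
  have bad_sets: "bad k \<in> events" for k
    unfolding bad_def Sr_def D_def using P_measurable[OF s0] B_measurable[OF s0] X_M[OF t0] by measurable
  have bad_prob: "prob (bad k) \<le> \<eta>" if "k \<le> n" for k
  proof -
    have "s 0 = 0 \<and> s (k * m) = real k * h \<and> (\<forall>j<k * m. s j \<le> s (Suc j) \<and> s (Suc j) - s j < d k)"
      using dt(1) m(2) d0(2)[OF that] st[of k] by (simp add: sS s_def[of 0] t_def dt_def)
    from d(2)[of k, unfolded Q_def, THEN spec[of _ "k * m"], THEN spec[of _ s], THEN mp, OF this]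
    show ?thesis unfolding bad_def Sr_def D_def t_def by (rule less_imp_le)
  qed

  define b where "b k w = B (t (Suc k)) w - B (t k) w" for k w
  define Z1 where "Z1 w = (\<Sum>k<n. clip (K\<^sup>2) (P (t k) w * U (t k) w) * step h (b k w))" for w
  \<comment> \<open>\<open>l div m\<close> is the coarse interval containing the fine step l.
    Reading U and the reference price at its left end keeps the coefficient known at time
    \<open>s l\<close>; with the clips inactive, \<open>Z2\<close> is the sum of
    \<open>U (t k) * e k\<close>.\<close>
  define G2 where "G2 l w = clip K (U (t (l div m)) w) * (\<sigma> * clip \<epsilon> (P (s l) w - P (t (l div m)) w))" for l w
  define Z2 where "Z2 w = (\<Sum>l<n * m. G2 l w * D l w)" for w
  define e where "e k w = (\<Sum>j<m. (\<sigma> * clip \<epsilon> (P (s (k * m + j)) w - P (t k) w)) * D (k * m + j) w)" for k w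
  define E where "E k w = exp (- \<sigma> * b k w) - 1" for k w
  define Z3 where "Z3 w = (\<Sum>k<n. \<bar>E k w\<bar> * \<bar>e k w\<bar>)" for w

  have Z1_L2: "integrable M (\<lambda>w. (Z1 w)\<^sup>2) \<and> expectation (\<lambda>w. (Z1 w)\<^sup>2) \<le> real n * ((K\<^sup>2)\<^sup>2 * step_var (\<sigma>\<^sup>2 * h))"
    unfolding Z1_def b_def
  proof (rule increment_transform_L2[where h = h])
    show "(\<lambda>w. clip (K\<^sup>2) (P (t k) w * U (t k) w)) \<in> borel_measurable (F (t k))" for k
      using P_adapted[OF t0] U_adapted[OF t0] by measurable
    show "step h \<in> borel_measurable borel" unfolding step_def by measurable
    show "expectation (\<lambda>w. step h (B (t + h) w - B t w)) = 0" if "0 \<le> t" for t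
      using step_moments(1)[OF that h] by (rule has_bochner_integral_integral_eq)
    show "has_bochner_integral M (\<lambda>w. (step h (B (t + h) w - B t w))\<^sup>2) (step_var (\<sigma>\<^sup>2 * h))" if "0 \<le> t" for t
      using step_moments(2)[OF that h] .
  qed (use t0 h tS in \<open>auto intro!: abs_clip_le\<close>)

  have G2_adapted: "G2 l \<in> borel_measurable (F (s l))" for l
  proof -
    have "l div m * m \<le> l" by simp
    then have le: "t (l div m) \<le> s l" unfolding st[symmetric] by (rule smono)
    show ?thesis unfolding G2_def
      using P_adapted[OF s0] filtration_measurable_mono[OF t0 le P_adapted[OF t0]]
        filtration_measurable_mono[OF t0 le U_adapted[OF t0]] by measurable
  qed
  have Z2_L2: "integrable M (\<lambda>w. (Z2 w)\<^sup>2) \<and> expectation (\<lambda>w. (Z2 w)\<^sup>2) \<le> real (n * m) * ((K * (\<sigma> * \<epsilon>))\<^sup>2 * dt)"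
    unfolding Z2_def D_def
  proof (rule increment_transform_L2[where h = dt and f = "\<lambda>x. x"])
    show "\<bar>G2 l w\<bar> \<le> K * (\<sigma> * \<epsilon>)" for l w
      unfolding G2_def abs_mult using K \<sigma> \<epsilon>(1) by (intro mult_mono) (auto intro!: abs_clip_le mult_left_mono)
    show "expectation (\<lambda>w. B (t + dt) w - B t w) = 0" if "0 \<le> t" for t
      using increment_second_moment(2)[OF that dt(1)] by (rule has_bochner_integral_integral_eq)
    show "has_bochner_integral M (\<lambda>w. (B (t + dt) w - B t w)\<^sup>2) dt" if "0 \<le> t" for t
      using increment_second_moment(1)[OF that dt(1)] .
  qed (use s0 dt sS G2_adapted in auto)

  have e_L2: "integrable M (\<lambda>w. (e k w)\<^sup>2) \<and> expectation (\<lambda>w. (e k w)\<^sup>2) \<le> real m * ((\<sigma> * \<epsilon>)\<^sup>2 * dt)" for k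
  proof -
    have *: "D (k * m + j) w = B (s (k * m + Suc j)) w - B (s (k * m + j)) w" for j w
      by (simp add: D_def)
    show ?thesis
      unfolding e_def *
    proof (rule increment_transform_L2[where h = dt and f = "\<lambda>x. x" and s = "\<lambda>j. s (k * m + j)"])
      fix j
      have le: "t k \<le> s (k * m + j)" unfolding st[symmetric] by (rule smono) simp
      show "(\<lambda>w. \<sigma> * clip \<epsilon> (P (s (k * m + j)) w - P (t k) w)) \<in> borel_measurable (F (s (k * m + j)))"
        using P_adapted[OF s0] filtration_measurable_mono[OF t0 le P_adapted[OF t0]] by measurable
      show "\<bar>\<sigma> * clip \<epsilon> (P (s (k * m + j)) w - P (t k) w)\<bar> \<le> \<sigma> * \<epsilon>" for w
        unfolding abs_mult using \<sigma> \<epsilon>(1) by (auto intro!: abs_clip_le mult_left_mono)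
      show "expectation (\<lambda>w. B (t + dt) w - B t w) = 0" if "0 \<le> t" for t
        using increment_second_moment(2)[OF that dt(1)] by (rule has_bochner_integral_integral_eq)
      show "has_bochner_integral M (\<lambda>w. (B (t + dt) w - B t w)\<^sup>2) dt" if "0 \<le> t" for t
        using increment_second_moment(1)[OF that dt(1)] .
    qed (use s0 dt sS in auto)
  qed
  define v where "v = exp (2 * (\<sigma>\<^sup>2 * h)) - 2 * exp (\<sigma>\<^sup>2 * h / 2) + 1"
  have E_L2: "has_bochner_integral M (\<lambda>w. (E k w)\<^sup>2) v" for k
    using exp_increment_moment[OF t0 h, of k] unfolding E_def b_def tS v_def .
  have e_M: "e k \<in> borel_measurable M" for k
    unfolding e_def D_def using P_measurable[OF s0] P_measurable[OF t0] B_measurable[OF s0] by measurable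
  have E_M: "E k \<in> borel_measurable M" for k
    unfolding E_def b_def using B_measurable[OF t0] by measurable
  \<comment> \<open>\<open>E k\<close> and \<open>e k\<close> depend on the Brownian path over the
    same interval, so independence is no help. The weight \<open>\<epsilon>\<close> turns second
    moments of order h and \<open>\<epsilon>\<^sup>2 * h\<close> into a bound of order
    \<open>\<epsilon> * h\<close>, which sums to order \<open>\<epsilon>\<close> over n
    steps.\<close>
  have amgm: "\<bar>x\<bar> * \<bar>y\<bar> \<le> (\<epsilon> * x\<^sup>2 + y\<^sup>2 / \<epsilon>) / 2" for x y :: real
  proof -
    have "0 \<le> (\<epsilon> * \<bar>x\<bar> - \<bar>y\<bar>)\<^sup>2" by simp
    then have "2 * \<epsilon> * (\<bar>x\<bar> * \<bar>y\<bar>) \<le> \<epsilon>\<^sup>2 * x\<^sup>2 + y\<^sup>2" by (simp add: power2_diff power_mult_distrib)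
    then show ?thesis using \<epsilon>(1) by (simp add: field_simps power2_eq_square)
  qed
  have Ee: "integrable M (\<lambda>w. \<bar>E k w\<bar> * \<bar>e k w\<bar>) \<and>
     expectation (\<lambda>w. \<bar>E k w\<bar> * \<bar>e k w\<bar>) \<le> (\<epsilon> * v + \<sigma>\<^sup>2 * \<epsilon> * h) / 2" for k
  proof -
    have i: "integrable M (\<lambda>w. (\<epsilon> * (E k w)\<^sup>2 + (e k w)\<^sup>2 / \<epsilon>) / 2)"
      using E_L2 e_L2 by (auto simp: has_bochner_integral_iff)
    have j: "integrable M (\<lambda>w. \<bar>E k w\<bar> * \<bar>e k w\<bar>)"
      by (rule Bochner_Integration.integrable_bound[OF i])
         (use amgm E_M e_M \<epsilon>(1) in \<open>auto simp: abs_mult\<close>)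
    have "expectation (\<lambda>w. \<bar>E k w\<bar> * \<bar>e k w\<bar>) \<le> expectation (\<lambda>w. (\<epsilon> * (E k w)\<^sup>2 + (e k w)\<^sup>2 / \<epsilon>) / 2)"
      by (rule integral_mono[OF j i amgm])
    also have "\<dots> = (\<epsilon> * v + expectation (\<lambda>w. (e k w)\<^sup>2) / \<epsilon>) / 2"
      using E_L2[of k] e_L2[of k] by (simp add: has_bochner_integral_iff)
    also have "\<dots> \<le> (\<epsilon> * v + (real m * ((\<sigma> * \<epsilon>)\<^sup>2 * dt)) / \<epsilon>) / 2"
      using e_L2[of k] \<epsilon>(1) by (intro divide_right_mono add_left_mono) auto
    also have "(real m * ((\<sigma> * \<epsilon>)\<^sup>2 * dt)) / \<epsilon> = \<sigma>\<^sup>2 * \<epsilon> * h"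
      using \<epsilon>(1) by (simp add: dt(2)[symmetric] power2_eq_square)
    finally show ?thesis using j by simp
  qed
  have Z3_int: "integrable M Z3" unfolding Z3_def using Ee by auto
  have Z3_exp: "K * expectation Z3 \<le> \<zeta>\<^sup>2"
  proof -
    have "expectation Z3 = (\<Sum>k<n. expectation (\<lambda>w. \<bar>E k w\<bar> * \<bar>e k w\<bar>))"
      unfolding Z3_def using Ee by (subst Bochner_Integration.integral_sum) auto
    also have "\<dots> \<le> (\<Sum>k<n. (\<epsilon> * v + \<sigma>\<^sup>2 * \<epsilon> * h) / 2)" by (intro sum_mono) (use Ee in auto)
    also have "\<dots> = (\<epsilon> * (real n * v) + \<sigma>\<^sup>2 * \<epsilon> * (real n * h)) / 2" by (simp add: algebra_simps)
    also have "\<dots> \<le> (\<epsilon> * (2 * c) + \<sigma>\<^sup>2 * \<epsilon> * T) / 2"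
    proof -
      have "real n * v \<le> 2 * c" using n(5) unfolding ch v_def by simp
      moreover have "real n * h = T" using n(1) by (simp add: h_def)
      ultimately show ?thesis using \<epsilon>(1) by (intro divide_right_mono add_mono mult_left_mono) auto
    qed
    also have "\<dots> \<le> 2 * \<sigma>\<^sup>2 * T * \<epsilon>" using \<epsilon>(1) T by (simp add: c_def field_simps)
    finally have "K * expectation Z3 \<le> K * (2 * \<sigma>\<^sup>2 * T * \<epsilon>)" using K by (intro mult_left_mono) auto
    also have "\<dots> \<le> \<zeta>\<^sup>2" using \<epsilon>(4) by (simp add: mult_ac)
    finally show ?thesis .
  qed

  define C1 where "C1 = {w \<in> space M. \<zeta> \<le> \<bar>Z1 w\<bar>}"
  define C2 where "C2 = {w \<in> space M. \<zeta> \<le> \<bar>Z2 w\<bar>}"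
  define C3 where "C3 = {w \<in> space M. \<zeta> / K \<le> Z3 w}"
  have Z1_M: "Z1 \<in> borel_measurable M"
    unfolding Z1_def b_def step_def
    using P_measurable[OF t0] U_M[OF t0] B_measurable[OF t0] by measurable
  have Z2_M: "Z2 \<in> borel_measurable M"
    unfolding Z2_def D_def using filtration_measurable[OF s0 G2_adapted] B_measurable[OF s0] by measurable
  have C_sets: "C1 \<in> events" "C2 \<in> events" "C3 \<in> events"
    unfolding C1_def C2_def C3_def
    using Z1_M Z2_M borel_measurable_integrable[OF Z3_int] by measurable
  have C1: "prob C1 \<le> \<zeta>"
  proof -
    have "prob C1 \<le> expectation (\<lambda>w. (Z1 w)\<^sup>2) / \<zeta>\<^sup>2"
      unfolding C1_def using Z1_L2 \<zeta> Z1_M by (intro second_moment_method) auto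
    also have "\<dots> \<le> \<zeta>^3 / \<zeta>\<^sup>2"
      using Z1_L2 n(4) unfolding ch by (intro divide_right_mono) auto
    also have "\<dots> = \<zeta>" using \<zeta> by (simp add: power3_eq_cube power2_eq_square)
    finally show ?thesis .
  qed
  have C2: "prob C2 \<le> \<zeta>"
  proof -
    have "real (n * m) * ((K * (\<sigma> * \<epsilon>))\<^sup>2 * dt) = T * K\<^sup>2 * \<sigma>\<^sup>2 * \<epsilon>\<^sup>2"
      using n(1) dt(2) by (simp add: power_mult_distrib h_def field_simps)
    with Z2_L2 \<epsilon>(3) have le: "expectation (\<lambda>w. (Z2 w)\<^sup>2) \<le> \<zeta>^3" by linarith
    have "prob C2 \<le> expectation (\<lambda>w. (Z2 w)\<^sup>2) / \<zeta>\<^sup>2"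
      unfolding C2_def using Z2_L2 \<zeta> Z2_M by (intro second_moment_method) auto
    also have "\<dots> \<le> \<zeta>^3 / \<zeta>\<^sup>2"
      using le by (intro divide_right_mono) auto
    also have "\<dots> = \<zeta>" using \<zeta> by (simp add: power3_eq_cube power2_eq_square)
    finally show ?thesis .
  qed
  have C3: "prob C3 \<le> \<zeta>"
  proof -
    have "prob C3 \<le> expectation Z3 / (\<zeta> / K)"
      unfolding C3_def
      by (rule integral_Markov_inequality_measure[OF Z3_int, of "{}"])
         (use \<zeta> K in \<open>auto simp: Z3_def intro!: sum_nonneg\<close>)
    also have "\<dots> \<le> \<zeta>" using Z3_exp \<zeta> K by (simp add: field_simps power2_eq_square)
    finally show ?thesis .
  qed

  \<comment> \<open>The seven sets: failure of the bound on P, of the bound on U, or of the modulus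
    of P, some inaccurate Riemann sum, and large values of \<open>Z1\<close>, \<open>Z2\<close> and
    \<open>Z3\<close>.\<close>
  let ?W = "(space M - A1) \<union> (space M - A2) \<union> (space M - A3) \<union> (\<Union>k\<in>{..n}. bad k) \<union> C1 \<union> C2 \<union> C3"
  have path: "\<bar>P T w * U T w - P 0 w\<bar> \<le> 5 * \<zeta>" if w: "w \<in> space M" "w \<notin> ?W" for w
  proof -
    have wA: "w \<in> A1" "w \<in> A2" "w \<in> A3" and wC: "\<bar>Z1 w\<bar> < \<zeta>" "\<bar>Z2 w\<bar> < \<zeta>" "Z3 w < \<zeta> / K"
      and wb: "\<And>k. k \<le> n \<Longrightarrow> \<bar>Sr (k * m) w - X (t k) w\<bar> \<le> \<eta>"
      using w by (auto simp: C1_def C2_def C3_def bad_def not_le not_less)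
    have close: "\<bar>P r w - P (t k) w\<bar> \<le> \<epsilon>" if "k < n" "t k \<le> r" "r \<le> t (Suc k)" for k r
    proof (rule \<delta>(2)[OF wA(3)])
      have "t (Suc k) \<le> T" using tT[of "Suc k"] that by simp
      then show "r \<in> {0..T}" using that t0[of k] by auto
      show "t k \<in> {0..T}" using that by (intro tT) simp
      show "\<bar>r - t k\<bar> < \<delta>" using that n(2) by (simp add: tS h_def)
    qed
    have fine: "\<bar>P (s (k * m + j)) w - P (t k) w\<bar> \<le> \<epsilon>" if "k < n" "j < m" for k j
    proof (rule close[OF that(1)])
      show "t k \<le> s (k * m + j)" using dt(1) by (simp add: skm)
      have "real j * dt \<le> h" using that dt by (simp add: dt(2)[symmetric] mult_right_mono)
      then show "s (k * m + j) \<le> t (Suc k)" by (simp add: skm tS)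
    qed
    define J where "J k = integral {t k..t (Suc k)} (\<lambda>r. \<mu> * P r w)" for k
    define \<rho> where "\<rho> k = P (t (Suc k)) w - P (t k) w - J k - (Sr (Suc k * m) w - Sr (k * m) w)" for k
    have J: "\<bar>J k - \<mu> * h * P (t k) w\<bar> \<le> \<mu> * h * \<epsilon>" if "k < n" for k
    proof -
      have i: "(\<lambda>r. \<mu> * P r w) integrable_on {t k..t (Suc k)}" by (rule P_integrable[OF w(1) t0])
      have "J k - \<mu> * h * P (t k) w = integral {t k..t (Suc k)} (\<lambda>r. \<mu> * P r w - \<mu> * P (t k) w)"
        using h unfolding J_def by (subst Henstock_Kurzweil_Integration.integral_diff[OF i]) (auto simp: tS)
      also have "norm \<dots> \<le> integral {t k..t (Suc k)} (\<lambda>r. \<mu> * \<epsilon>)"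
      proof (rule integral_norm_bound_integral)
        fix r assume "r \<in> {t k..t (Suc k)}"
        then have "\<mu> * \<bar>P r w - P (t k) w\<bar> \<le> \<mu> * \<epsilon>"
          using close[OF that] \<mu>0 by (intro mult_left_mono) auto
        then show "norm (\<mu> * P r w - \<mu> * P (t k) w) \<le> \<mu> * \<epsilon>"
          using \<mu>0 by (simp add: right_diff_distrib[symmetric] abs_mult)
      qed (use i in \<open>auto intro!: integrable_diff\<close>)
      also have "\<dots> = \<mu> * h * \<epsilon>" using h by (simp add: tS)
      finally show ?thesis by simp
    qed
    \<comment> \<open>\<open>\<rho> k\<close> is the change of the Riemann error X - Sr between
      consecutive coarse times, hence the factor 2.\<close>
    have \<rho>: "\<bar>\<rho> k\<bar> \<le> 2 * \<eta>" if "k < n" for k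
    proof -
      have "integral {0..t k} (\<lambda>s. \<mu> * P s w) + J k = integral {0..t (Suc k)} (\<lambda>s. \<mu> * P s w)"
        unfolding J_def
        by (rule Henstock_Kurzweil_Integration.integral_combine) (use t0 h in \<open>auto simp: tS intro!: P_integrable w(1)\<close>)
      then have "\<rho> k = (X (t (Suc k)) w - Sr (Suc k * m) w) - (X (t k) w - Sr (k * m) w)"
        unfolding \<rho>_def X_def by simp
      then show ?thesis using wb[of k] wb[of "Suc k"] that by linarith
    qed
    \<comment> \<open>All fine times of a coarse interval lie within the modulus of its left end, so
      clipping at \<open>\<epsilon>\<close> changes nothing on this path.\<close>
    have eq_e: "e k w = (\<Sum>j<m. \<sigma> * (P (s (k * m + j)) w - P (t k) w) * D (k * m + j) w)" if "k < n" for k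
      unfolding e_def by (intro sum.cong refl) (simp add: clip_eq fine[OF that])
    have Sr: "Sr (Suc k * m) w - Sr (k * m) w = \<sigma> * P (t k) w * b k w + e k w" if "k < n" for k
    proof -
      have "Sr (Suc k * m) w - Sr (k * m) w = (\<Sum>j<m. \<sigma> * P (s (k * m + j)) w * D (k * m + j) w)"
        unfolding Sr_def sum_blocks by simp
      also have "\<dots> = (\<Sum>j<m. \<sigma> * P (t k) w * D (k * m + j) w) + e k w"
        unfolding eq_e[OF that] sum.distrib[symmetric] by (intro sum.cong refl) (simp add: algebra_simps)
      also have "(\<Sum>j<m. \<sigma> * P (t k) w * D (k * m + j) w) = \<sigma> * P (t k) w * (\<Sum>j<m. B (s (k * m + Suc j)) w - B (s (k * m + j)) w)"
        by (simp add: sum_distrib_left D_def)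
      also have "(\<Sum>j<m. B (s (k * m + Suc j)) w - B (s (k * m + j)) w) = b k w"
        using sum_lessThan_telescope[of "\<lambda>j. B (s (k * m + j)) w" m]
        by (simp add: b_def st[symmetric] add.commute)
      finally show ?thesis .
    qed
    have tele: "\<bar>P (t n) w * U (t n) w - P (t 0) w * U (t 0) w\<bar> \<le>
      \<bar>\<Sum>k<n. P (t k) w * U (t k) w * ((1 + \<sigma> * b k w + \<mu> * h) * exp (- \<sigma> * b k w) - step_mean (\<sigma>\<^sup>2 * h))\<bar>
      + \<bar>\<Sum>k<n. U (t k) w * e k w\<bar> + K * (\<Sum>k<n. \<bar>exp (- \<sigma> * b k w) - 1\<bar> * \<bar>e k w\<bar>)
      + real n * (K\<^sup>2 * \<bar>step_mean (\<sigma>\<^sup>2 * h) - 1\<bar>) + real n * (K * (\<mu> * h * \<epsilon> + 2 * \<eta>))"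
    proof (rule ratio_telescope[where J = J and r = \<rho>])
      fix k assume k: "k < n"
      show "P (t (Suc k)) w = P (t k) w + J k + \<sigma> * P (t k) w * b k w + e k w + \<rho> k"
        unfolding \<rho>_def using Sr[OF k] by simp
      show "U (t (Suc k)) w = U (t k) w * exp (- \<sigma> * b k w)"
        by (simp add: U_def b_def exp_add[symmetric] algebra_simps)
    qed (use J \<rho> PK[OF wA(1) tT] UK[OF wA(2) tT] in auto)
    have "(\<Sum>k<n. P (t k) w * U (t k) w * ((1 + \<sigma> * b k w + \<mu> * h) * exp (- \<sigma> * b k w) - step_mean (\<sigma>\<^sup>2 * h))) = Z1 w"
      unfolding Z1_def
    proof (intro sum.cong refl)
      fix k assume "k \<in> {..<n}"
      then have "\<bar>P (t k) w * U (t k) w\<bar> \<le> K\<^sup>2"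
        unfolding abs_mult power2_eq_square using K by (intro mult_mono PK UK wA tT) auto
      then show "P (t k) w * U (t k) w * ((1 + \<sigma> * b k w + \<mu> * h) * exp (- \<sigma> * b k w) - step_mean (\<sigma>\<^sup>2 * h)) =
         clip (K\<^sup>2) (P (t k) w * U (t k) w) * step h (b k w)"
        by (simp add: clip_eq step_def)
    qed
    moreover have "(\<Sum>k<n. U (t k) w * e k w) = Z2 w"
    proof -
      have "U (t k) w * e k w = (\<Sum>j<m. G2 (k * m + j) w * D (k * m + j) w)" if "k < n" for k
      proof -
        have "\<bar>U (t k) w\<bar> \<le> K" using that by (intro UK wA tT) auto
        then show ?thesis
          unfolding e_def sum_distrib_left by (intro sum.cong refl) (simp add: G2_def clip_eq)
      qed
      then show ?thesis unfolding Z2_def sum_blocks by (intro sum.cong) auto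
    qed
    moreover have "K * Z3 w \<le> \<zeta>" using wC(3) K by (simp add: field_simps)
    moreover have "real n * (K\<^sup>2 * \<bar>step_mean (\<sigma>\<^sup>2 * h) - 1\<bar>) \<le> \<zeta>" using n(3) unfolding ch by simp
    moreover have "real n * (K * (\<mu> * h * \<epsilon> + 2 * \<eta>)) \<le> \<zeta>"
    proof -
      have "real n * (K * (\<mu> * h * \<epsilon> + 2 * \<eta>)) = K * (\<mu> * (real n * h) * \<epsilon> + 2 * (real n * \<eta>))"
        by (simp add: algebra_simps)
      also have "\<dots> \<le> K * (\<mu> * T * \<epsilon> + 2 * \<epsilon>)"
        using \<eta>(2) n(1) K by (intro mult_left_mono add_mono) (auto simp: h_def)
      also have "\<dots> \<le> \<zeta>" using \<epsilon>(2) by (simp add: algebra_simps)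
      finally show ?thesis .
    qed
    moreover have "P (t 0) w * U (t 0) w = P 0 w"
      using w(1) by (simp add: t_def U_def B_0)
    ultimately show ?thesis
      using tele wC(1,2) unfolding tn Z3_def E_def by linarith
  qed
  have badU: "prob (\<Union>k\<in>{..n}. bad k) \<le> \<zeta>"
  proof -
    have "prob (\<Union>k\<in>{..n}. bad k) \<le> (\<Sum>k\<in>{..n}. prob (bad k))"
      using bad_sets by (intro finite_measure_subadditive_finite) auto
    also have "\<dots> \<le> (\<Sum>k\<in>{..n}. \<eta>)" by (intro sum_mono bad_prob) auto
    also have "\<dots> \<le> \<zeta>" using \<eta>(3) by simp
    finally show ?thesis .
  qed
  have compl: "prob (space M - A) \<le> \<zeta>" if "A \<in> events" "1 - \<zeta> < prob A" for A
    using that by (simp add: prob_compl)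
  have sub: "prob (A \<union> A') \<le> x + y" if "A \<in> events" "A' \<in> events" "prob A \<le> x" "prob A' \<le> y" for A A' x y
    using measure_Un_le[of A M A'] that by linarith
  have "prob {w \<in> space M. 5 * \<zeta> < \<bar>P T w * exp (- \<sigma> * B T w) - P 0 w\<bar>} \<le> prob ?W"
  proof (rule finite_measure_mono)
    show "{w \<in> space M. 5 * \<zeta> < \<bar>P T w * exp (- \<sigma> * B T w) - P 0 w\<bar>} \<subseteq> ?W"
      using path unfolding U_def by (auto simp: not_less[symmetric])
    show "?W \<in> events" using A1 A2 A3 bad_sets C_sets by auto
  qed
  also have "\<dots> \<le> \<zeta> + \<zeta> + \<zeta> + \<zeta> + \<zeta> + \<zeta> + \<zeta>"
    using A1 A2 A3 bad_sets C_sets by (intro sub compl badU C1 C2 C3) auto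
  finally show ?thesis by simp
qed

text \<open>\<open>ratio_estimate\<close> settles each fixed time up to a null set of its own.
  Countably many rational times and continuity of both sides reduce this to a single null set, as
  evaluation at random arrival times requires.\<close>

lemma price_eq:
  assumes P0: "\<And>w. w \<in> space M \<Longrightarrow> P 0 w = p"
  shows "AE w in M. \<forall>t\<ge>0. P t w = p * exp (\<sigma> * B t w)"
proof -
  have ratio: "AE w in M. P T w = p * exp (\<sigma> * B T w)" if T: "0 \<le> T" for T
  proof (cases "T = 0")
    case True
    then show ?thesis using P0 B_0 by auto
  next
    case False
    with T have T: "0 < T" by simp
    define Y where "Y w = \<bar>P T w * exp (- \<sigma> * B T w) - P 0 w\<bar>" for w
    have Y_M: "Y \<in> borel_measurable M"
      unfolding Y_def using P_measurable[OF less_imp_le[OF T]] P_measurable[OF order_refl] B_measurable[OF less_imp_le[OF T]]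
      by measurable
    have small: "prob {w \<in> space M. 0 < Y w} \<le> 0"
    proof -
      have "(\<lambda>i. prob {w \<in> space M. 1 / real (Suc i) < Y w}) \<longlonglongrightarrow> prob (\<Union>i. {w \<in> space M. 1 / real (Suc i) < Y w})"
      proof (rule finite_Lim_measure_incseq)
        show "range (\<lambda>i. {w \<in> space M. 1 / real (Suc i) < Y w}) \<subseteq> events" using Y_M by auto
        show "incseq (\<lambda>i. {w \<in> space M. 1 / real (Suc i) < Y w})"
        proof (rule incseq_SucI)
          fix i
          have "1 / real (Suc (Suc i)) \<le> 1 / real (Suc i)" by (simp add: field_simps)
          then show "{w \<in> space M. 1 / real (Suc i) < Y w} \<subseteq> {w \<in> space M. 1 / real (Suc (Suc i)) < Y w}"
            by (auto intro: le_less_trans)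
        qed
      qed
      moreover have "prob {w \<in> space M. 1 / real (Suc i) < Y w} = 0" for i
      proof -
        \<comment> \<open>The event stays fixed while \<open>\<zeta>\<close> decreases to 0: once
          \<open>5 * \<zeta>\<close> is below 1 / (i + 1), its probability is at most
          \<open>7 * \<zeta>\<close>.\<close>
        have "prob {w \<in> space M. 1 / real (Suc i) < Y w} \<le> 7 * \<zeta>" if "0 < \<zeta>" "\<zeta> < 1 / (5 * real (Suc i))" for \<zeta>
        proof -
          have "5 * \<zeta> < 1 / real (Suc i)" using that by (simp add: field_simps)
          then have "prob {w \<in> space M. 1 / real (Suc i) < Y w} \<le> prob {w \<in> space M. 5 * \<zeta> < Y w}"
            using Y_M by (intro finite_measure_mono) auto
          with ratio_estimate[OF T that(1)] show ?thesis unfolding Y_def by linarith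
        qed
        then have "\<forall>\<^sub>F \<zeta> in at_right 0. prob {w \<in> space M. 1 / real (Suc i) < Y w} \<le> 7 * \<zeta>"
          unfolding eventually_at_right_field by (intro exI[of _ "1 / (5 * real (Suc i))"]) auto
        moreover have "((\<lambda>\<zeta>::real. 7 * \<zeta>) \<longlongrightarrow> 0) (at_right 0)" by (auto intro!: tendsto_eq_intros)
        ultimately have "prob {w \<in> space M. 1 / real (Suc i) < Y w} \<le> 0"
          by (intro tendsto_lowerbound[OF _ _ trivial_limit_at_right_real]) auto
        then show ?thesis using measure_nonneg[of M] by (metis order_antisym)
      qed
      moreover have "(\<Union>i. {w \<in> space M. 1 / real (Suc i) < Y w}) = {w \<in> space M. 0 < Y w}"
      proof -
        have "\<exists>i. 1 / real (Suc i) < Y w" if "0 < Y w" for w using that by (metis nat_approx_posE)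
        moreover have "0 < Y w" if "1 / real (Suc i) < Y w" for i w
          using that by (rule less_trans[rotated]) simp
        ultimately show ?thesis by blast
      qed
      ultimately have "(\<lambda>i::nat. 0) \<longlonglongrightarrow> prob {w \<in> space M. 0 < Y w}" by simp
      then have "prob {w \<in> space M. 0 < Y w} = 0" using LIMSEQ_unique tendsto_const by blast
      then show ?thesis by simp
    qed
    have "AE w in M. \<not> 0 < Y w"
    proof (subst AE_iff_measurable[OF _ refl])
      show "{w \<in> space M. \<not> \<not> 0 < Y w} \<in> events" using Y_M by measurable
      show "emeasure M {w \<in> space M. \<not> \<not> 0 < Y w} = 0"
        using small measure_nonneg[of M] by (simp add: emeasure_eq_measure order_antisym)
    qed
    then show ?thesis
    proof (rule AE_mp, intro AE_I2 impI)
      fix w assume w: "w \<in> space M" "\<not> 0 < Y w"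
      then have "P T w * exp (- \<sigma> * B T w) = p" using P0 by (simp add: Y_def)
      then have "p * exp (\<sigma> * B T w) = P T w * (exp (- \<sigma> * B T w) * exp (\<sigma> * B T w))" by simp
      then show "P T w = p * exp (\<sigma> * B T w)" by (simp add: exp_add[symmetric])
    qed
  qed
  have "AE w in M. \<forall>t\<in>\<rat> \<inter> {0..}. P t w = p * exp (\<sigma> * B t w)"
    using ratio by (subst AE_ball_countable) (auto intro: countable_Int1 countable_rat)
  then show ?thesis
  proof (rule AE_mp, intro AE_I2 impI allI)
    fix w and t :: real assume w: "w \<in> space M" and eq: "\<forall>t\<in>\<rat> \<inter> {0..}. P t w = p * exp (\<sigma> * B t w)" and t: "0 \<le> t"
    obtain q where q: "\<And>n. q n \<in> \<rat> \<inter> {0..t}" "q \<longlonglongrightarrow> t"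
      using exists_rational_sequence[of t t] t by auto
    have q0: "q n \<in> \<rat> \<inter> {0..}" for n using q(1)[of n] by auto
    have "(\<lambda>k. P (q k) w) \<longlonglongrightarrow> P t w"
      by (rule continuous_on_tendsto_compose[OF P_continuous[OF w] q(2)]) (use q0 t in auto)
    moreover have "(\<lambda>k. B (q k) w) \<longlonglongrightarrow> B t w"
      by (rule continuous_on_tendsto_compose[OF B_continuous[OF w] q(2)]) (use q0 t in auto)
    then have "(\<lambda>k. p * exp (\<sigma> * B (q k) w)) \<longlonglongrightarrow> p * exp (\<sigma> * B t w)" by (intro tendsto_intros)
    moreover have "P (q k) w = p * exp (\<sigma> * B (q k) w)" for k using eq q0 by blast
    ultimately show "P t w = p * exp (\<sigma> * B t w)" using LIMSEQ_unique by auto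
  qed
qed

end

section \<open>Decoupling independent processes\<close>

lemma (in prob_space) indep_rvs_distr:
  assumes "indep_rvs M X S Y T"
  shows "distr M (S \<Otimes>\<^sub>M T) (\<lambda>w. (X w, Y w)) = distr M S X \<Otimes>\<^sub>M distr M T Y"
proof -
  have X [measurable]: "X \<in> measurable M S" and Y [measurable]: "Y \<in> measurable M T"
    and ind: "indep_set (sets (vimage_algebra (space M) X S)) (sets (vimage_algebra (space M) Y T))"
    using assms by (auto simp: indep_rvs_def)
  interpret X: prob_space "distr M S X" by (rule prob_space_distr) fact
  interpret Y: prob_space "distr M T Y" by (rule prob_space_distr) fact
  show ?thesis
  proof (rule pair_measure_eqI[symmetric])
    show "sets (distr M S X \<Otimes>\<^sub>M distr M T Y) = sets (distr M (S \<Otimes>\<^sub>M T) (\<lambda>w. (X w, Y w)))"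
      by (simp cong: sets_pair_measure_cong)
    fix A B assume "A \<in> sets (distr M S X)" "B \<in> sets (distr M T Y)"
    then have [measurable]: "A \<in> sets S" "B \<in> sets T" by simp_all
    have "X -` A \<inter> space M \<in> sets (vimage_algebra (space M) X S)"
      "Y -` B \<inter> space M \<in> sets (vimage_algebra (space M) Y T)"
      by (auto intro!: in_vimage_algebra)
    from indep_setD[OF ind this]
    have "prob ((X -` A \<inter> space M) \<inter> (Y -` B \<inter> space M)) = prob (X -` A \<inter> space M) * prob (Y -` B \<inter> space M)" .
    moreover have "(X -` A \<inter> space M) \<inter> (Y -` B \<inter> space M) = (\<lambda>w. (X w, Y w)) -` (A \<times> B) \<inter> space M"
      by auto
    ultimately show "emeasure (distr M S X) A * emeasure (distr M T Y) B =
       emeasure (distr M (S \<Otimes>\<^sub>M T) (\<lambda>w. (X w, Y w))) (A \<times> B)"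
      by (simp add: emeasure_distr emeasure_eq_measure ennreal_mult'[symmetric])
  qed unfold_locales
qed

text \<open>Tonelli for the product law, pulled back to M: \<open>X\<close> receives a sample point
  w' of its own, so that \<open>Y w\<close> is a constant inside the inner integral.\<close>

lemma (in prob_space) nn_integral_decouple:
  assumes ind: "indep_rvs M X S Y T" and f [measurable]: "f \<in> borel_measurable (S \<Otimes>\<^sub>M T)"
  shows "(\<integral>\<^sup>+w. f (X w, Y w) \<partial>M) = (\<integral>\<^sup>+w. (\<integral>\<^sup>+w'. f (X w', Y w) \<partial>M) \<partial>M)"
proof -
  have X [measurable]: "X \<in> measurable M S" and Y [measurable]: "Y \<in> measurable M T"
    using ind by (auto simp: indep_rvs_def)
  interpret X: prob_space "distr M S X" by (rule prob_space_distr) fact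
  interpret Y: prob_space "distr M T Y" by (rule prob_space_distr) fact
  interpret pair_sigma_finite "distr M S X" "distr M T Y" by unfold_locales
  have "(\<integral>\<^sup>+w. f (X w, Y w) \<partial>M) = (\<integral>\<^sup>+q. f q \<partial>(distr M S X \<Otimes>\<^sub>M distr M T Y))"
    unfolding indep_rvs_distr[OF ind, symmetric] by (simp add: nn_integral_distr)
  also have "\<dots> = (\<integral>\<^sup>+y. (\<integral>\<^sup>+x. f (x, y) \<partial>distr M S X) \<partial>distr M T Y)"
    by (rule nn_integral_snd[symmetric]) (simp cong: measurable_cong_sets sets_pair_measure_cong)
  also have "\<dots> = (\<integral>\<^sup>+y. (\<integral>\<^sup>+w'. f (X w', y) \<partial>M) \<partial>distr M T Y)"
    by (intro nn_integral_cong) (simp add: nn_integral_distr)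
  also have "\<dots> = (\<integral>\<^sup>+w. (\<integral>\<^sup>+w'. f (X w', Y w) \<partial>M) \<partial>M)"
    by (rule nn_integral_distr) measurable
  finally show ?thesis .
qed

text \<open>Rounding to the grid leaves countably many possible times, so that evaluating a process
  there is measurable. \<open>Suc n\<close> avoids division by zero, and \<open>nat\<close> keeps
  the value nonnegative for negative t.\<close>

definition grid_below :: "nat \<Rightarrow> real \<Rightarrow> real" where
  "grid_below n t = real (nat \<lfloor>t * real (Suc n)\<rfloor>) / real (Suc n)"

lemma grid_below_nonneg: "0 \<le> grid_below n t"
  by (simp add: grid_below_def)

lemma grid_below_tendsto:
  assumes "0 \<le> t"
  shows "(\<lambda>n. grid_below n t) \<longlonglongrightarrow> t"
proof -
  have "(\<lambda>n. of_int \<lfloor>t * real (Suc n)\<rfloor> / real (Suc n)) \<longlonglongrightarrow> t" by real_asymp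
  then show ?thesis using assms by (simp add: grid_below_def)
qed

lemma continuous_path_grid_tendsto:
  fixes x :: "real \<Rightarrow> real"
  assumes "continuous_on {0..} x" "0 \<le> t"
  shows "(\<lambda>n. x (grid_below n t)) \<longlonglongrightarrow> x t"
  by (rule continuous_on_tendsto_compose[OF assms(1) grid_below_tendsto])
     (use assms(2) grid_below_nonneg in auto)

lemma measurable_at_grid_time:
  fixes X :: "real \<Rightarrow> 'a \<Rightarrow> real"
  assumes X: "\<And>t. 0 \<le> t \<Longrightarrow> X t \<in> borel_measurable M" and T [measurable]: "T \<in> borel_measurable M"
  shows "(\<lambda>w. X (grid_below n (T w)) w) \<in> borel_measurable M"
proof -
  have "(\<lambda>w. (\<lambda>i w. X (real i / real (Suc n)) w) (nat \<lfloor>T w * real (Suc n)\<rfloor>) w) \<in> borel_measurable M"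
    by (rule measurable_compose_countable) (auto intro: X)
  then show ?thesis by (simp add: grid_below_def)
qed

lemma measurable_at_random_time:
  fixes X :: "real \<Rightarrow> 'a \<Rightarrow> real"
  assumes "\<And>t. 0 \<le> t \<Longrightarrow> X t \<in> borel_measurable M" "T \<in> borel_measurable M"
    and "\<And>w. w \<in> space M \<Longrightarrow> continuous_on {0..} (\<lambda>t. X t w)" "\<And>w. w \<in> space M \<Longrightarrow> 0 \<le> T w"
  shows "(\<lambda>w. X (T w) w) \<in> borel_measurable M"
  by (rule borel_measurable_LIMSEQ_real[where u="\<lambda>n w. X (grid_below n (T w)) w"])
     (auto intro!: continuous_path_grid_tendsto measurable_at_grid_time assms)

text \<open>Evaluation of a path at a given time is not jointly measurable for the product
  \<open>\<sigma>\<close>-algebra; the limit along grid times is, and it agrees with evaluation on continuous paths.\<close>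

definition path_eval :: "real \<Rightarrow> (real \<Rightarrow> real) \<Rightarrow> real" where
  "path_eval t x = lim (\<lambda>n. x (grid_below n t))"

lemma path_eval_measurable [measurable]:
  assumes [measurable]: "f \<in> borel_measurable M" "g \<in> measurable M real_paths"
  shows "(\<lambda>w. path_eval (f w) (g w)) \<in> borel_measurable M"
  unfolding path_eval_def
proof (rule borel_measurable_lim_metric)
  fix n
  show "(\<lambda>w. g w (grid_below n (f w))) \<in> borel_measurable M"
  proof (rule measurable_at_grid_time)
    show "(\<lambda>w. g w t) \<in> borel_measurable M" if "0 \<le> t" for t
      by (rule measurable_compose[OF assms(2) measurable_component_singleton])
         (use that in auto)
  qed fact
qed

lemma path_eval_restricted_path:
  assumes "continuous_on {0..} (\<lambda>t. B t w)" "0 \<le> t"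
  shows "path_eval t (restricted_path B w) = B t w"
proof -
  have "(\<lambda>n. restricted_path B w (grid_below n t)) \<longlonglongrightarrow> B t w"
    using continuous_path_grid_tendsto[OF assms] grid_below_nonneg by (simp add: restricted_path_def)
  then show ?thesis unfolding path_eval_def by (rule limI)
qed

text \<open>The time at which the count reaches i, read off the counting path alone. Rational times
  keep it measurable for the product \<sigma>-algebra; if the count never reaches i the infimum is
  \<infinity> and the result defaults to 0.\<close>

definition path_arrival :: "nat \<Rightarrow> (real \<Rightarrow> nat) \<Rightarrow> real" where
  "path_arrival i x = real_of_ereal (INF q\<in>\<rat> \<inter> {0..}. if i \<le> x q then ereal q else \<infinity>)"

lemma path_arrival_measurable [measurable]:
  assumes [measurable]: "g \<in> measurable M nat_paths"
  shows "(\<lambda>w. path_arrival i (g w)) \<in> borel_measurable M"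
proof -
  have "(\<lambda>w. if i \<le> g w q then ereal q else \<infinity>) \<in> borel_measurable M" if "q \<in> \<rat> \<inter> {0..}" for q
  proof -
    have [measurable]: "(\<lambda>w. g w q) \<in> measurable M (count_space UNIV)"
      by (rule measurable_compose[OF assms measurable_component_singleton]) (use that in auto)
    show ?thesis by measurable
  qed
  then have "(\<lambda>w. INF q\<in>\<rat> \<inter> {0..}. if i \<le> g w q then ereal q else \<infinity>) \<in> borel_measurable M"
    by (intro borel_measurable_INF countable_Int1 countable_rat)
  then show ?thesis unfolding path_arrival_def by measurable
qed

lemma path_arrival_eq:
  assumes "0 \<le> t" and x: "\<And>q. 0 \<le> q \<Longrightarrow> i \<le> x q \<longleftrightarrow> t \<le> q"
  shows "path_arrival i x = t"
proof -
  have "(INF q\<in>\<rat> \<inter> {0..}. if i \<le> x q then ereal q else \<infinity>) = ereal t"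
  proof (rule antisym)
    show "ereal t \<le> (INF q\<in>\<rat> \<inter> {0..}. if i \<le> x q then ereal q else \<infinity>)"
      using x by (intro INF_greatest) auto
    show "(INF q\<in>\<rat> \<inter> {0..}. if i \<le> x q then ereal q else \<infinity>) \<le> ereal t"
    proof (rule ereal_le_epsilon2)
      fix e :: real assume "0 < e"
      then obtain q where q: "q \<in> \<rat>" "t < q" "q < t + e" using Rats_dense_in_real[of t "t + e"] by auto
      then have "(INF q\<in>\<rat> \<inter> {0..}. if i \<le> x q then ereal q else \<infinity>) \<le> (if i \<le> x q then ereal q else \<infinity>)"
        using \<open>0 \<le> t\<close> by (intro INF_lower) auto
      also have "\<dots> \<le> ereal t + ereal e" using q x \<open>0 \<le> t\<close> by auto
      finally show "(INF q\<in>\<rat> \<inter> {0..}. if i \<le> x q then ereal q else \<infinity>) \<le> ereal t + ereal e" .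
    qed
  qed
  then show ?thesis by (simp add: path_arrival_def)
qed

section \<open>The mispricing process at arrivals\<close>

locale arbitrage_model = price_space M F B P \<sigma> \<mu>
  for M :: "'a measure" and F :: "real \<Rightarrow> 'a measure" and B P :: "real \<Rightarrow> 'a \<Rightarrow> real" and \<sigma> \<mu> :: real +
  fixes z :: "real \<Rightarrow> 'a \<Rightarrow> real" and z0 :: "'a \<Rightarrow> real" and N :: "real \<Rightarrow> 'a \<Rightarrow> nat" and \<tau> :: "nat \<Rightarrow> 'a \<Rightarrow> real"
    and lam \<gamma> p :: real
  assumes lam: "0 < lam" and \<gamma>: "0 < \<gamma>" and p: "0 < p"
    and P0: "\<forall>w\<in>space M. P 0 w = p"
    and poisson: "poisson_process M lam N"
    and arrivals: "arrival_times M N \<tau>"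
    and indep_BN: "indep_rvs M (restricted_path B) real_paths (restricted_path N) nat_paths"
    and indep_z0: "indep_rvs M z0 borel
           (\<lambda>w. (restricted_path B w, restricted_path N w)) (real_paths \<Otimes>\<^sub>M nat_paths)"
    and z0_distr: "distributed M lborel z0 (\<lambda>x. ennreal (stationary_density \<sigma> lam \<gamma> x))"
    and mispricing: "mispricing M \<sigma> \<gamma> B \<tau> z0 z"
begin

lemma N_measurable: "0 \<le> t \<Longrightarrow> N t \<in> measurable M (count_space UNIV)"
  using poisson by (simp add: poisson_process_def)

lemma z0_measurable [measurable]: "z0 \<in> borel_measurable M"
  using indep_z0 by (simp add: indep_rvs_def)

lemma arrival_less:
  assumes "w \<in> space M" "1 \<le> i" "i < j"
  shows "\<tau> i w < \<tau> j w"
  using arrivals assms unfolding arrival_times_def by (auto dest!: bspec[of _ _ w] intro: strict_mono_onD)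

lemma arrival_pos:
  assumes "w \<in> space M" "1 \<le> i"
  shows "0 < \<tau> i w"
proof -
  have "0 < \<tau> 1 w" using arrivals assms by (simp add: arrival_times_def)
  then show ?thesis using arrival_less[OF assms(1), of 1 i] assms(2) by (cases "i = 1") auto
qed

lemma arrival_nonneg: "w \<in> space M \<Longrightarrow> 1 \<le> i \<Longrightarrow> 0 \<le> \<tau> i w"
  by (rule less_imp_le[OF arrival_pos])

text \<open>Arrivals are strictly ordered, so those up to time t form an initial segment of the
  indices and \<open>N t w\<close> is its length. Measurability of \<open>\<tau> i\<close> and its
  recovery from the counting path both rest on this equivalence.\<close>

lemma arrival_le_iff:
  assumes w: "w \<in> space M" and i: "1 \<le> i" and t: "0 \<le> t"
  shows "\<tau> i w \<le> t \<longleftrightarrow> i \<le> N t w"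
proof -
  define S where "S = {j. 1 \<le> j \<and> \<tau> j w \<le> t}"
  have S: "finite S" "N t w = card S"
    using arrivals w t by (auto simp: arrival_times_def S_def)
  show ?thesis
  proof
    assume le: "\<tau> i w \<le> t"
    have "{1..i} \<subseteq> S"
    proof
      fix j assume "j \<in> {1..i}"
      then show "j \<in> S" using le arrival_less[OF w, of j i] by (cases "j = i") (auto simp: S_def)
    qed
    from card_mono[OF S(1) this] show "i \<le> N t w" by (simp add: S(2))
  next
    assume le: "i \<le> N t w"
    show "\<tau> i w \<le> t"
    proof (rule ccontr)
      assume gt: "\<not> \<tau> i w \<le> t"
      have "S \<subseteq> {1..<i}"
      proof
        fix j assume "j \<in> S"
        then show "j \<in> {1..<i}" using gt arrival_less[OF w i, of j] by (cases i j rule: linorder_cases) (auto simp: S_def)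
      qed
      from card_mono[OF _ this] have "N t w \<le> i - 1" by (simp add: S(2))
      then show False using le i by simp
    qed
  qed
qed

lemma arrival_measurable: 
  assumes "1 \<le> i"
  shows "\<tau> i \<in> borel_measurable M"
  unfolding borel_measurable_iff_le
proof
  fix a
  show "{w \<in> space M. \<tau> i w \<le> a} \<in> events"
  proof (cases "0 \<le> a")
    case True
    have "{w \<in> space M. \<tau> i w \<le> a} = {w \<in> space M. i \<le> N a w}"
      using arrival_le_iff[OF _ assms True] by blast
    also have "\<dots> \<in> events" using N_measurable[OF True] by measurable
    finally show ?thesis .
  next
    case False
    then have empty: "{w \<in> space M. \<tau> i w \<le> a} = {}" using arrival_pos[OF _ assms] by force
    show ?thesis unfolding empty by simp
  qed
qed

lemma B_arrival_measurable: "1 \<le> i \<Longrightarrow> (\<lambda>w. B (\<tau> i w) w) \<in> borel_measurable M"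
  by (rule measurable_at_random_time[OF B_measurable arrival_measurable B_continuous])
     (auto intro: arrival_nonneg)

lemma P_arrival_measurable: "1 \<le> i \<Longrightarrow> (\<lambda>w. P (\<tau> i w) w) \<in> borel_measurable M"
  by (rule measurable_at_random_time[OF P_measurable arrival_measurable P_continuous])
     (auto intro: arrival_nonneg)

text \<open>\<open>premium i\<close> is the mispricing just before the arrival with (one-based) index \<open>Suc i\<close>.\<close>

primrec premium :: "nat \<Rightarrow> 'a \<Rightarrow> real" where
  "premium 0 w = z0 w + \<sigma> * B (\<tau> 1 w) w"
| "premium (Suc i) w = max (min (premium i w) \<gamma>) (- \<gamma>) + \<sigma> * (B (\<tau> (Suc (Suc i)) w) w - B (\<tau> (Suc i) w) w)"

lemma premium_measurable [measurable]: "premium i \<in> borel_measurable M"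
proof (induction i)
  case 0
  show ?case using B_arrival_measurable[OF order_refl] by (subst fun_eq_iff[THEN iffD2, OF allI, OF premium.simps(1)]) measurable
next
  case (Suc i)
  then show ?case using B_arrival_measurable[of "Suc i", simplified] B_arrival_measurable[of "Suc (Suc i)", simplified]
    by (subst fun_eq_iff[THEN iffD2, OF allI, OF premium.simps(2)])
      (intro borel_measurable_add borel_measurable_times borel_measurable_diff borel_measurable_max
        borel_measurable_min borel_measurable_const)
qed

lemma left_limit_eqI:
  assumes w: "w \<in> space M" and "0 \<le> r" "r < t"
    and eq: "\<And>s. r \<le> s \<Longrightarrow> s < t \<Longrightarrow> z s w = c + \<sigma> * (B s w - b)"
  shows "left_limit z t w = c + \<sigma> * (B t w - b)"
  unfolding left_limit_def
proof (rule tendsto_Lim)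
  have "isCont (\<lambda>s. B s w) t"
    by (rule continuous_on_interior[OF B_continuous[OF w]]) (use assms in \<open>auto simp: interior_real_atLeast\<close>)
  then have "((\<lambda>s. B s w) \<longlongrightarrow> B t w) (at_left t)"
    by (simp add: isCont_def filterlim_at_split)
  then have "((\<lambda>s. c + \<sigma> * (B s w - b)) \<longlongrightarrow> c + \<sigma> * (B t w - b)) (at_left t)"
    by (intro tendsto_intros)
  moreover have "\<forall>\<^sub>F s in at_left t. c + \<sigma> * (B s w - b) = z s w"
    using eventually_at_left_real[OF \<open>r < t\<close>] by eventually_elim (simp add: eq)
  ultimately show "((\<lambda>s. z s w) \<longlongrightarrow> c + \<sigma> * (B t w - b)) (at_left t)"
    by (rule Lim_transform_eventually)
qed simp

text \<open>Between arrivals z differs from \<sigma> B by a constant, so continuity of B gives the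
  left limit; the clamp at the preceding arrival provides the constant. From here on
  \<open>premium\<close> replaces z.\<close>

lemma left_limit_premium:
  assumes w: "w \<in> space M"
  shows "left_limit z (\<tau> (Suc i) w) w = premium i w"
proof (induction i)
  case 0
  have "left_limit z (\<tau> 1 w) w = z0 w + \<sigma> * (B (\<tau> 1 w) w - 0)"
    by (rule left_limit_eqI[OF w, of 0])
       (use mispricing w arrival_pos[OF w, of 1] in \<open>auto simp: mispricing_def\<close>)
  then show ?case by simp
next
  case (Suc i)
  have "left_limit z (\<tau> (Suc (Suc i)) w) w =
     z (\<tau> (Suc i) w) w + \<sigma> * (B (\<tau> (Suc (Suc i)) w) w - B (\<tau> (Suc i) w) w)"
    by (rule left_limit_eqI[OF w, of "\<tau> (Suc i) w"])
       (use mispricing w arrival_pos[OF w, of "Suc i"] arrival_less[OF w, of "Suc i" "Suc (Suc i)"]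
         in \<open>auto simp: mispricing_def\<close>)
  moreover have "z (\<tau> (Suc i) w) w = max (min (left_limit z (\<tau> (Suc i) w) w) \<gamma>) (- \<gamma>)"
    using mispricing w by (simp add: mispricing_def)
  ultimately show ?case using Suc by simp
qed

text \<open>Three sample points appear: w for the arrivals, w' for the Brownian path and w'' for the
  initial mispricing. Inside, the arrival times are constants. Two indices are allowed because a
  later profit involves the increment of B between two arrivals.\<close>

lemma nn_integral_arrival_decouple:
  assumes H [measurable]: "H \<in> borel_measurable (borel \<Otimes>\<^sub>M borel \<Otimes>\<^sub>M borel)"
    and i: "1 \<le> i" and j: "1 \<le> j" and T: "0 \<le> T"
  shows "(\<integral>\<^sup>+w. (if i \<le> N T w then H (z0 w, B (\<tau> i w) w, B (\<tau> j w) w) else 0) \<partial>M) =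
    (\<integral>\<^sup>+w. (if i \<le> N T w then \<integral>\<^sup>+w'. \<integral>\<^sup>+w''. H (z0 w'', B (\<tau> i w) w', B (\<tau> j w) w') \<partial>M \<partial>M else 0) \<partial>M)"
proof -
  \<comment> \<open>The integrand must be a measurable function of \<open>z0\<close> and the two
    paths before independence can be applied; evaluation of B at an arrival is therefore expressed
    through \<open>path_eval\<close> and \<open>path_arrival\<close>.\<close>
  define G where "G = (\<lambda>(x :: real, b :: real \<Rightarrow> real, n :: real \<Rightarrow> nat).
     if i \<le> n T then H (x, path_eval (path_arrival i n) b, path_eval (path_arrival j n) b) else 0)"
  have [measurable]: "(\<lambda>q. snd (snd q) T) \<in> measurable (borel \<Otimes>\<^sub>M real_paths \<Otimes>\<^sub>M nat_paths) (count_space UNIV)"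
    by (rule measurable_compose[OF _ measurable_component_singleton[of T "{0..}"]]) (use T in auto)
  have G [measurable]: "G \<in> borel_measurable (borel \<Otimes>\<^sub>M real_paths \<Otimes>\<^sub>M nat_paths)"
    unfolding G_def case_prod_beta by measurable
  have arr: "path_arrival k (restricted_path N w) = \<tau> k w" if "w \<in> space M" "1 \<le> k" for k w
    using arrival_le_iff[OF that] arrival_pos[OF that]
    by (intro path_arrival_eq) (auto simp: restricted_path_def)
  have ev: "path_eval (\<tau> k w) (restricted_path B w') = B (\<tau> k w) w'"
    if "w \<in> space M" "w' \<in> space M" "1 \<le> k" for k w w'
    using arrival_pos[OF that(1,3)] by (intro path_eval_restricted_path B_continuous that) auto
  have Geq: "G (x, restricted_path B w', restricted_path N w) =
     (if i \<le> N T w then H (x, B (\<tau> i w) w', B (\<tau> j w) w') else 0)" if "w \<in> space M" "w' \<in> space M" for x w w'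
    using that i j T by (simp add: G_def arr ev) (simp add: restricted_path_def)
  have "(\<integral>\<^sup>+w. (if i \<le> N T w then H (z0 w, B (\<tau> i w) w, B (\<tau> j w) w) else 0) \<partial>M) =
     (\<integral>\<^sup>+w. G (z0 w, restricted_path B w, restricted_path N w) \<partial>M)"
    by (intro nn_integral_cong) (simp add: Geq)
  also have "\<dots> = (\<integral>\<^sup>+w. \<integral>\<^sup>+w''. G (z0 w'', restricted_path B w, restricted_path N w) \<partial>M \<partial>M)"
    by (rule nn_integral_decouple[OF indep_z0 G])
  also have "\<dots> = (\<integral>\<^sup>+w. \<integral>\<^sup>+w'. \<integral>\<^sup>+w''. G (z0 w'', restricted_path B w', restricted_path N w) \<partial>M \<partial>M \<partial>M)"
    by (rule nn_integral_decouple[OF indep_BN, of "\<lambda>q. \<integral>\<^sup>+w''. G (z0 w'', q) \<partial>M", simplified]) measurable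
  also have "\<dots> = (\<integral>\<^sup>+w. (if i \<le> N T w then \<integral>\<^sup>+w'. \<integral>\<^sup>+w''. H (z0 w'', B (\<tau> i w) w', B (\<tau> j w) w') \<partial>M \<partial>M else 0) \<partial>M)"
    by (intro nn_integral_cong) (auto simp: Geq cong: nn_integral_cong_simp)
  finally show ?thesis .
qed

section \<open>The Poisson count\<close>

lemma N_distr: "0 < T \<Longrightarrow> distr M (count_space UNIV) (N T) = measure_pmf (poisson_pmf (lam * T))"
proof -
  assume T: "0 < T"
  have "distr M (count_space UNIV) (\<lambda>w. N T w - N 0 w) = measure_pmf (poisson_pmf (lam * (T - 0)))"
    using poisson T unfolding poisson_process_def by blast
  moreover have "distr M (count_space UNIV) (\<lambda>w. N T w - N 0 w) = distr M (count_space UNIV) (N T)"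
    using poisson by (intro distr_cong) (auto simp: poisson_process_def)
  ultimately show ?thesis by simp
qed

lemma nn_integral_N:
  assumes T: "0 < T"
  shows "(\<integral>\<^sup>+w. f (N T w) \<partial>M) = (\<Sum>n. ennreal ((lam * T) ^ n / fact n * exp (- (lam * T))) * f n)"
proof -
  have "(\<integral>\<^sup>+w. f (N T w) \<partial>M) = (\<integral>\<^sup>+n. f n \<partial>distr M (count_space UNIV) (N T))"
    using N_measurable[of T] T by (simp add: nn_integral_distr)
  also have "\<dots> = (\<integral>\<^sup>+n. ennreal (pmf (poisson_pmf (lam * T)) n) * f n \<partial>count_space UNIV)"
    unfolding N_distr[OF T] by (rule nn_integral_measure_pmf)
  also have "\<dots> = (\<Sum>n. ennreal ((lam * T) ^ n / fact n * exp (- (lam * T))) * f n)"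
    using T lam by (simp add: nn_integral_count_space_nat)
  finally show ?thesis .
qed

lemma prob_arrival:
  assumes T: "0 < T"
  shows "prob {w \<in> space M. 1 \<le> N T w} = 1 - exp (- (lam * T))"
proof -
  have N [measurable]: "N T \<in> measurable M (count_space UNIV)" using N_measurable T by simp
  have "prob {w \<in> space M. N T w = 0} = measure (distr M (count_space UNIV) (N T)) {0}"
    by (subst measure_distr) (auto intro!: arg_cong[where f=prob])
  also have "\<dots> = exp (- (lam * T))"
    unfolding N_distr[OF T] using T lam by (simp add: measure_pmf_single)
  finally have "prob {w \<in> space M. N T w = 0} = exp (- (lam * T))" .
  moreover have "{w \<in> space M. 1 \<le> N T w} = space M - {w \<in> space M. N T w = 0}" by auto
  ultimately show ?thesis by (simp add: prob_compl)
qed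

text \<open>The number of arrivals after the first is at most N (N - 1), and the second factorial
  moment of a Poisson variable is the square of its mean.\<close>

lemma expected_excess_arrivals:
  assumes T: "0 < T"
  shows "(\<integral>\<^sup>+w. of_nat (N T w - 1) \<partial>M) \<le> ennreal ((lam * T)\<^sup>2)"
proof -
  define x where "x = lam * T"
  have x: "0 < x" using T lam by (simp add: x_def)
  define a where "a n = x ^ n / fact n * exp (- x) * (real n * (real n - 1))" for n
  have a0: "0 \<le> a n" for n using x by (cases n) (auto simp: a_def)
  have shift: "a (n + 2) = x\<^sup>2 * exp (- x) * (inverse (fact n) * x ^ n)" for n
  proof -
    define c where "c = (real n + 2) * (real n + 1)"
    have "c \<noteq> 0" by (simp add: c_def add_nonneg_eq_0_iff)
    have "fact (n + 2) = c * fact n" by (simp add: c_def algebra_simps)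
    then have "a (n + 2) = x ^ (n + 2) / (c * fact n) * exp (- x) * c"
      unfolding a_def by (simp add: c_def add.commute)
    also have "\<dots> = x ^ (n + 2) / fact n * exp (- x)" using \<open>c \<noteq> 0\<close> by (simp add: field_simps)
    finally show ?thesis by (simp add: power2_eq_square field_simps)
  qed
  have "(\<lambda>n. x\<^sup>2 * exp (- x) * (inverse (fact n) * x ^ n)) sums (x\<^sup>2 * exp (- x) * exp x)"
    using exp_converges[of x] by (intro sums_mult) (simp add: scaleR_conv_of_real)
  then have "(\<lambda>n. a (n + 2)) sums x\<^sup>2" unfolding shift by (simp add: mult.assoc exp_add[symmetric])
  then have "a sums (x\<^sup>2 + (\<Sum>i<2. a i))" by (rule sums_iff_shift[THEN iffD1])
  \<comment> \<open>The two terms skipped by the shift vanish because of the factor n (n -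
    1).\<close>
  then have sums: "a sums x\<^sup>2" by (simp add: a_def numeral_2_eq_2)
  have "(\<integral>\<^sup>+w. of_nat (N T w - 1) \<partial>M) = (\<Sum>n. ennreal (x ^ n / fact n * exp (- x)) * of_nat (n - 1))"
    unfolding x_def by (rule nn_integral_N[OF T])
  also have "\<dots> \<le> (\<Sum>n. ennreal (a n))"
  proof (rule suminf_le)
    fix n
    have "ennreal (x ^ n / fact n * exp (- x)) * of_nat (n - 1) = ennreal (x ^ n / fact n * exp (- x) * real (n - 1))"
      using x by (subst ennreal_mult) (auto simp: ennreal_of_nat_eq_real_of_nat)
    also have "\<dots> \<le> ennreal (a n)"
    proof (rule ennreal_leI)
      have "real (n - 1) \<le> real n * (real n - 1)" by (cases n) (auto simp: algebra_simps)
      then show "x ^ n / fact n * exp (- x) * real (n - 1) \<le> a n"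
        unfolding a_def using x by (intro mult_left_mono) auto
    qed
    finally show "ennreal (x ^ n / fact n * exp (- x)) * of_nat (n - 1) \<le> ennreal (a n)" .
  qed auto
  also have "\<dots> = ennreal (x\<^sup>2)"
    using sums_unique[OF sums] suminf_ennreal_eq[OF a0 sums] by simp
  finally show ?thesis by (simp add: x_def)
qed

end

section \<open>Short-time limits\<close>

lemma nn_integral_even:
  fixes h :: "real \<Rightarrow> ennreal"
  assumes [measurable]: "h \<in> borel_measurable borel" and even: "\<And>x. h (- x) = h x"
  shows "(\<integral>\<^sup>+x. h x \<partial>lborel) = 2 * (\<integral>\<^sup>+x. h x * indicator {0<..} x \<partial>lborel)"
proof -
  have "(\<integral>\<^sup>+x. h x * indicator {0<..} x \<partial>lborel) = (\<integral>\<^sup>+x. h (0 + - 1 * x) * indicator {0<..} (0 + - 1 * x) \<partial>lborel)"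
    by (subst nn_integral_real_affine[where c="-1" and t=0]) auto
  also have "\<dots> = (\<integral>\<^sup>+x. h x * indicator {..<0} x \<partial>lborel)"
    by (intro nn_integral_cong) (auto simp: even split: split_indicator)
  finally have neg: "(\<integral>\<^sup>+x. h x * indicator {..<0} x \<partial>lborel) = (\<integral>\<^sup>+x. h x * indicator {0<..} x \<partial>lborel)" ..
  have "(\<integral>\<^sup>+x. h x \<partial>lborel) = (\<integral>\<^sup>+x. h x * indicator {0<..} x + h x * indicator {..<0} x \<partial>lborel)"
  proof (rule nn_integral_cong_AE)
    have "AE x in lborel. x \<noteq> (0::real)" by (rule AE_lborel_singleton)
    then show "AE x in lborel. h x = h x * indicator {0<..} x + h x * indicator {..<0} x"
      by eventually_elim (auto split: split_indicator)
  qed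
  also have "\<dots> = (\<integral>\<^sup>+x. h x * indicator {0<..} x \<partial>lborel) + (\<integral>\<^sup>+x. h x * indicator {..<0} x \<partial>lborel)"
    by (rule nn_integral_add) auto
  finally show ?thesis unfolding neg by (simp add: mult_2)
qed

lemma nn_integral_exp_decay:
  fixes s :: real
  assumes s: "0 < s"
  shows "(\<integral>\<^sup>+x. ennreal (exp (- s * x)) * indicator {0<..} x \<partial>lborel) = ennreal (1 / s)"
proof -
  interpret prob_space "density lborel (exponential_density s)" by (rule prob_space_exponential_density[OF s])
  have "(\<integral>\<^sup>+x. ennreal (exponential_density s x) \<partial>lborel) = 1"
    using emeasure_space_1 by (simp add: emeasure_density)
  moreover have "(\<integral>\<^sup>+x. ennreal (exponential_density s x) \<partial>lborel) =
     (\<integral>\<^sup>+x. ennreal s * (ennreal (exp (- s * x)) * indicator {0<..} x) \<partial>lborel)"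
  proof (rule nn_integral_cong_AE)
    have "AE x in lborel. x \<noteq> (0::real)" by (rule AE_lborel_singleton)
    then show "AE x in lborel. ennreal (exponential_density s x) = ennreal s * (ennreal (exp (- s * x)) * indicator {0<..} x)"
      by eventually_elim
        (use s in \<open>auto simp: exponential_density_def ennreal_mult'[symmetric] mult_ac split: split_indicator\<close>)
  qed
  moreover have "\<dots> = ennreal s * (\<integral>\<^sup>+x. ennreal (exp (- s * x)) * indicator {0<..} x \<partial>lborel)"
    by (rule nn_integral_cmult) auto
  ultimately have eq: "ennreal s * (\<integral>\<^sup>+x. ennreal (exp (- s * x)) * indicator {0<..} x \<partial>lborel) = 1" by simp
  have "ennreal (1 / s) * (ennreal s * (\<integral>\<^sup>+x. ennreal (exp (- s * x)) * indicator {0<..} x \<partial>lborel)) =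
    (\<integral>\<^sup>+x. ennreal (exp (- s * x)) * indicator {0<..} x \<partial>lborel)"
    using s by (simp add: mult.assoc[symmetric] ennreal_mult'[symmetric])
  then show ?thesis unfolding eq by simp
qed

text \<open>The three branches share one constant, since \<eta> = r \<gamma> makes the uniform
  height equal to the exponential densities at the edges. The density is thus an even function of
  the distance of y from the band.\<close>

lemma stationary_density_eq:
  assumes "0 < \<sigma>" "0 < lam" "0 < \<gamma>"
  defines "r \<equiv> sqrt (2 * lam) / \<sigma>"
  shows "stationary_density \<sigma> lam \<gamma> y = r / (2 * (1 + r * \<gamma>)) * exp (- r * max (\<bar>y\<bar> - \<gamma>) 0)"
proof -
  have \<eta>: "sqrt (2 * lam) * \<gamma> / \<sigma> = r * \<gamma>" by (simp add: r_def)
  have r: "0 < r" using assms by (simp add: r_def)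
  have nz: "1 + r * \<gamma> \<noteq> 0" using r assms(3) by (metis add_pos_pos less_irrefl mult_pos_pos zero_less_one)
  consider "y > \<gamma>" | "y < - \<gamma>" | "\<bar>y\<bar> \<le> \<gamma>" by linarith
  then show ?thesis
  proof cases
    case 1
    then have "max (\<bar>y\<bar> - \<gamma>) 0 = y - \<gamma>" using assms(3) by auto
    then show ?thesis using 1 nz unfolding stationary_density_def \<eta> r_def[symmetric] Let_def
      by (simp add: exponential_density_def field_simps)
  next
    case 2
    then have "max (\<bar>y\<bar> - \<gamma>) 0 = - \<gamma> - y" using assms(3) by auto
    then show ?thesis using 2 nz assms(3) unfolding stationary_density_def \<eta> r_def[symmetric] Let_def
      by (simp add: exponential_density_def field_simps)
  next
    case 3
    then have "max (\<bar>y\<bar> - \<gamma>) 0 = 0" by auto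
    moreover have "r * \<gamma> / c * (1 / (2 * \<gamma>)) = r / (2 * c)" for c
      using assms(3) by (cases "c = 0") (auto simp: field_simps)
    ultimately show ?thesis using 3 unfolding stationary_density_def \<eta> r_def[symmetric] Let_def
      by auto
  qed
qed

lemma sqrt_exp: "sqrt (exp x) = exp (x / 2)"
proof -
  have "exp x = (exp (x / 2))\<^sup>2" by (simp add: exp_double[symmetric])
  then show ?thesis by simp
qed

context arbitrage_model begin

abbreviation rate :: real where
  "rate \<equiv> sqrt (2 * lam) / \<sigma>"

abbreviation dens :: "real \<Rightarrow> real" where
  "dens \<equiv> stationary_density \<sigma> lam \<gamma>"

lemma rate_pos: "0 < rate"
  using lam \<sigma> by simp

lemmas dens_eq = stationary_density_eq[OF \<sigma> lam \<gamma>]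

lemma dens_const_pos: "0 < rate / (2 * (1 + rate * \<gamma>))"
proof -
  have "0 < 2 * (1 + rate * \<gamma>)" by (intro mult_pos_pos add_pos_pos rate_pos \<gamma>) simp_all
  with rate_pos show ?thesis by (rule divide_pos_pos)
qed

lemma dens_nonneg: "0 \<le> dens y"
  unfolding dens_eq by (intro mult_nonneg_nonneg less_imp_le[OF dens_const_pos]) simp

lemma dens_measurable [measurable]: "dens \<in> borel_measurable borel"
  by (subst fun_eq_iff[THEN iffD2, OF allI, OF dens_eq]) measurable

lemma nn_integral_z0:
  assumes "h \<in> borel_measurable borel"
  shows "(\<integral>\<^sup>+w. h (z0 w) \<partial>M) = (\<integral>\<^sup>+y. ennreal (dens y) * h y \<partial>lborel)"
  by (rule distributed_nn_integral[OF z0_distr, symmetric]) (use assms in simp)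

text \<open>On the whole line the density is at most a constant times exp (- rate |y|), so the
  integrand decays with exponent \<open>rate - a\<close>.\<close>

lemma nn_integral_dens_exp:
  assumes "a < rate"
  shows "(\<integral>\<^sup>+y. ennreal (dens y * exp (a * \<bar>y\<bar>)) \<partial>lborel) < \<infinity>"
proof -
  define c where "c = rate / (2 * (1 + rate * \<gamma>))"
  have c: "0 < c" unfolding c_def by (rule dens_const_pos)
  have "(\<integral>\<^sup>+y. ennreal (dens y * exp (a * \<bar>y\<bar>)) \<partial>lborel) \<le>
     (\<integral>\<^sup>+y. ennreal (c * exp (rate * \<gamma>)) * ennreal (exp (- (rate - a) * \<bar>y\<bar>)) \<partial>lborel)"
  proof (rule nn_integral_mono)
    fix y :: real
    have "exp (- rate * max (\<bar>y\<bar> - \<gamma>) 0) \<le> exp (- rate * (\<bar>y\<bar> - \<gamma>))"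
      using mult_left_mono[OF max.cobounded1[of "\<bar>y\<bar> - \<gamma>" 0] less_imp_le[OF rate_pos]] by simp
    then have "dens y * exp (a * \<bar>y\<bar>) \<le> c * exp (- rate * (\<bar>y\<bar> - \<gamma>)) * exp (a * \<bar>y\<bar>)"
      unfolding dens_eq c_def[symmetric] using c by (intro mult_right_mono mult_left_mono) auto
    also have "\<dots> = c * exp (rate * \<gamma>) * exp (- (rate - a) * \<bar>y\<bar>)"
      by (simp add: mult.assoc exp_add[symmetric]) (simp add: algebra_simps diff_divide_distrib)
    finally show "ennreal (dens y * exp (a * \<bar>y\<bar>)) \<le> ennreal (c * exp (rate * \<gamma>)) * ennreal (exp (- (rate - a) * \<bar>y\<bar>))"
      using c by (simp add: ennreal_mult'[symmetric] ennreal_leI)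
  qed
  also have "\<dots> = ennreal (c * exp (rate * \<gamma>)) * (\<integral>\<^sup>+y. ennreal (exp (- (rate - a) * \<bar>y\<bar>)) \<partial>lborel)"
    by (rule nn_integral_cmult) measurable
  also have "(\<integral>\<^sup>+y. ennreal (exp (- (rate - a) * \<bar>y\<bar>)) \<partial>lborel) =
     2 * (\<integral>\<^sup>+y. ennreal (exp (- (rate - a) * \<bar>y\<bar>)) * indicator {0<..} y \<partial>lborel)"
    by (rule nn_integral_even) auto
  also have "(\<integral>\<^sup>+y. ennreal (exp (- (rate - a) * \<bar>y\<bar>)) * indicator {0<..} y \<partial>lborel) =
     (\<integral>\<^sup>+y. ennreal (exp (- (rate - a) * y)) * indicator {0<..} y \<partial>lborel)"
    by (intro nn_integral_cong) (auto split: split_indicator)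
  also have "\<dots> = ennreal (1 / (rate - a))" by (rule nn_integral_exp_decay) (use assms in simp)
  also have "ennreal (c * exp (rate * \<gamma>)) * (2 * ennreal (1 / (rate - a))) < \<infinity>"
    by (simp add: ennreal_mult_less_top)
  finally show ?thesis .
qed

text \<open>Indexed from 0 like \<open>premium\<close>: \<open>profit k i\<close> belongs to the
  arrival \<open>Suc i\<close>, and \<open>k\<close> is a profile depending on the mispricing
  alone.\<close>

definition profit :: "(real \<Rightarrow> real) \<Rightarrow> nat \<Rightarrow> 'a \<Rightarrow> real" where
  "profit k i w = sqrt (P (\<tau> (Suc i) w) w) * k (premium i w)"

lemma profit_measurable:
  assumes [measurable]: "k \<in> borel_measurable borel"
  shows "profit k i \<in> borel_measurable M"
proof -
  have [measurable]: "(\<lambda>w. P (\<tau> (Suc i) w) w) \<in> borel_measurable M" by (rule P_arrival_measurable) simp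
  show ?thesis unfolding profit_def[abs_def] by (intro borel_measurable_times borel_measurable_sqrt) measurable
qed

lemma cumulative_eq:
  assumes "w \<in> space M"
  shows "cumulative (\<lambda>q y. sqrt q * k y) N \<tau> P z T w = (\<Sum>i<N T w. profit k i w)"
  using left_limit_premium[OF assms] by (simp add: cumulative_def profit_def sum.atLeast1_atMost_eq)

lemma cumulative_measurable:
  assumes [measurable]: "k \<in> borel_measurable borel" and "0 \<le> T"
  shows "cumulative (\<lambda>q y. sqrt q * k y) N \<tau> P z T \<in> borel_measurable M"
proof -
  have [measurable]: "N T \<in> measurable M (count_space UNIV)" by (rule N_measurable) fact
  have [measurable]: "profit k i \<in> borel_measurable M" for i by (rule profit_measurable) fact
  have "(\<lambda>w. (\<lambda>n w. \<Sum>i<n. profit k i w) (N T w) w) \<in> borel_measurable M"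
    by (rule measurable_compose_countable) measurable
  then show ?thesis by (subst measurable_cong[OF cumulative_eq]) auto
qed

definition expected_profit :: "(real \<Rightarrow> real) \<Rightarrow> real \<Rightarrow> nat \<Rightarrow> ennreal" where
  "expected_profit k T i = (\<integral>\<^sup>+w. (if Suc i \<le> N T w then ennreal (profit k i w) else 0) \<partial>M)"

text \<open>The random number of summands is encoded by indicators in an infinite series of
  nonnegative terms, which may then be integrated termwise.\<close>

lemma nn_integral_cumulative:
  assumes [measurable]: "k \<in> borel_measurable borel" and k: "\<And>y. 0 \<le> k y" and "0 \<le> T"
  shows "(\<integral>\<^sup>+w. ennreal (cumulative (\<lambda>q y. sqrt q * k y) N \<tau> P z T w) \<partial>M) = (\<Sum>i. expected_profit k T i)"
proof -
  have [measurable]: "N T \<in> measurable M (count_space UNIV)" by (rule N_measurable) fact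
  have [measurable]: "profit k i \<in> borel_measurable M" for i by (rule profit_measurable) fact
  have nonneg: "0 \<le> profit k i w" if "w \<in> space M" for i w
    using k P_pos[OF that] arrival_pos[OF that, of "Suc i"] by (simp add: profit_def less_imp_le)
  have "(\<integral>\<^sup>+w. ennreal (cumulative (\<lambda>q y. sqrt q * k y) N \<tau> P z T w) \<partial>M) =
     (\<integral>\<^sup>+w. (\<Sum>i. if Suc i \<le> N T w then ennreal (profit k i w) else 0) \<partial>M)"
  proof (rule nn_integral_cong)
    fix w assume w: "w \<in> space M"
    have "(\<Sum>i. if Suc i \<le> N T w then ennreal (profit k i w) else 0) = (\<Sum>i<N T w. if Suc i \<le> N T w then ennreal (profit k i w) else 0)"
      by (rule suminf_finite) auto
    also have "\<dots> = ennreal (\<Sum>i<N T w. profit k i w)"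
      using nonneg[OF w] by (subst sum_ennreal[symmetric]) auto
    finally show "ennreal (cumulative (\<lambda>q y. sqrt q * k y) N \<tau> P z T w) = (\<Sum>i. if Suc i \<le> N T w then ennreal (profit k i w) else 0)"
      by (simp add: cumulative_eq[OF w])
  qed
  also have "\<dots> = (\<Sum>i. expected_profit k T i)"
    unfolding expected_profit_def by (rule nn_integral_suminf) measurable
  finally show ?thesis .
qed

lemma has_expectation_cumulative:
  assumes [measurable]: "k \<in> borel_measurable borel" and k: "\<And>y. 0 \<le> k y" and T: "0 \<le> T"
  shows "has_expectation M (cumulative (\<lambda>q y. sqrt q * k y) N \<tau> P z T) (enn2ereal (\<Sum>i. expected_profit k T i))"
proof -
  have "0 \<le> cumulative (\<lambda>q y. sqrt q * k y) N \<tau> P z T w" if "w \<in> space M" for w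
    unfolding cumulative_eq[OF that]
    using k P_pos[OF that] arrival_pos[OF that] by (auto simp: profit_def less_imp_le intro!: sum_nonneg)
  then have "(\<integral>\<^sup>+w. ennreal (- cumulative (\<lambda>q y. sqrt q * k y) N \<tau> P z T w) \<partial>M) = (\<integral>\<^sup>+w. 0 \<partial>M)"
    by (intro nn_integral_cong ennreal_neg) simp
  then show ?thesis
    unfolding has_expectation_def nn_integral_cumulative[OF assms]
    using cumulative_measurable[OF assms(1) T] by (simp add: zero_ennreal.rep_eq)
qed

text \<open>Mean profit of a first arrival frozen at time t, with the price replaced by its explicit
  solution and separate sample points for B and \<open>z0\<close>.\<close>

definition first_profit :: "(real \<Rightarrow> real) \<Rightarrow> real \<Rightarrow> ennreal" where
  "first_profit k t = (\<integral>\<^sup>+w'. \<integral>\<^sup>+w''. ennreal (sqrt p * exp (\<sigma> * B t w' / 2) * k (z0 w'' + \<sigma> * B t w')) \<partial>M \<partial>M)"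

lemma AE_price: "AE w in M. \<forall>t\<ge>0. P t w = p * exp (\<sigma> * B t w)"
  by (rule price_eq) (use P0 in auto)

lemma sqrt_price: "sqrt (p * exp (\<sigma> * x)) = sqrt p * exp (\<sigma> * x / 2)"
  by (simp add: real_sqrt_mult sqrt_exp)

lemma expected_profit_0:
  assumes [measurable]: "k \<in> borel_measurable borel" and T: "0 \<le> T"
  shows "expected_profit k T 0 = (\<integral>\<^sup>+w. (if 1 \<le> N T w then first_profit k (\<tau> 1 w) else 0) \<partial>M)"
proof -
  \<comment> \<open>Only one Brownian value enters at the first arrival, so the third component of q
    is ignored and both indices of the decoupling are 1.\<close>
  define H where "H q = ennreal (sqrt p * exp (\<sigma> * fst (snd q) / 2) * k (fst q + \<sigma> * fst (snd q)))"
    for q :: "real \<times> real \<times> real"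
  have H: "H \<in> borel_measurable (borel \<Otimes>\<^sub>M borel \<Otimes>\<^sub>M borel)" unfolding H_def by measurable
  have "expected_profit k T 0 = (\<integral>\<^sup>+w. (if 1 \<le> N T w then H (z0 w, B (\<tau> 1 w) w, B (\<tau> 1 w) w) else 0) \<partial>M)"
    unfolding expected_profit_def
  proof (rule nn_integral_cong_AE)
    show "AE w in M. (if Suc 0 \<le> N T w then ennreal (profit k 0 w) else 0) =
       (if 1 \<le> N T w then H (z0 w, B (\<tau> 1 w) w, B (\<tau> 1 w) w) else 0)"
      using AE_price AE_space
    proof eventually_elim
      case (elim w)
      then have "P (\<tau> 1 w) w = p * exp (\<sigma> * B (\<tau> 1 w) w)" using arrival_nonneg[of w 1] by simp
      then show ?case by (simp add: profit_def H_def sqrt_price)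
    qed
  qed
  also have "\<dots> = (\<integral>\<^sup>+w. (if 1 \<le> N T w then first_profit k (\<tau> 1 w) else 0) \<partial>M)"
    unfolding nn_integral_arrival_decouple[OF H order_refl order_refl T] unfolding H_def first_profit_def
    by (simp cong: if_cong)
  finally show ?thesis .
qed

text \<open>Brownian scaling replaces \<open>B t\<close> by sqrt t times a standard normal variable.
  The time then occurs only in the integrand, over a fixed measure, which suits dominated
  convergence.\<close>

lemma first_profit_eq:
  assumes [measurable]: "k \<in> borel_measurable borel" and k: "\<And>y. 0 \<le> k y" and t: "0 < t"
  shows "first_profit k t = (\<integral>\<^sup>+x. ennreal (std_normal_density x) *
    (\<integral>\<^sup>+y. ennreal (dens y * (sqrt p * exp (\<sigma> * (sqrt t * x) / 2) * k (y + \<sigma> * (sqrt t * x)))) \<partial>lborel) \<partial>lborel)"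
proof -
  define I where "I x = (\<integral>\<^sup>+y. ennreal (dens y * (sqrt p * exp (\<sigma> * x / 2) * k (y + \<sigma> * x))) \<partial>lborel)" for x
  have I [measurable]: "I \<in> borel_measurable borel" unfolding I_def by measurable
  have "first_profit k t = (\<integral>\<^sup>+w. I (B t w) \<partial>M)"
    unfolding first_profit_def
  proof (rule nn_integral_cong)
    fix w
    have "(\<integral>\<^sup>+w''. ennreal (sqrt p * exp (\<sigma> * B t w / 2) * k (z0 w'' + \<sigma> * B t w)) \<partial>M) =
       (\<integral>\<^sup>+y. ennreal (dens y) * ennreal (sqrt p * exp (\<sigma> * B t w / 2) * k (y + \<sigma> * B t w)) \<partial>lborel)"
      by (rule nn_integral_z0) measurable
    also have "\<dots> = I (B t w)"
      unfolding I_def using dens_nonneg by (simp add: ennreal_mult'[symmetric])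
    finally show "(\<integral>\<^sup>+w''. ennreal (sqrt p * exp (\<sigma> * B t w / 2) * k (z0 w'' + \<sigma> * B t w)) \<partial>M) = I (B t w)" .
  qed
  also have "\<dots> = (\<integral>\<^sup>+w. I (B (0 + t) w - B 0 w) \<partial>M)"
    by (intro nn_integral_cong) (simp add: B_0)
  also have "\<dots> = (\<integral>\<^sup>+x. ennreal (normal_density 0 (sqrt t) x) * I x \<partial>lborel)"
    by (rule distributed_nn_integral[OF increment_distributed[OF order_refl t], symmetric]) simp
  also have "\<dots> = ennreal \<bar>sqrt t\<bar> * (\<integral>\<^sup>+x. ennreal (normal_density 0 (sqrt t) (0 + sqrt t * x)) * I (0 + sqrt t * x) \<partial>lborel)"
    using t by (subst nn_integral_real_affine[where c="sqrt t" and t=0]) auto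
  also have "\<dots> = (\<integral>\<^sup>+x. ennreal \<bar>sqrt t\<bar> * (ennreal (normal_density 0 (sqrt t) (0 + sqrt t * x)) * I (0 + sqrt t * x)) \<partial>lborel)"
    by (rule nn_integral_cmult[symmetric]) measurable
  also have "\<dots> = (\<integral>\<^sup>+x. ennreal (std_normal_density x) * I (sqrt t * x) \<partial>lborel)"
  proof (rule nn_integral_cong)
    fix x :: real
    have "sqrt t * normal_density 0 (sqrt t) (sqrt t * x) = std_normal_density x"
      using t by (simp add: normal_density_def real_sqrt_mult power_mult_distrib field_simps)
    then have "ennreal \<bar>sqrt t\<bar> * ennreal (normal_density 0 (sqrt t) (sqrt t * x)) = ennreal (std_normal_density x)"
      using t by (simp add: ennreal_mult'[symmetric])
    then show "ennreal \<bar>sqrt t\<bar> * (ennreal (normal_density 0 (sqrt t) (0 + sqrt t * x)) * I (0 + sqrt t * x)) = ennreal (std_normal_density x) * I (sqrt t * x)"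
      by (simp add: mult.assoc[symmetric])
  qed
  finally show ?thesis unfolding I_def .
qed

end

context arbitrage_model begin

text \<open>Dominated convergence is applied first in the initial mispricing y, then in the Gaussian
  variable x. The restriction to times below 1 gives a majorant in which x and y separate.\<close>

lemma first_profit_tendsto:
  assumes cont: "continuous_on UNIV k" and k: "\<And>y. 0 \<le> k y"
    and bd: "\<And>y. k y \<le> C * exp (a * \<bar>y\<bar>)" and a: "0 \<le> a" "a < rate"
  shows "(first_profit k \<longlongrightarrow> (\<integral>\<^sup>+y. ennreal (dens y * (sqrt p * k y)) \<partial>lborel)) (at_right 0)"
proof (rule tendsto_at_right_sequentially[of 0 1])
  have [measurable]: "k \<in> borel_measurable borel" by (rule borel_measurable_continuous_onI[OF cont])
  fix S :: "nat \<Rightarrow> real"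
  assume S: "\<And>n. 0 < S n" "\<And>n. S n < 1" "S \<longlonglongrightarrow> 0"
  define u where "u n x y = dens y * (sqrt p * exp (\<sigma> * (sqrt (S n) * x) / 2) * k (y + \<sigma> * (sqrt (S n) * x)))" for n x y
  \<comment> \<open>The exponent 1/2 comes from the square root of the price and \<open>a\<close>
    from the growth of \<open>k\<close> under the shift by \<sigma> sqrt t x, where |sqrt t x| \<le>
    |x|.\<close>
  define D where "D x = sqrt p * (C * exp ((1 / 2 + a) * \<sigma> * \<bar>x\<bar>))" for x
  define Z where "Z = (\<integral>\<^sup>+y. ennreal (dens y * exp (a * \<bar>y\<bar>)) \<partial>lborel)"
  have Z: "Z < \<infinity>" unfolding Z_def by (rule nn_integral_dens_exp[OF a(2)])
  have C: "0 \<le> C" using order_trans[OF k bd, of 0] by simp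
  have D: "0 \<le> D x" for x using C p by (simp add: D_def)
  have [measurable]: "u n x \<in> borel_measurable borel" for n x unfolding u_def by measurable
  have [measurable]: "(\<lambda>x. \<integral>\<^sup>+y. ennreal (u n x y) \<partial>lborel) \<in> borel_measurable borel" for n
    unfolding u_def by measurable
  have [measurable]: "D \<in> borel_measurable borel" unfolding D_def by measurable
  have u_le: "u n x y \<le> D x * (dens y * exp (a * \<bar>y\<bar>))" for n x y
  proof -
    have "sqrt (S n) \<le> 1" using S(2)[of n] by simp
    then have s: "\<bar>sqrt (S n) * x\<bar> \<le> \<bar>x\<bar>" using S(1)[of n] by (simp add: abs_mult mult_left_le_one_le)
    have "\<sigma> * (sqrt (S n) * x) \<le> \<sigma> * \<bar>x\<bar>" using s \<sigma> by (intro mult_left_mono) auto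
    then have e1: "exp (\<sigma> * (sqrt (S n) * x) / 2) \<le> exp (\<sigma> * \<bar>x\<bar> / 2)" by simp
    have "\<bar>y + \<sigma> * (sqrt (S n) * x)\<bar> \<le> \<bar>y\<bar> + \<sigma> * \<bar>sqrt (S n) * x\<bar>"
      using \<sigma> abs_triangle_ineq[of y "\<sigma> * (sqrt (S n) * x)"] by (simp add: abs_mult)
    also have "\<dots> \<le> \<bar>y\<bar> + \<sigma> * \<bar>x\<bar>" using s \<sigma> by (intro add_left_mono mult_left_mono) auto
    finally have "a * \<bar>y + \<sigma> * (sqrt (S n) * x)\<bar> \<le> a * (\<bar>y\<bar> + \<sigma> * \<bar>x\<bar>)" using a by (intro mult_left_mono)
    then have "C * exp (a * \<bar>y + \<sigma> * (sqrt (S n) * x)\<bar>) \<le> C * exp (a * (\<bar>y\<bar> + \<sigma> * \<bar>x\<bar>))"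
      using C by (intro mult_left_mono) auto
    with bd have "k (y + \<sigma> * (sqrt (S n) * x)) \<le> C * exp (a * (\<bar>y\<bar> + \<sigma> * \<bar>x\<bar>))" by (rule order_trans)
    then have "exp (\<sigma> * (sqrt (S n) * x) / 2) * k (y + \<sigma> * (sqrt (S n) * x)) \<le> exp (\<sigma> * \<bar>x\<bar> / 2) * (C * exp (a * (\<bar>y\<bar> + \<sigma> * \<bar>x\<bar>)))"
      using e1 k by (intro mult_mono) auto
    also have "\<dots> = C * exp ((1 / 2 + a) * \<sigma> * \<bar>x\<bar>) * exp (a * \<bar>y\<bar>)"
      by (simp add: exp_add[symmetric] mult_ac) (simp add: algebra_simps)
    finally have "dens y * (sqrt p * (exp (\<sigma> * (sqrt (S n) * x) / 2) * k (y + \<sigma> * (sqrt (S n) * x)))) \<le>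
       dens y * (sqrt p * (C * exp ((1 / 2 + a) * \<sigma> * \<bar>x\<bar>) * exp (a * \<bar>y\<bar>)))"
      using dens_nonneg p by (intro mult_left_mono) auto
    then show ?thesis by (simp add: u_def D_def mult_ac)
  qed
  have inner_le: "(\<integral>\<^sup>+y. ennreal (u n x y) \<partial>lborel) \<le> ennreal (D x) * Z" for n x
  proof -
    have "(\<integral>\<^sup>+y. ennreal (u n x y) \<partial>lborel) \<le> (\<integral>\<^sup>+y. ennreal (D x) * ennreal (dens y * exp (a * \<bar>y\<bar>)) \<partial>lborel)"
      using D u_le by (intro nn_integral_mono) (simp add: ennreal_mult'[symmetric] ennreal_leI)
    also have "\<dots> = ennreal (D x) * Z" unfolding Z_def by (rule nn_integral_cmult) measurable
    finally show ?thesis .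
  qed
  define c0 where "c0 = (\<integral>\<^sup>+y. ennreal (dens y * (sqrt p * k y)) \<partial>lborel)"
  have sq: "(\<lambda>n. sqrt (S n) * x) \<longlonglongrightarrow> 0" for x
    using tendsto_mult_right[OF tendsto_real_sqrt[OF S(3)], of x] by (simp add: mult.commute)
  have inner: "(\<lambda>n. \<integral>\<^sup>+y. ennreal (u n x y) \<partial>lborel) \<longlonglongrightarrow> c0" for x
    unfolding c0_def
  proof (rule nn_integral_dominated_convergence[where w="\<lambda>y. ennreal (D x * (dens y * exp (a * \<bar>y\<bar>)))"])
    have "(\<integral>\<^sup>+y. ennreal (D x * (dens y * exp (a * \<bar>y\<bar>))) \<partial>lborel) = ennreal (D x) * Z"
      unfolding Z_def using D by (simp add: ennreal_mult' nn_integral_cmult)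
    also have "\<dots> < \<infinity>" using Z by (simp add: ennreal_mult_less_top)
    finally show "(\<integral>\<^sup>+y. ennreal (D x * (dens y * exp (a * \<bar>y\<bar>))) \<partial>lborel) < \<infinity>" .
    show "AE y in lborel. (\<lambda>n. ennreal (u n x y)) \<longlonglongrightarrow> ennreal (dens y * (sqrt p * k y))"
    proof (intro AE_I2 tendsto_ennrealI)
      fix y :: real
      have "(\<lambda>n. y + \<sigma> * (sqrt (S n) * x)) \<longlonglongrightarrow> y + \<sigma> * 0" by (intro tendsto_intros sq)
      then have "(\<lambda>n. k (y + \<sigma> * (sqrt (S n) * x))) \<longlonglongrightarrow> k y"
        by (intro continuous_on_tendsto_compose[OF cont]) auto
      moreover have "(\<lambda>n. exp (\<sigma> * (sqrt (S n) * x) / 2)) \<longlonglongrightarrow> exp (\<sigma> * 0 / 2)" by (intro tendsto_intros sq) simp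
      ultimately have "(\<lambda>n. u n x y) \<longlonglongrightarrow> dens y * (sqrt p * exp (\<sigma> * 0 / 2) * k y)"
        unfolding u_def by (intro tendsto_mult tendsto_const)
      then show "(\<lambda>n. u n x y) \<longlonglongrightarrow> dens y * (sqrt p * k y)" by simp
    qed
  qed (use u_le in \<open>auto intro!: AE_I2 ennreal_leI\<close>)
  have "(\<lambda>n. \<integral>\<^sup>+x. ennreal (std_normal_density x) * (\<integral>\<^sup>+y. ennreal (u n x y) \<partial>lborel) \<partial>lborel) \<longlonglongrightarrow>
     (\<integral>\<^sup>+x. ennreal (std_normal_density x) * c0 \<partial>lborel)"
  proof (rule nn_integral_dominated_convergence[where w="\<lambda>x. ennreal (std_normal_density x) * (ennreal (D x) * Z)"])
    \<comment> \<open>Bounding exp (b |x|) by exp (b x) + exp (- b x) reduces the integrability of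
      the majorant to Gaussian exponential moments.\<close>
    define b where "b = (1 / 2 + a) * \<sigma>"
    have e: "(\<integral>\<^sup>+x. ennreal (std_normal_density x * exp (s * x)) \<partial>lborel) < \<infinity>" for s
    proof -
      have "integrable lborel (\<lambda>x. std_normal_density x * exp (s * x))"
        using has_bochner_integral_normal_exp_quadratic[of 1 s 1 0 0] by (simp add: has_bochner_integral_iff)
      then show ?thesis by (simp add: nn_integral_eq_integral)
    qed
    have "(\<integral>\<^sup>+x. ennreal (std_normal_density x * D x) \<partial>lborel) \<le>
       (\<integral>\<^sup>+x. ennreal (sqrt p * C) * (ennreal (std_normal_density x * exp (b * x)) + ennreal (std_normal_density x * exp (- b * x))) \<partial>lborel)"
    proof (rule nn_integral_mono)
      fix x :: real
      have "exp (b * \<bar>x\<bar>) \<le> exp (b * x) + exp (- b * x)" by (cases "0 \<le> x") auto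
      then have "sqrt p * C * (std_normal_density x * exp (b * \<bar>x\<bar>)) \<le> sqrt p * C * (std_normal_density x * (exp (b * x) + exp (- b * x)))"
        using p C by (intro mult_left_mono) auto
      then have "std_normal_density x * D x \<le> sqrt p * C * (std_normal_density x * exp (b * x) + std_normal_density x * exp (- b * x))"
        by (simp add: D_def b_def algebra_simps)
      then show "ennreal (std_normal_density x * D x) \<le> ennreal (sqrt p * C) * (ennreal (std_normal_density x * exp (b * x)) + ennreal (std_normal_density x * exp (- b * x)))"
        using p C by (simp add: ennreal_plus[symmetric] ennreal_mult'[symmetric] ennreal_leI del: ennreal_plus)
    qed
    also have "\<dots> = ennreal (sqrt p * C) * ((\<integral>\<^sup>+x. ennreal (std_normal_density x * exp (b * x)) \<partial>lborel) + (\<integral>\<^sup>+x. ennreal (std_normal_density x * exp (- b * x)) \<partial>lborel))"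
      by (simp add: nn_integral_cmult nn_integral_add)
    also have "\<dots> < \<infinity>" using e[of b] e[of "- b"] by (simp add: ennreal_mult_less_top)
    finally have fin: "(\<integral>\<^sup>+x. ennreal (std_normal_density x * D x) \<partial>lborel) < \<infinity>" .
    have "(\<integral>\<^sup>+x. ennreal (std_normal_density x) * (ennreal (D x) * Z) \<partial>lborel) = (\<integral>\<^sup>+x. ennreal (std_normal_density x * D x) \<partial>lborel) * Z"
      using D by (simp add: nn_integral_multc[symmetric] ennreal_mult' mult.assoc)
    also have "\<dots> < \<infinity>" using fin Z by (simp add: ennreal_mult_less_top)
    finally show "(\<integral>\<^sup>+x. ennreal (std_normal_density x) * (ennreal (D x) * Z) \<partial>lborel) < \<infinity>" .
    show "AE x in lborel. (\<lambda>n. ennreal (std_normal_density x) * (\<integral>\<^sup>+y. ennreal (u n x y) \<partial>lborel)) \<longlonglongrightarrow> ennreal (std_normal_density x) * c0"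
      by (intro AE_I2 ennreal_tendsto_cmult inner) simp
  qed (use inner_le in \<open>auto intro!: AE_I2 mult_left_mono\<close>)
  also have "(\<integral>\<^sup>+x. ennreal (std_normal_density x) * c0 \<partial>lborel) = c0"
  proof -
    have "(\<integral>\<^sup>+x. ennreal (std_normal_density x) \<partial>lborel) = 1"
      by (simp add: nn_integral_eq_integral)
    then show ?thesis by (simp add: nn_integral_multc)
  qed
  finally show "(\<lambda>n. first_profit k (S n)) \<longlonglongrightarrow> (\<integral>\<^sup>+y. ennreal (dens y * (sqrt p * k y)) \<partial>lborel)"
    unfolding u_def c0_def using k S(1) by (simp add: first_profit_eq)
qed simp

lemma nn_integral_exp_increment:
  assumes "0 \<le> s" "s < t" "t \<le> 1"
  shows "(\<integral>\<^sup>+w. ennreal (exp (b * (B t w - B s w))) \<partial>M) \<le> ennreal (exp (b\<^sup>2 / 2))"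
proof -
  have h: "has_bochner_integral M (\<lambda>w. exp (b * (B t w - B s w))) (exp (b\<^sup>2 * (t - s) / 2))"
    using increment_exp_quadratic[of s "t - s" b 1 0 0] assms by simp
  then have "(\<integral>\<^sup>+w. ennreal (exp (b * (B t w - B s w))) \<partial>M) = ennreal (exp (b\<^sup>2 * (t - s) / 2))"
    by (subst nn_integral_eq_integral) (auto simp: has_bochner_integral_iff)
  also have "\<dots> \<le> ennreal (exp (b\<^sup>2 / 2))"
    using assms by (intro ennreal_leI) (auto intro!: divide_right_mono mult_left_le)
  finally show ?thesis .
qed

text \<open>Clamping at the previous arrival bounds the mispricing by \<open>\<gamma>\<close> plus
  one Brownian increment, so every exponent \<open>a \<ge> 0\<close> is allowed here, whatever the
  tails of the stationary law. The estimate g h \<le> \<open>g\<^sup>2 + h\<^sup>2\<close> separates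
  price and mispricing and avoids their joint law.\<close>

lemma later_profit_bound:
  assumes [measurable]: "k \<in> borel_measurable borel" and k: "\<And>y. 0 \<le> k y"
    and bd: "\<And>y. k y \<le> C * exp (a * \<bar>y\<bar>)" and a: "0 \<le> a"
    and T: "0 < T" "T \<le> 1"
  shows "expected_profit k T (Suc i) \<le>
    ennreal (C * sqrt p * exp (a * \<gamma>) * (exp (\<sigma>\<^sup>2 / 2) + 2 * exp ((2 * a * \<sigma>)\<^sup>2 / 2))) *
      (\<integral>\<^sup>+w. (if Suc (Suc i) \<le> N T w then 1 else 0) \<partial>M)"
proof -
  have C: "0 \<le> C" using order_trans[OF k bd, of 0] by simp
  define A where "A = C * sqrt p * exp (a * \<gamma>)"
  have A: "0 \<le> A" using C p by (simp add: A_def)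
  \<comment> \<open>The first exponential is the square of the price factor; the other two bound the
    square of exp (a |\<sigma> (y - v)|) for either sign. The initial mispricing survives only
    through the bound \<open>\<gamma>\<close> contained in A.\<close>
  define H where "H q = (case q of (x :: real, y, v) \<Rightarrow>
     ennreal A * (ennreal (exp (\<sigma> * y)) + ennreal (exp (2 * a * \<sigma> * (y - v))) + ennreal (exp (- 2 * a * \<sigma> * (y - v)))))" for q
  have H: "H \<in> borel_measurable (borel \<Otimes>\<^sub>M borel \<Otimes>\<^sub>M borel)" unfolding H_def by measurable
  have [measurable]: "N T \<in> measurable M (count_space UNIV)" by (rule N_measurable) (use T in simp)
  have "expected_profit k T (Suc i) \<le>
     (\<integral>\<^sup>+w. (if Suc (Suc i) \<le> N T w then H (z0 w, B (\<tau> (Suc (Suc i)) w) w, B (\<tau> (Suc i) w) w) else 0) \<partial>M)"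
    unfolding expected_profit_def
  proof (rule nn_integral_mono_AE)
    show "AE w in M. (if Suc (Suc i) \<le> N T w then ennreal (profit k (Suc i) w) else 0) \<le>
       (if Suc (Suc i) \<le> N T w then H (z0 w, B (\<tau> (Suc (Suc i)) w) w, B (\<tau> (Suc i) w) w) else 0)"
      using AE_price AE_space
    proof eventually_elim
      case (elim w)
      define y where "y = B (\<tau> (Suc (Suc i)) w) w"
      define v where "v = B (\<tau> (Suc i) w) w"
      have P: "P (\<tau> (Suc (Suc i)) w) w = p * exp (\<sigma> * y)"
        using elim arrival_nonneg[of w "Suc (Suc i)"] by (simp add: y_def)
      have "\<bar>premium (Suc i) w\<bar> \<le> \<gamma> + \<bar>\<sigma> * (y - v)\<bar>"
        using \<gamma> unfolding premium.simps y_def[symmetric] v_def[symmetric] by linarith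
      then have "a * \<bar>premium (Suc i) w\<bar> \<le> a * (\<gamma> + \<bar>\<sigma> * (y - v)\<bar>)" using a by (rule mult_left_mono)
      then have "C * exp (a * \<bar>premium (Suc i) w\<bar>) \<le> C * (exp (a * \<gamma>) * exp (a * \<bar>\<sigma> * (y - v)\<bar>))"
        using C by (intro mult_left_mono) (auto simp: exp_add[symmetric] distrib_left)
      then have "k (premium (Suc i) w) \<le> C * (exp (a * \<gamma>) * exp (a * \<bar>\<sigma> * (y - v)\<bar>))"
        by (rule order_trans[OF bd])
      then have "profit k (Suc i) w \<le> sqrt p * exp (\<sigma> * y / 2) * (C * (exp (a * \<gamma>) * exp (a * \<bar>\<sigma> * (y - v)\<bar>)))"
        unfolding profit_def P sqrt_price using p by (intro mult_left_mono) auto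
      also have "\<dots> = A * (exp (\<sigma> * y / 2) * exp (a * \<bar>\<sigma> * (y - v)\<bar>))" by (simp add: A_def mult_ac)
      also have "\<dots> \<le> A * (exp (\<sigma> * y) + exp (2 * a * \<sigma> * (y - v)) + exp (- 2 * a * \<sigma> * (y - v)))"
      proof (rule mult_left_mono[OF _ A])
        define g h where "g = exp (\<sigma> * y / 2)" and "h = exp (a * \<bar>\<sigma> * (y - v)\<bar>)"
        have "0 \<le> (g - h)\<^sup>2" "0 \<le> g * h" by (simp_all add: g_def h_def)
        then have "g * h \<le> g\<^sup>2 + h\<^sup>2" unfolding power2_diff by linarith
        also have "g\<^sup>2 = exp (\<sigma> * y)" by (simp add: g_def exp_double[symmetric])
        also have "h\<^sup>2 \<le> exp (2 * a * \<sigma> * (y - v)) + exp (- 2 * a * \<sigma> * (y - v))"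
          by (cases "0 \<le> \<sigma> * (y - v)") (auto simp: h_def exp_double[symmetric] mult_ac)
        finally show "g * h \<le> exp (\<sigma> * y) + exp (2 * a * \<sigma> * (y - v)) + exp (- 2 * a * \<sigma> * (y - v))" by simp
      qed
      finally have "ennreal (profit k (Suc i) w) \<le> H (z0 w, y, v)"
        using A unfolding H_def
        by (simp add: ennreal_plus[symmetric] ennreal_mult'[symmetric] ennreal_leI del: ennreal_plus)
      then show ?case by (simp add: y_def v_def)
    qed
  qed
  also have "\<dots> = (\<integral>\<^sup>+w. (if Suc (Suc i) \<le> N T w then \<integral>\<^sup>+w'. \<integral>\<^sup>+w''. H (z0 w'', B (\<tau> (Suc (Suc i)) w) w', B (\<tau> (Suc i) w) w') \<partial>M \<partial>M else 0) \<partial>M)"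
    by (rule nn_integral_arrival_decouple[OF H]) (use T in auto)
  also have "\<dots> \<le> (\<integral>\<^sup>+w. ennreal (A * (exp (\<sigma>\<^sup>2 / 2) + 2 * exp ((2 * a * \<sigma>)\<^sup>2 / 2))) * (if Suc (Suc i) \<le> N T w then 1 else 0) \<partial>M)"
  proof (rule nn_integral_mono)
    fix w assume w: "w \<in> space M"
    show "(if Suc (Suc i) \<le> N T w then \<integral>\<^sup>+w'. \<integral>\<^sup>+w''. H (z0 w'', B (\<tau> (Suc (Suc i)) w) w', B (\<tau> (Suc i) w) w') \<partial>M \<partial>M else 0) \<le>
       ennreal (A * (exp (\<sigma>\<^sup>2 / 2) + 2 * exp ((2 * a * \<sigma>)\<^sup>2 / 2))) * (if Suc (Suc i) \<le> N T w then 1 else 0)"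
    proof (cases "Suc (Suc i) \<le> N T w")
      case True
      define t s where "t = \<tau> (Suc (Suc i)) w" and "s = \<tau> (Suc i) w"
      have st: "0 < s" "s < t" "t \<le> 1"
        using arrival_pos[OF w, of "Suc i"] arrival_less[OF w, of "Suc i" "Suc (Suc i)"] 
          arrival_le_iff[OF w, of "Suc (Suc i)" T] True T by (auto simp: t_def s_def)
      have [measurable]: "B t \<in> borel_measurable M" "B s \<in> borel_measurable M"
        using st by (auto intro: B_measurable)
      \<comment> \<open>Reading \<open>B t\<close> as an increment from time 0 brings the price
        factor under the same moment bound, uniform since all times are at most 1.\<close>
      have B0: "(\<integral>\<^sup>+w'. ennreal (exp (\<sigma> * B t w')) \<partial>M) = (\<integral>\<^sup>+w'. ennreal (exp (\<sigma> * (B t w' - B 0 w'))) \<partial>M)"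
        by (intro nn_integral_cong) (simp add: B_0)
      have "(\<integral>\<^sup>+w'. \<integral>\<^sup>+w''. H (z0 w'', B t w', B s w') \<partial>M \<partial>M) =
         (\<integral>\<^sup>+w'. ennreal A * (ennreal (exp (\<sigma> * B t w')) + ennreal (exp (2 * a * \<sigma> * (B t w' - B s w'))) +
            ennreal (exp (- 2 * a * \<sigma> * (B t w' - B s w')))) \<partial>M)"
        by (simp add: H_def emeasure_space_1)
      also have "\<dots> = ennreal A * ((\<integral>\<^sup>+w'. ennreal (exp (\<sigma> * B t w')) \<partial>M) + (\<integral>\<^sup>+w'. ennreal (exp (2 * a * \<sigma> * (B t w' - B s w'))) \<partial>M) +
            (\<integral>\<^sup>+w'. ennreal (exp (- 2 * a * \<sigma> * (B t w' - B s w'))) \<partial>M))"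
        by (simp add: nn_integral_cmult nn_integral_add)
      also have "\<dots> \<le> ennreal A * (ennreal (exp (\<sigma>\<^sup>2 / 2)) + ennreal (exp ((2 * a * \<sigma>)\<^sup>2 / 2)) + ennreal (exp ((- 2 * a * \<sigma>)\<^sup>2 / 2)))"
        unfolding B0 using st by (intro mult_left_mono add_mono nn_integral_exp_increment) auto
      also have "\<dots> = ennreal (A * (exp (\<sigma>\<^sup>2 / 2) + 2 * exp ((2 * a * \<sigma>)\<^sup>2 / 2)))"
        using A by (simp add: ennreal_plus[symmetric] ennreal_mult'[symmetric] power_mult_distrib algebra_simps del: ennreal_plus)
      finally show ?thesis using True by (simp add: t_def s_def)
    qed simp
  qed
  also have "\<dots> = ennreal (A * (exp (\<sigma>\<^sup>2 / 2) + 2 * exp ((2 * a * \<sigma>)\<^sup>2 / 2))) * (\<integral>\<^sup>+w. (if Suc (Suc i) \<le> N T w then 1 else 0) \<partial>M)"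
    by (rule nn_integral_cmult) measurable
  finally show ?thesis by (simp add: A_def)
qed

lemma suminf_later_arrivals:
  assumes T: "0 < T"
  shows "(\<Sum>i. \<integral>\<^sup>+w. (if Suc (Suc i) \<le> N T w then 1 else 0) \<partial>M) \<le> ennreal ((lam * T)\<^sup>2)"
proof -
  have [measurable]: "N T \<in> measurable M (count_space UNIV)" by (rule N_measurable) (use T in simp)
  have "(\<Sum>i. \<integral>\<^sup>+w. (if Suc (Suc i) \<le> N T w then 1 else 0) \<partial>M) = (\<integral>\<^sup>+w. (\<Sum>i. if Suc (Suc i) \<le> N T w then 1 else 0) \<partial>M)"
    by (rule nn_integral_suminf[symmetric]) measurable
  also have "\<dots> = (\<integral>\<^sup>+w. of_nat (N T w - 1) \<partial>M)"
  proof (rule nn_integral_cong)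
    fix w
    have "(\<Sum>i. if Suc (Suc i) \<le> N T w then 1 else 0 :: ennreal) = (\<Sum>i<N T w - 1. if Suc (Suc i) \<le> N T w then 1 else 0)"
      by (rule suminf_finite) auto
    also have "\<dots> = (\<Sum>i<N T w - 1. 1)" by (intro sum.cong) auto
    finally show "(\<Sum>i. if Suc (Suc i) \<le> N T w then 1 else 0 :: ennreal) = of_nat (N T w - 1)" by simp
  qed
  also have "\<dots> \<le> ennreal ((lam * T)\<^sup>2)" by (rule expected_excess_arrivals[OF T])
  finally show ?thesis .
qed

lemma nn_integral_arrival:
  assumes T: "0 < T"
  shows "(\<integral>\<^sup>+w. (if 1 \<le> N T w then c else 0) \<partial>M) = c * ennreal (1 - exp (- (lam * T)))"
proof -
  have [measurable]: "N T \<in> measurable M (count_space UNIV)" by (rule N_measurable) (use T in simp)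
  have "(\<integral>\<^sup>+w. (if 1 \<le> N T w then c else 0) \<partial>M) = (\<integral>\<^sup>+w. c * indicator {w \<in> space M. 1 \<le> N T w} w \<partial>M)"
    by (intro nn_integral_cong) (auto split: split_indicator)
  also have "\<dots> = c * emeasure M {w \<in> space M. 1 \<le> N T w}"
    by (rule nn_integral_cmult_indicator) measurable
  also have "\<dots> = c * ennreal (1 - exp (- (lam * T)))"
    by (simp only: emeasure_eq_measure prob_arrival[OF T])
  finally show ?thesis .
qed

text \<open>If an arrival occurs by time T, then the first one lies in (0, T], where
  \<open>first_profit\<close> is within \<epsilon> of its limit c; it contributes c times the
  probability \<open>q T\<close> of an arrival, up to \<epsilon> \<open>q T\<close>. Since
  \<open>q T / T\<close> tends to \<open>lam\<close> and the later arrivals add order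
  \<open>T\<^sup>2\<close>, the limit is \<open>lam * c\<close>.\<close>

lemma has_intensity_finite:
  assumes cont: "continuous_on UNIV k" and k: "\<And>y. 0 \<le> k y"
    and bd: "\<And>y. k y \<le> C * exp (a * \<bar>y\<bar>)" and a: "0 \<le> a" "a < rate"
    and c0: "(\<integral>\<^sup>+y. ennreal (dens y * k y) \<partial>lborel) = ennreal c0" "0 \<le> c0"
  shows "has_intensity M (cumulative (\<lambda>q y. sqrt q * k y) N \<tau> P z) (ereal (lam * (sqrt p * c0)))"
proof -
  have k_meas [measurable]: "k \<in> borel_measurable borel" by (rule borel_measurable_continuous_onI[OF cont])
  define c where "c = sqrt p * c0"
  have c: "0 \<le> c" using c0 p by (simp add: c_def)
  define A where "A = C * sqrt p * exp (a * \<gamma>) * (exp (\<sigma>\<^sup>2 / 2) + 2 * exp ((2 * a * \<sigma>)\<^sup>2 / 2))"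
  have "0 \<le> C" using order_trans[OF k bd, of 0] by simp
  then have A: "0 \<le> A" using p by (simp add: A_def)
  define q where "q T = 1 - exp (- (lam * T))" for T
  define X where "X T = (\<Sum>i. expected_profit k T i)" for T
  have "(\<integral>\<^sup>+y. ennreal (dens y * (sqrt p * k y)) \<partial>lborel) = (\<integral>\<^sup>+y. ennreal (sqrt p) * ennreal (dens y * k y) \<partial>lborel)"
    using p by (intro nn_integral_cong) (simp add: ennreal_mult'[symmetric] mult_ac)
  also have "\<dots> = ennreal (sqrt p) * ennreal c0" by (subst nn_integral_cmult) (auto simp: c0)
  also have "\<dots> = ennreal c" using p by (simp add: ennreal_mult' c_def)
  finally have lim: "(first_profit k \<longlongrightarrow> ennreal c) (at_right 0)"
    using first_profit_tendsto[OF cont k bd a] by simp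
  have q: "0 \<le> q T" "q T \<le> lam * T" if "0 < T" for T
    using that lam exp_ge_add_one_self[of "- (lam * T)"] by (auto simp: q_def)
  have rest: "(\<Sum>i. expected_profit k T (Suc i)) \<le> ennreal (A * (lam * T)\<^sup>2)" if T: "0 < T" "T \<le> 1" for T
  proof -
    have "(\<Sum>i. expected_profit k T (Suc i)) \<le> (\<Sum>i. ennreal A * (\<integral>\<^sup>+w. (if Suc (Suc i) \<le> N T w then 1 else 0) \<partial>M))"
      unfolding A_def using later_profit_bound[OF k_meas k bd a(1) T] by (intro suminf_le) auto
    also have "\<dots> = ennreal A * (\<Sum>i. \<integral>\<^sup>+w. (if Suc (Suc i) \<le> N T w then 1 else 0) \<partial>M)" by (rule ennreal_suminf_cmult)
    also have "\<dots> \<le> ennreal A * ennreal ((lam * T)\<^sup>2)" by (intro mult_left_mono suminf_later_arrivals T) simp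
    finally show ?thesis using A by (simp add: ennreal_mult)
  qed
  have split: "X T = expected_profit k T 0 + (\<Sum>i. expected_profit k T (Suc i))" for T
    unfolding X_def by (subst suminf_offset[where i=1]) auto
  have bounds: "\<forall>\<^sub>F T in at_right 0. X T < \<infinity> \<and> \<bar>enn2real (X T) - c * q T\<bar> \<le> \<epsilon> * q T + A * (lam * T)\<^sup>2"
    if \<epsilon>: "0 < \<epsilon>" for \<epsilon>
  proof -
    have "\<forall>\<^sub>F t in at_right 0. first_profit k t < ennreal (c + \<epsilon>)"
      by (rule order_tendstoD(2)[OF lim]) (use c \<epsilon> in \<open>simp add: ennreal_less_iff\<close>)
    \<comment> \<open>For \<epsilon> \<ge> c the lower bound is trivial, because
      \<open>ennreal\<close> sends nonpositive numbers to 0.\<close>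
    moreover have "\<forall>\<^sub>F t in at_right 0. ennreal (c - \<epsilon>) \<le> first_profit k t"
    proof (cases "c - \<epsilon> \<le> 0")
      case True
      then show ?thesis by (simp add: ennreal_neg)
    next
      case False
      then have "ennreal (c - \<epsilon>) < ennreal c" using \<epsilon> by (simp add: ennreal_less_iff)
      from order_tendstoD(1)[OF lim this] show ?thesis by eventually_elim simp
    qed
    ultimately have "\<forall>\<^sub>F t in at_right 0. ennreal (c - \<epsilon>) \<le> first_profit k t \<and> first_profit k t \<le> ennreal (c + \<epsilon>)"
      by eventually_elim (auto intro: less_imp_le)
    then obtain \<delta> where \<delta>: "0 < \<delta>"
      "\<And>t. 0 < t \<Longrightarrow> t < \<delta> \<Longrightarrow> ennreal (c - \<epsilon>) \<le> first_profit k t \<and> first_profit k t \<le> ennreal (c + \<epsilon>)"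
      unfolding eventually_at_right_field by blast
    have "\<forall>\<^sub>F T in at_right 0. 0 < T \<and> T < min \<delta> 1"
      unfolding eventually_at_right_field using \<delta>(1) by (intro exI[of _ "min \<delta> 1"]) auto
    then show ?thesis
    proof eventually_elim
      case (elim T)
      then have T: "0 < T" "T < \<delta>" "T \<le> 1" by auto
      have first: "ennreal (c - \<epsilon>) \<le> first_profit k (\<tau> 1 w) \<and> first_profit k (\<tau> 1 w) \<le> ennreal (c + \<epsilon>)"
        if "w \<in> space M" "1 \<le> N T w" for w
        using arrival_pos[OF that(1), of 1] arrival_le_iff[OF that(1), of 1 T] that(2) T by (intro \<delta>(2)) auto
      have e0: "expected_profit k T 0 = (\<integral>\<^sup>+w. (if 1 \<le> N T w then first_profit k (\<tau> 1 w) else 0) \<partial>M)"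
        by (rule expected_profit_0) (use T in auto)
      have "expected_profit k T 0 \<le> (\<integral>\<^sup>+w. (if 1 \<le> N T w then ennreal (c + \<epsilon>) else 0) \<partial>M)"
        unfolding e0 using first by (intro nn_integral_mono) auto
      then have up0: "expected_profit k T 0 \<le> ennreal ((c + \<epsilon>) * q T)"
        unfolding nn_integral_arrival[OF T(1)] using q[OF T(1)] c \<epsilon> by (simp add: q_def ennreal_mult)
      have "(\<integral>\<^sup>+w. (if 1 \<le> N T w then ennreal (c - \<epsilon>) else 0) \<partial>M) \<le> expected_profit k T 0"
        unfolding e0 using first by (intro nn_integral_mono) auto
      then have lo0: "ennreal ((c - \<epsilon>) * q T) \<le> expected_profit k T 0"
        unfolding nn_integral_arrival[OF T(1)] using q[OF T(1)] by (simp add: q_def ennreal_mult'')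
      have "X T \<le> ennreal ((c + \<epsilon>) * q T) + ennreal (A * (lam * T)\<^sup>2)"
        unfolding split by (intro add_mono up0 rest T)
      also have "\<dots> = ennreal ((c + \<epsilon>) * q T + A * (lam * T)\<^sup>2)"
        using A c \<epsilon> q[OF T(1)] by (intro ennreal_plus[symmetric]) auto
      finally have up: "X T \<le> ennreal ((c + \<epsilon>) * q T + A * (lam * T)\<^sup>2)" .
      then have fin: "X T < \<infinity>" using ennreal_less_top le_less_trans by (metis infinity_ennreal_def)
      have "ennreal ((c - \<epsilon>) * q T) \<le> X T" unfolding split using lo0 by (rule add_increasing2[OF zero_le])
      then have lo': "ennreal ((c - \<epsilon>) * q T) \<le> ennreal (enn2real (X T))" using fin by (simp add: less_top)
      have lo: "(c - \<epsilon>) * q T \<le> enn2real (X T)"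
        by (rule ennreal_le_iff[THEN iffD1, OF enn2real_nonneg lo'])
      have "enn2real (X T) \<le> (c + \<epsilon>) * q T + A * (lam * T)\<^sup>2"
        by (rule enn2real_leI[OF _ up]) (use A c \<epsilon> q[OF T(1)] in auto)
      moreover have "0 \<le> A * (lam * T)\<^sup>2" using A by simp
      ultimately show ?case using lo fin by (simp add: algebra_simps abs_le_iff)
    qed
  qed
  have "((\<lambda>T. (enn2real (X T) - c * q T) / T) \<longlongrightarrow> 0) (at_right 0)"
  proof (rule tendstoI)
    fix e :: real assume e: "0 < e"
    \<comment> \<open>As \<open>q T\<close> \<le> lam T, this choice uses half of e for the first
      arrival and leaves half for the quadratic remainder.\<close>
    define \<epsilon> where "\<epsilon> = e / (2 * lam)"
    have \<epsilon>: "0 < \<epsilon>" using e lam by (simp add: \<epsilon>_def)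
    have "((\<lambda>T. A * lam\<^sup>2 * T) \<longlongrightarrow> 0) (at_right 0)" by (auto intro!: tendsto_eq_intros)
    then have "\<forall>\<^sub>F T in at_right 0. A * lam\<^sup>2 * T < e / 2" by (rule order_tendstoD) (use e in simp)
    with bounds[OF \<epsilon>] eventually_at_right_less[of "0::real"]
    show "\<forall>\<^sub>F T in at_right 0. dist ((enn2real (X T) - c * q T) / T) 0 < e"
    proof eventually_elim
      case (elim T)
      then have T: "0 < T" by simp
      have "\<bar>enn2real (X T) - c * q T\<bar> \<le> \<epsilon> * (lam * T) + A * (lam * T)\<^sup>2"
        using elim q[OF T] \<epsilon> mult_left_mono[of "q T" "lam * T" \<epsilon>] by linarith
      also have "\<dots> = (e / 2 + A * lam\<^sup>2 * T) * T" using lam by (simp add: \<epsilon>_def power2_eq_square algebra_simps)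
      also have "\<dots> < e * T" using elim T by (intro mult_strict_right_mono) auto
      finally show ?case using T by (simp add: abs_divide field_simps)
    qed
  qed
  moreover have "((\<lambda>T. c * (q T / T)) \<longlongrightarrow> c * lam) (at_right 0)"
    unfolding q_def by (intro tendsto_intros) (use lam in real_asymp)
  ultimately have "((\<lambda>T. (enn2real (X T) - c * q T) / T + c * (q T / T)) \<longlongrightarrow> 0 + c * lam) (at_right 0)"
    by (rule tendsto_add)
  then have "((\<lambda>T. enn2real (X T) / T) \<longlongrightarrow> lam * c) (at_right 0)"
    by (simp add: diff_divide_distrib mult.commute)
  then have real_lim: "((\<lambda>T. ereal (enn2real (X T) / T)) \<longlongrightarrow> ereal (lam * c)) (at_right 0)"
    by (simp add: lim_ereal)
  have "((\<lambda>T. enn2ereal (X T) / ereal T) \<longlongrightarrow> ereal (lam * c)) (at_right 0)"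
  proof (rule Lim_transform_eventually[OF real_lim])
    show "\<forall>\<^sub>F T in at_right 0. ereal (enn2real (X T) / T) = enn2ereal (X T) / ereal T"
      using bounds[OF zero_less_one] eventually_at_right_less[of "0::real"]
    proof eventually_elim
      case (elim T)
      then have "enn2ereal (X T) = ereal (enn2real (X T))"
        by (cases "X T" rule: ennreal_cases) (auto simp: enn2ereal_ennreal)
      then show ?case using elim by simp
    qed
  qed
  moreover have "\<forall>T>0. has_expectation M (cumulative (\<lambda>q y. sqrt q * k y) N \<tau> P z T) (enn2ereal (X T))"
    unfolding X_def using k by (auto intro!: has_expectation_cumulative)
  ultimately show ?thesis
    unfolding has_intensity_def c_def by (intro exI[of _ "\<lambda>T. enn2ereal (X T)"]) simp
qed

text \<open>The hypothesis covers all shifts v because the profile is evaluated at \<open>z0\<close>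
  plus an arbitrary Brownian displacement. Every frozen first profit is then infinite, and an
  arrival has positive probability for each T > 0.\<close>

lemma has_intensity_infinite:
  assumes [measurable]: "k \<in> borel_measurable borel" and k: "\<And>y. 0 \<le> k y"
    and inf: "\<And>v. (\<integral>\<^sup>+y. ennreal (dens y * k (y + v)) \<partial>lborel) = \<infinity>"
  shows "has_intensity M (cumulative (\<lambda>q y. sqrt q * k y) N \<tau> P z) \<infinity>"
proof -
  have first: "first_profit k t = \<infinity>" if "0 < t" for t
  proof -
    have "(\<integral>\<^sup>+y. ennreal (dens y * (sqrt p * exp u * k (y + v))) \<partial>lborel) = \<infinity>" for u v
    proof -
      have "(\<integral>\<^sup>+y. ennreal (dens y * (sqrt p * exp u * k (y + v))) \<partial>lborel) =
        (\<integral>\<^sup>+y. ennreal (sqrt p * exp u) * ennreal (dens y * k (y + v)) \<partial>lborel)"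
        using p by (intro nn_integral_cong) (simp add: ennreal_mult'[symmetric] mult_ac)
      also have "\<dots> = ennreal (sqrt p * exp u) * \<infinity>" by (subst nn_integral_cmult) (auto simp: inf)
      also have "\<dots> = \<infinity>" using p by (simp add: ennreal_mult_top)
      finally show ?thesis .
    qed
    then have "first_profit k t = (\<integral>\<^sup>+x. ennreal (std_normal_density x) * \<infinity> \<partial>lborel)"
      using first_profit_eq[OF assms(1) k that] by simp
    also have "\<dots> = (\<integral>\<^sup>+x. ennreal (std_normal_density x) \<partial>lborel) * \<infinity>" by (rule nn_integral_multc) measurable
    also have "\<dots> = \<infinity>" by (simp add: nn_integral_eq_integral)
    finally show ?thesis .
  qed
  have X: "(\<Sum>i. expected_profit k T i) = \<infinity>" if T: "0 < T" for T
  proof -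
    have "expected_profit k T 0 = (\<integral>\<^sup>+w. (if 1 \<le> N T w then first_profit k (\<tau> 1 w) else 0) \<partial>M)"
      by (rule expected_profit_0) (use T in auto)
    also have "\<dots> = (\<integral>\<^sup>+w. (if 1 \<le> N T w then \<infinity> else 0) \<partial>M)"
      by (intro nn_integral_cong) (auto simp: first arrival_pos)
    also have "\<dots> = \<infinity>" unfolding nn_integral_arrival[OF T] using T lam by (simp add: ennreal_top_mult)
    finally have "expected_profit k T 0 = \<infinity>" .
    moreover have "expected_profit k T 0 \<le> (\<Sum>i. expected_profit k T i)"
      using sum_le_suminf[of "expected_profit k T" "{0}"] by simp
    ultimately show ?thesis by (simp add: top_unique)
  qed
  have "\<forall>\<^sub>F T in at_right 0. \<infinity> = enn2ereal (\<Sum>i. expected_profit k T i) / ereal T"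
    using eventually_at_right_less[of "0::real"] by eventually_elim (simp add: X)
  then have "((\<lambda>T. enn2ereal (\<Sum>i. expected_profit k T i) / ereal T) \<longlongrightarrow> \<infinity>) (at_right 0)"
    by (rule Lim_transform_eventually[OF tendsto_const])
  moreover have "\<forall>T>0. has_expectation M (cumulative (\<lambda>q y. sqrt q * k y) N \<tau> P z T) (enn2ereal (\<Sum>i. expected_profit k T i))"
    using k by (auto intro!: has_expectation_cumulative)
  ultimately show ?thesis
    unfolding has_intensity_def by (intro exI[of _ "\<lambda>T. enn2ereal (\<Sum>i. expected_profit k T i)"]) simp
qed

end

section \<open>The constant product pool\<close>

text \<open>The inequality of arithmetic and geometric means in the form (q x + y)^2 = (q x - y)^2 +
  4 q x y. Equality forces q x = y, which determines the point.\<close>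

lemma cpmm_curve:
  assumes q: "0 < q" and L: "0 < L" and on: "on_curve cpmm L v"
  shows "2 * L * sqrt q \<le> q * fst v + snd v"
    and "q * fst v + snd v = 2 * L * sqrt q \<Longrightarrow> v = (L / sqrt q, L * sqrt q)"
proof -
  obtain x y where v: "v = (x, y)" by (cases v)
  have xy: "0 \<le> x" "0 \<le> y" "sqrt (x * y) = L" using on by (auto simp: on_curve_def cpmm_def v)
  have L2: "x * y = L\<^sup>2" using xy by (metis mult_nonneg_nonneg real_sqrt_pow2)
  have sq: "(sqrt q)\<^sup>2 = q" using q by simp
  have id: "(q * x + y)\<^sup>2 = (q * x - y)\<^sup>2 + (2 * L * sqrt q)\<^sup>2"
    unfolding power_mult_distrib sq L2[symmetric] by (simp add: power2_eq_square algebra_simps)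
  then have "(2 * L * sqrt q)\<^sup>2 \<le> (q * x + y)\<^sup>2" by simp
  then show "2 * L * sqrt q \<le> q * fst v + snd v"
    using power2_le_imp_le[of "2 * L * sqrt q" "q * x + y"] xy q by (simp add: v)
  assume "q * fst v + snd v = 2 * L * sqrt q"
  then have eq: "q * x + y = 2 * L * sqrt q" by (simp add: v)
  with id have "q * x = y" by simp
  with eq have y: "y = L * sqrt q" by simp
  have "x = y / q" using \<open>q * x = y\<close> q by (simp add: field_simps)
  also have "\<dots> = L / sqrt q" unfolding y using q by (simp add: divide_simps)
  finally show "v = (L / sqrt q, L * sqrt q)" by (simp add: v y)
qed

lemma cpmm_optimum_on_curve:
  assumes "0 < q" "0 < L"
  shows "on_curve cpmm L (L / sqrt q, L * sqrt q)"
    and "q * (L / sqrt q) + L * sqrt q = 2 * L * sqrt q"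
  using assms by (auto simp: on_curve_def cpmm_def field_simps power2_eq_square[symmetric])

text \<open>\<open>arg_min\<close> is a choice among minimisers, so its value is known only through
  uniqueness: the attained minimum is identified first, then the equality case of
  \<open>cpmm_curve\<close> gives the point.\<close>

lemma cpmm_arg_min:
  assumes q: "0 < q" and L: "0 < L"
  shows "arg_min (\<lambda>v. q * fst v + snd v) (on_curve cpmm L) = (L / sqrt q, L * sqrt q)"
proof -
  let ?f = "\<lambda>v :: real \<times> real. q * fst v + snd v" and ?v = "(L / sqrt q, L * sqrt q)"
  have "?f (arg_min ?f (on_curve cpmm L)) = ?f ?v \<and> on_curve cpmm L (arg_min ?f (on_curve cpmm L))"
    unfolding arg_min_def
  proof (rule someI2[of _ ?v])
    show "is_arg_min ?f (on_curve cpmm L) ?v"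
      using cpmm_optimum_on_curve[OF assms] cpmm_curve(1)[OF assms] by (fastforce simp: is_arg_min_def not_less)
    show "?f v = ?f ?v \<and> on_curve cpmm L v" if "is_arg_min ?f (on_curve cpmm L) v" for v
    proof -
      have v: "on_curve cpmm L v" "\<not> ?f ?v < ?f v"
        using that cpmm_optimum_on_curve(1)[OF assms] unfolding is_arg_min_def by blast+
      then show ?thesis
        using cpmm_optimum_on_curve(2)[OF assms] cpmm_curve(1)[OF assms v(1)] by simp
    qed
  qed
  then show ?thesis
    using cpmm_curve(2)[OF assms] cpmm_optimum_on_curve(2)[OF assms] by simp
qed

lemma x_opt_cpmm: "0 < q \<Longrightarrow> 0 < L \<Longrightarrow> x_opt cpmm L q = L / sqrt q"
  and y_opt_cpmm: "0 < q \<Longrightarrow> 0 < L \<Longrightarrow> y_opt cpmm L q = L * sqrt q"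
  by (simp_all add: x_opt_def y_opt_def cpmm_arg_min)

lemma pool_value_cpmm:
  assumes "0 < q" "0 < L"
  shows "pool_value cpmm L q = 2 * L * sqrt q"
  unfolding pool_value_def
proof (rule Least_equality)
  show "\<exists>v. on_curve cpmm L v \<and> 2 * L * sqrt q = q * fst v + snd v"
    using cpmm_optimum_on_curve[OF assms] by (intro exI[of _ "(L / sqrt q, L * sqrt q)"]) simp
qed (use cpmm_curve(1)[OF assms] in auto)

text \<open>Distance of the mispricing from the no-trade band [-\<gamma>, \<gamma>].\<close>

definition excess :: "real \<Rightarrow> real \<Rightarrow> real" where
  "excess \<gamma> y = max (\<bar>y\<bar> - \<gamma>) 0"

text \<open>The last factor is 4 sinh(u / 4)^2: quadratic near 0 and of order exp (u / 2) at
  infinity.\<close>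

definition arb_profile :: "real \<Rightarrow> real \<Rightarrow> real \<Rightarrow> real" where
  "arb_profile L \<gamma> u = L * exp (\<gamma> / 2) * (exp (u / 2) + exp (- u / 2) - 2)"

definition fee_profile :: "real \<Rightarrow> real \<Rightarrow> real \<Rightarrow> real" where
  "fee_profile L \<gamma> u = L * (exp (\<gamma> / 2) - exp (- \<gamma> / 2)) * (1 - exp (- u / 2))"

text \<open>Exchanging the roles of the two assets maps one side of the band to the other, and the
  fee convention respects this; hence profits and fees depend on y only through the distance from
  the band.\<close>

lemma cpmm_profiles:
  assumes q: "0 < q" and L: "0 < L" and \<gamma>: "0 < \<gamma>"
  shows "arb cpmm L \<gamma> q y = sqrt q * arb_profile L \<gamma> (excess \<gamma> y)"
    and "fee cpmm L \<gamma> q y = sqrt q * fee_profile L \<gamma> (excess \<gamma> y)"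
proof -
  \<comment> \<open>In the variables g, t and s, the half-exponentials and the square root of the
    price, all holdings are rational and the claims become field identities.\<close>
  define g where "g = exp (\<gamma> / 2)"
  define t where "t = exp (y / 2)"
  have g: "0 < g" "exp \<gamma> = g\<^sup>2" "exp (- \<gamma> / 2) = 1 / g" 
    by (simp_all add: g_def exp_double[symmetric] exp_minus inverse_eq_divide)
  have t: "0 < t" "exp (- y / 2) = 1 / t" by (simp_all add: t_def exp_minus inverse_eq_divide)
  define s where "s = sqrt q"
  have s: "0 < s" "q = s\<^sup>2" using q by (simp_all add: s_def)
  have x: "x_opt cpmm L (q * exp a) = L / (s * exp (a / 2))"
    and y: "y_opt cpmm L (q * exp a) = L * (s * exp (a / 2))" for a
    using q L by (simp_all add: x_opt_cpmm y_opt_cpmm real_sqrt_mult sqrt_exp s_def)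
  have opt: "x_opt cpmm L (q * exp (- y)) = L * t / s" "y_opt cpmm L (q * exp (- y)) = L * s / t"
    "x_opt cpmm L (q * exp (- \<gamma>)) = L * g / s" "y_opt cpmm L (q * exp (- \<gamma>)) = L * s / g"
    "x_opt cpmm L (q * exp \<gamma>) = L / (s * g)" "y_opt cpmm L (q * exp \<gamma>) = L * s * g"
    unfolding x y g(3) t(2) using g s t by (simp_all add: g_def[symmetric])
  consider (pos) "\<gamma> < y" | (neg) "y < - \<gamma>" | (mid) "\<bar>y\<bar> \<le> \<gamma>" by linarith
  then have "arb cpmm L \<gamma> q y = s * arb_profile L \<gamma> (excess \<gamma> y) \<and> fee cpmm L \<gamma> q y = s * fee_profile L \<gamma> (excess \<gamma> y)"
  proof cases
    case pos
    then have e: "excess \<gamma> y = y - \<gamma>" using \<gamma> by (simp add: excess_def)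
    have 1: "exp ((y - \<gamma>) / 2) = t / g" "exp (- (y - \<gamma>) / 2) = g / t"
      by (simp_all add: t_def g_def diff_divide_distrib exp_diff)
    show ?thesis
      using pos \<gamma> unfolding e arb_profile_def fee_profile_def arb_def fee_def arb_plus_def arb_minus_def fee_plus_def fee_minus_def opt
      unfolding 1 g(2,3) g_def[symmetric]
      using g(1) s t(1) by (simp add: field_simps power2_eq_square)
  next
    case neg
    then have e: "excess \<gamma> y = - y - \<gamma>" using \<gamma> by (simp add: excess_def)
    have 1: "exp ((- y - \<gamma>) / 2) = 1 / (t * g)" "exp (- (- y - \<gamma>) / 2) = t * g"
    proof -
      have tg: "t * g = exp ((y + \<gamma>) / 2)" by (simp add: t_def g_def exp_add[symmetric] add_divide_distrib)
      have eqs: "(- y - \<gamma>) / 2 = - ((y + \<gamma>) / 2)" "- (- y - \<gamma>) / 2 = (y + \<gamma>) / 2"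
        by (simp_all add: diff_divide_distrib add_divide_distrib)
      show "exp ((- y - \<gamma>) / 2) = 1 / (t * g)" unfolding tg eqs exp_minus by (simp add: inverse_eq_divide)
      show "exp (- (- y - \<gamma>) / 2) = t * g" unfolding tg eqs ..
    qed
    show ?thesis
      using neg \<gamma> unfolding e arb_profile_def fee_profile_def arb_def fee_def arb_plus_def arb_minus_def fee_plus_def fee_minus_def opt
      unfolding 1 g(2,3) g_def[symmetric]
      using g(1) s t(1) by (simp add: field_simps power2_eq_square)
  next
    case mid
    then have e: "excess \<gamma> y = 0" by (simp add: excess_def)
    show ?thesis
      using mid by (simp add: e arb_profile_def fee_profile_def arb_def fee_def arb_plus_def arb_minus_def fee_plus_def fee_minus_def)
  qed
  then show "arb cpmm L \<gamma> q y = sqrt q * arb_profile L \<gamma> (excess \<gamma> y)"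
    and "fee cpmm L \<gamma> q y = sqrt q * fee_profile L \<gamma> (excess \<gamma> y)"
    by (simp_all add: s_def)
qed

lemma arb_profile_nonneg:
  assumes "0 \<le> L"
  shows "0 \<le> arb_profile L \<gamma> u"
proof -
  have "exp (u / 2) + exp (- u / 2) - 2 = (exp (u / 4) - exp (- u / 4))\<^sup>2"
    by (simp add: power2_diff exp_double[symmetric] mult_exp_exp)
  then show ?thesis using assms by (simp add: arb_profile_def)
qed

lemma arb_profile_le:
  assumes "0 \<le> L" "0 \<le> u"
  shows "arb_profile L \<gamma> u \<le> L * exp (\<gamma> / 2) * exp (u / 2)"
proof -
  have "exp (- u / 2) \<le> 1" using assms by simp
  then have "exp (u / 2) + exp (- u / 2) - 2 \<le> exp (u / 2)" by linarith
  then show ?thesis unfolding arb_profile_def using assms by (intro mult_left_mono) auto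
qed

lemma fee_profile_bounds:
  assumes "0 \<le> L" "0 \<le> \<gamma>" "0 \<le> u"
  shows "0 \<le> fee_profile L \<gamma> u" "fee_profile L \<gamma> u \<le> L * (exp (\<gamma> / 2) - exp (- \<gamma> / 2))"
proof -
  have c: "0 \<le> L * (exp (\<gamma> / 2) - exp (- \<gamma> / 2))" using assms by simp
  show "0 \<le> fee_profile L \<gamma> u" unfolding fee_profile_def using assms by (intro mult_nonneg_nonneg[OF c]) simp
  show "fee_profile L \<gamma> u \<le> L * (exp (\<gamma> / 2) - exp (- \<gamma> / 2))"
    unfolding fee_profile_def using mult_left_le[OF _ c, of "1 - exp (- u / 2)"] by simp
qed

lemma emeasure_lborel_atLeast: "emeasure lborel {a :: real..} = \<infinity>"
proof (rule ccontr)
  assume "emeasure lborel {a..} \<noteq> \<infinity>"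
  then obtain n :: nat where n: "emeasure lborel {a..} < of_nat n"
    using ennreal_Ex_less_of_nat by (auto simp: less_top)
  have "of_nat n = emeasure lborel {a..a + real n}"
    by (simp add: ennreal_of_nat_eq_real_of_nat)
  also have "\<dots> \<le> emeasure lborel {a..}" by (intro emeasure_mono) auto
  finally show False using n by simp
qed

lemma has_bochner_integral_exp_decay:
  fixes s :: real
  assumes "0 < s"
  shows "has_bochner_integral lborel (\<lambda>x. exp (- s * x) * indicator {0<..} x) (1 / s)"
proof (rule has_bochner_integral_nn_integral)
  show "(\<integral>\<^sup>+x. ennreal (exp (- s * x) * indicator {0<..} x) \<partial>lborel) = ennreal (1 / s)"
    using nn_integral_exp_decay[OF assms] by (simp add: ennreal_mult' ennreal_indicator)
qed (use assms in auto)

lemma has_intensity_cong: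
  assumes "\<And>T w. 0 < T \<Longrightarrow> w \<in> space M \<Longrightarrow> X T w = Y T w"
  shows "has_intensity M X v \<longleftrightarrow> has_intensity M Y v"
proof -
  have "has_expectation M (X T) e \<longleftrightarrow> has_expectation M (Y T) e" if "0 < T" for T e
  proof -
    have "X T \<in> borel_measurable M \<longleftrightarrow> Y T \<in> borel_measurable M"
      using assms[OF that] by (intro measurable_cong) auto
    moreover have "(\<integral>\<^sup>+w. ennreal (X T w) \<partial>M) = (\<integral>\<^sup>+w. ennreal (Y T w) \<partial>M)"
      "(\<integral>\<^sup>+w. ennreal (- X T w) \<partial>M) = (\<integral>\<^sup>+w. ennreal (- Y T w) \<partial>M)"
      using assms[OF that] by (auto intro!: nn_integral_cong)
    ultimately show ?thesis by (simp add: has_expectation_def)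
  qed
  then show ?thesis by (simp add: has_intensity_def)
qed

section \<open>Intensities for the constant product pool\<close>

context arbitrage_model begin

lemma dens_mass_nonneg: "0 \<le> rate / (1 + rate * \<gamma>)"
  by (intro divide_nonneg_pos add_pos_pos mult_pos_pos rate_pos \<gamma>) (use lam \<sigma> in simp_all)

text \<open>Since \<open>K 0 = 0\<close> the band contributes nothing; evenness doubles the upper
  tail and a shift by \<open>\<gamma>\<close> leaves an exponential integral. The prefactor is
  \<open>rate\<close> times the trade probability 1 / (1 + rate \<gamma>).\<close>

lemma nn_integral_dens_excess:
  assumes [measurable]: "K \<in> borel_measurable borel" and K0: "K 0 = 0" and K: "\<And>x. 0 \<le> x \<Longrightarrow> 0 \<le> K x"
    and I: "has_bochner_integral lborel (\<lambda>x. exp (- rate * x) * K x * indicator {0<..} x) I"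
  shows "(\<integral>\<^sup>+y. ennreal (dens y * K (excess \<gamma> y)) \<partial>lborel) = ennreal (rate / (1 + rate * \<gamma>) * I)"
proof -
  define c where "c = rate / (2 * (1 + rate * \<gamma>))"
  have c: "0 < c" unfolding c_def by (rule dens_const_pos)
  have c2: "2 * c = rate / (1 + rate * \<gamma>)" 
  proof -
    have "2 * (a / (2 * b)) = a / b" for a b :: real by simp
    then show ?thesis unfolding c_def .
  qed
  have deq: "dens y = c * exp (- rate * excess \<gamma> y)" for y by (simp add: dens_eq c_def excess_def)
  have [measurable]: "excess \<gamma> \<in> borel_measurable borel" unfolding excess_def[abs_def] by measurable
  have I0: "0 \<le> I"
    unfolding has_bochner_integral_integral_eq[OF I, symmetric]
    by (rule Bochner_Integration.integral_nonneg) (auto split: split_indicator intro!: mult_nonneg_nonneg K)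
  have "(\<integral>\<^sup>+y. ennreal (dens y * K (excess \<gamma> y)) \<partial>lborel) =
     2 * (\<integral>\<^sup>+y. ennreal (dens y * K (excess \<gamma> y)) * indicator {0<..} y \<partial>lborel)"
    by (rule nn_integral_even) (auto simp: deq excess_def)
  also have "(\<integral>\<^sup>+y. ennreal (dens y * K (excess \<gamma> y)) * indicator {0<..} y \<partial>lborel) =
     (\<integral>\<^sup>+y. ennreal (c * (exp (- rate * (y - \<gamma>)) * K (y - \<gamma>) * indicator {0<..} (y - \<gamma>))) \<partial>lborel)"
    using \<gamma> by (intro nn_integral_cong) (auto simp: deq excess_def K0 mult.assoc split: split_indicator)
  also have "\<dots> = (\<integral>\<^sup>+x. ennreal (c * (exp (- rate * x) * K x * indicator {0<..} x)) \<partial>lborel)"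
    by (subst nn_integral_real_affine[where c=1 and t=\<gamma>]) auto
  also have "\<dots> = ennreal (c * I)"
  proof -
    have h: "has_bochner_integral lborel (\<lambda>x. c * (exp (- rate * x) * K x * indicator {0<..} x)) (c * I)"
      by (rule has_bochner_integral_mult_right) (rule I)
    have "(\<integral>\<^sup>+x. ennreal (c * (exp (- rate * x) * K x * indicator {0<..} x)) \<partial>lborel) =
       ennreal (\<integral>x. c * (exp (- rate * x) * K x * indicator {0<..} x) \<partial>lborel)"
    proof (rule nn_integral_eq_integral)
      show "AE x in lborel. 0 \<le> c * (exp (- rate * x) * K x * indicator {0<..} x)"
        using c by (intro AE_I2) (auto split: split_indicator intro!: mult_nonneg_nonneg K)
    qed (rule integrable.intros[OF h])
    then show ?thesis unfolding has_bochner_integral_integral_eq[OF h] .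
  qed
  also have "2 * ennreal (c * I) = ennreal (2 * c * I)"
    using c I0 by (simp add: ennreal_mult' mult.assoc flip: ennreal_numeral)
  finally show ?thesis unfolding c2 .
qed

lemma cumulative_cpmm:
  assumes L: "0 < L" and w: "w \<in> space M"
  shows "cumulative (arb cpmm L \<gamma>) N \<tau> P z T w = cumulative (\<lambda>q y. sqrt q * arb_profile L \<gamma> (excess \<gamma> y)) N \<tau> P z T w"
    and "cumulative (fee cpmm L \<gamma>) N \<tau> P z T w = cumulative (\<lambda>q y. sqrt q * fee_profile L \<gamma> (excess \<gamma> y)) N \<tau> P z T w"
  unfolding cumulative_def
  using P_pos[OF w] arrival_nonneg[OF w] by (auto intro!: sum.cong simp: cpmm_profiles[OF _ L \<gamma>])

lemma excess_nonneg: "0 \<le> excess \<gamma> y"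
  by (simp add: excess_def)

lemma excess_le: "excess \<gamma> y \<le> \<bar>y\<bar>"
  using \<gamma> by (simp add: excess_def)

lemma excess_continuous: "continuous_on UNIV (excess \<gamma>)"
  unfolding excess_def[abs_def] by (intro continuous_intros)

text \<open>The fee profile is bounded, so growth exponent 0 is admissible and no condition relating
  \<open>lam\<close> and \<open>\<sigma>\<close> arises. The two reciprocals integrate the two terms
  of 1 - exp (- u / 2) against the exponential tail.\<close>

lemma fee_intensity:
  assumes L: "0 < L"
  shows "has_intensity M (cumulative (fee cpmm L \<gamma>) N \<tau> P z)
    (ereal (lam * (sqrt p * (rate / (1 + rate * \<gamma>) * (L * (exp (\<gamma> / 2) - exp (- \<gamma> / 2)) * (1 / rate - 1 / (rate + 1 / 2)))))))"
proof (subst has_intensity_cong[OF cumulative_cpmm(2)[OF L]], assumption, rule has_intensity_finite[where a = 0])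
  define A where "A = L * (exp (\<gamma> / 2) - exp (- \<gamma> / 2))"
  have A: "0 \<le> A" using L \<gamma> by (simp add: A_def)
  show "continuous_on UNIV (\<lambda>y. fee_profile L \<gamma> (excess \<gamma> y))"
    unfolding fee_profile_def by (intro continuous_intros excess_continuous) simp
  show "0 \<le> fee_profile L \<gamma> (excess \<gamma> y)" for y
    using L \<gamma> excess_nonneg by (intro fee_profile_bounds) auto
  show "fee_profile L \<gamma> (excess \<gamma> y) \<le> A * exp (0 * \<bar>y\<bar>)" for y
    using fee_profile_bounds(2)[of L \<gamma> "excess \<gamma> y"] L \<gamma> excess_nonneg by (simp add: A_def)
  show "(\<integral>\<^sup>+y. ennreal (dens y * fee_profile L \<gamma> (excess \<gamma> y)) \<partial>lborel) =
      ennreal (rate / (1 + rate * \<gamma>) * (L * (exp (\<gamma> / 2) - exp (- \<gamma> / 2)) * (1 / rate - 1 / (rate + 1 / 2))))"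
  proof (rule nn_integral_dens_excess)
    show "fee_profile L \<gamma> \<in> borel_measurable borel" unfolding fee_profile_def[abs_def] by measurable
    show "fee_profile L \<gamma> 0 = 0" by (simp add: fee_profile_def)
    show "0 \<le> fee_profile L \<gamma> x" if "0 \<le> x" for x using fee_profile_bounds(1) L \<gamma> that by auto
    have "has_bochner_integral lborel (\<lambda>x. A * (exp (- rate * x) * indicator {0<..} x - exp (- (rate + 1 / 2) * x) * indicator {0<..} x))
       (A * (1 / rate - 1 / (rate + 1 / 2)))"
      by (intro has_bochner_integral_mult_right has_bochner_integral_diff has_bochner_integral_exp_decay rate_pos add_pos_pos) simp_all
    moreover have "A * (exp (- rate * x) * i - exp (- (rate + 1 / 2) * x) * i) = exp (- rate * x) * fee_profile L \<gamma> x * i" for x i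
    proof -
      have "exp (- (rate + 1 / 2) * x) = exp (- rate * x) * exp (- x / 2)"
        by (simp add: exp_add[symmetric] algebra_simps)
      then show ?thesis unfolding fee_profile_def A_def[symmetric] by (simp add: algebra_simps)
    qed
    ultimately show "has_bochner_integral lborel (\<lambda>x. exp (- rate * x) * fee_profile L \<gamma> x * indicator {0<..} x)
       (L * (exp (\<gamma> / 2) - exp (- \<gamma> / 2)) * (1 / rate - 1 / (rate + 1 / 2)))"
      unfolding A_def by simp
  qed
  have "1 / (rate + 1 / 2) \<le> 1 / rate" using rate_pos by (intro divide_left_mono mult_pos_pos add_pos_pos) auto
  then have "0 \<le> A * (1 / rate - 1 / (rate + 1 / 2))" using A by simp
  moreover note dens_mass_nonneg
  ultimately show "0 \<le> rate / (1 + rate * \<gamma>) * (L * (exp (\<gamma> / 2) - exp (- \<gamma> / 2)) * (1 / rate - 1 / (rate + 1 / 2)))"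
    unfolding A_def by (rule mult_nonneg_nonneg[rotated])
qed (use rate_pos in auto)

text \<open>The growth exponent 1/2 of the profile has to stay below the tail exponent. The three
  reciprocals integrate exp (u / 2), exp (- u / 2) and the constant against the exponential
  tail.\<close>

lemma arb_intensity_finite:
  assumes L: "0 < L" and r: "1 / 2 < rate"
  shows "has_intensity M (cumulative (arb cpmm L \<gamma>) N \<tau> P z)
    (ereal (lam * (sqrt p * (rate / (1 + rate * \<gamma>) * (L * exp (\<gamma> / 2) * (1 / (rate - 1 / 2) + 1 / (rate + 1 / 2) - 2 * (1 / rate)))))))"
proof (subst has_intensity_cong[OF cumulative_cpmm(1)[OF L]], assumption, rule has_intensity_finite[where a = "1 / 2"])
  define A where "A = L * exp (\<gamma> / 2)"
  have A: "0 \<le> A" using L by (simp add: A_def)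
  show "continuous_on UNIV (\<lambda>y. arb_profile L \<gamma> (excess \<gamma> y))"
    unfolding arb_profile_def by (intro continuous_intros excess_continuous) simp_all
  show "0 \<le> arb_profile L \<gamma> (excess \<gamma> y)" for y
    using L by (intro arb_profile_nonneg) auto
  show "arb_profile L \<gamma> (excess \<gamma> y) \<le> A * exp (1 / 2 * \<bar>y\<bar>)" for y
  proof -
    have "arb_profile L \<gamma> (excess \<gamma> y) \<le> A * exp (excess \<gamma> y / 2)"
      unfolding A_def using L excess_nonneg by (intro arb_profile_le) auto
    also have "\<dots> \<le> A * exp (1 / 2 * \<bar>y\<bar>)" using A excess_le[of y] by (intro mult_left_mono) auto
    finally show ?thesis .
  qed
  define I where "I = A * (1 / (rate - 1 / 2) + 1 / (rate + 1 / 2) - 2 * (1 / rate))"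
  have I: "has_bochner_integral lborel (\<lambda>x. exp (- rate * x) * arb_profile L \<gamma> x * indicator {0<..} x) I"
  proof -
    have "has_bochner_integral lborel (\<lambda>x. A * (exp (- (rate - 1 / 2) * x) * indicator {0<..} x
         + exp (- (rate + 1 / 2) * x) * indicator {0<..} x - 2 * (exp (- rate * x) * indicator {0<..} x))) I"
      unfolding I_def
      by (intro has_bochner_integral_mult_right has_bochner_integral_diff has_bochner_integral_add
          has_bochner_integral_exp_decay rate_pos add_pos_pos) (use r in simp_all)
    moreover have "A * (exp (- (rate - 1 / 2) * x) * i + exp (- (rate + 1 / 2) * x) * i - 2 * (exp (- rate * x) * i)) =
       exp (- rate * x) * arb_profile L \<gamma> x * i" for x i
    proof -
      have "exp (- (rate - 1 / 2) * x) = exp (- rate * x) * exp (x / 2)"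
        "exp (- (rate + 1 / 2) * x) = exp (- rate * x) * exp (- x / 2)"
        by (simp_all add: exp_add[symmetric] algebra_simps)
      then show ?thesis unfolding arb_profile_def A_def[symmetric] by (simp add: algebra_simps)
    qed
    ultimately show ?thesis by simp
  qed
  show "(\<integral>\<^sup>+y. ennreal (dens y * arb_profile L \<gamma> (excess \<gamma> y)) \<partial>lborel) =
      ennreal (rate / (1 + rate * \<gamma>) * (L * exp (\<gamma> / 2) * (1 / (rate - 1 / 2) + 1 / (rate + 1 / 2) - 2 * (1 / rate))))"
    unfolding A_def[symmetric] I_def[symmetric]
  proof (rule nn_integral_dens_excess[OF _ _ _ I])
    show "arb_profile L \<gamma> \<in> borel_measurable borel" unfolding arb_profile_def[abs_def] by measurable
    show "arb_profile L \<gamma> 0 = 0" by (simp add: arb_profile_def)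
    show "0 \<le> arb_profile L \<gamma> x" for x using arb_profile_nonneg L by auto
  qed
  have "0 \<le> I"
    unfolding has_bochner_integral_integral_eq[OF I, symmetric]
    by (rule Bochner_Integration.integral_nonneg) (use L in \<open>auto intro!: mult_nonneg_nonneg arb_profile_nonneg\<close>)
  moreover note dens_mass_nonneg
  ultimately show "0 \<le> rate / (1 + rate * \<gamma>) * (L * exp (\<gamma> / 2) * (1 / (rate - 1 / 2) + 1 / (rate + 1 / 2) - 2 * (1 / rate)))"
    unfolding A_def[symmetric] I_def[symmetric] by (rule mult_nonneg_nonneg[rotated])
qed (use r in auto)

text \<open>For \<open>rate\<close> \<le> 1/2 the growth of the profile is not outweighed by the
  decay of the density: their product stays above a positive constant on a half-line, also at
  equality of the exponents.\<close>

lemma arb_intensity_infinite: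
  assumes L: "0 < L" and r: "rate \<le> 1 / 2"
  shows "has_intensity M (cumulative (arb cpmm L \<gamma>) N \<tau> P z) \<infinity>"
proof (subst has_intensity_cong[OF cumulative_cpmm(1)[OF L]], assumption, rule has_intensity_infinite)
  have [measurable]: "excess \<gamma> \<in> borel_measurable borel" unfolding excess_def[abs_def] by measurable
  show "(\<lambda>y. arb_profile L \<gamma> (excess \<gamma> y)) \<in> borel_measurable borel" unfolding arb_profile_def by measurable
  show "0 \<le> arb_profile L \<gamma> (excess \<gamma> y)" for y
    using L by (intro arb_profile_nonneg) auto
  fix v :: real
  define c where "c = rate / (2 * (1 + rate * \<gamma>))"
  have c: "0 < c" unfolding c_def by (rule dens_const_pos)
  \<comment> \<open>Beyond \<open>y0\<close> the shifted mispricing exceeds the band by at least 6,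
    so exp (u / 2) \<ge> 4 and subtracting 2 costs at most half of it; y itself is above
    \<open>\<gamma>\<close>.\<close>
  define y0 where "y0 = \<bar>v\<bar> + 2 * \<gamma> + 6"
  \<comment> \<open>The product of the lower bounds \<open>c * exp (- y / 2)\<close> and
    \<open>L * exp (v / 2) / 2 * exp (y / 2)\<close>, in which y cancels.\<close>
  define d where "d = c * L * exp (v / 2) / 2"
  have d: "0 < d" using c L by (simp add: d_def)
  have le: "d \<le> dens y * arb_profile L \<gamma> (excess \<gamma> (y + v))" if "y0 \<le> y" for y
  proof -
    have y: "6 \<le> y + v - \<gamma>" "\<gamma> \<le> y" "0 \<le> y" using that \<gamma> by (auto simp: y0_def)
    then have e: "excess \<gamma> (y + v) = y + v - \<gamma>" "excess \<gamma> y = y - \<gamma>" using \<gamma> by (auto simp: excess_def)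
    define u where "u = y + v - \<gamma>"
    have "6 \<le> u" using y(1) by (simp add: u_def)
    then have "4 \<le> exp (u / 2)" using exp_ge_add_one_self[of "u / 2"] by linarith
    then have "exp (u / 2) / 2 \<le> exp (u / 2) + exp (- u / 2) - 2" using exp_ge_zero[of "- u / 2"] by linarith
    then have "L * exp (\<gamma> / 2) * (exp (u / 2) / 2) \<le> arb_profile L \<gamma> u"
      unfolding arb_profile_def using L by (intro mult_left_mono) auto
    moreover have "exp (\<gamma> / 2) * exp (u / 2) = exp (v / 2) * exp (y / 2)"
      by (simp add: u_def exp_add[symmetric] diff_divide_distrib add_divide_distrib)
    ultimately have 1: "L * exp (v / 2) / 2 * exp (y / 2) \<le> arb_profile L \<gamma> u" by (simp add: mult_ac)
    have "rate * (y - \<gamma>) \<le> 1 / 2 * (y - \<gamma>)" using r y by (intro mult_right_mono) auto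
    then have "exp (- y / 2) \<le> exp (- rate * (y - \<gamma>))" using \<gamma> by simp
    then have 2: "c * exp (- y / 2) \<le> dens y" unfolding dens_eq c_def[symmetric] excess_def[symmetric] e(2)
      using c by (intro mult_left_mono) auto
    have "d = (c * exp (- y / 2)) * (L * exp (v / 2) / 2 * exp (y / 2))"
      by (simp add: d_def exp_minus)
    also have "\<dots> \<le> dens y * arb_profile L \<gamma> u"
      using 1 2 c L dens_nonneg by (intro mult_mono) auto
    finally show ?thesis by (simp add: e u_def)
  qed
  have "\<infinity> = ennreal d * emeasure lborel {y0..}" 
    using d by (simp add: emeasure_lborel_atLeast ennreal_mult_top)
  also have "\<dots> = (\<integral>\<^sup>+y. ennreal d * indicator {y0..} y \<partial>lborel)" by (simp add: nn_integral_cmult_indicator)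
  also have "\<dots> \<le> (\<integral>\<^sup>+y. ennreal (dens y * arb_profile L \<gamma> (excess \<gamma> (y + v))) \<partial>lborel)"
    using le by (intro nn_integral_mono) (auto split: split_indicator intro!: ennreal_leI)
  finally show "(\<integral>\<^sup>+y. ennreal (dens y * arb_profile L \<gamma> (excess \<gamma> (y + v))) \<partial>lborel) = \<infinity>"
    by (simp add: top_unique)
qed

lemma rate_gt_half_iff: "1 / 2 < rate \<longleftrightarrow> \<sigma>\<^sup>2 / 8 < lam"
proof -
  have "1 / 2 < rate \<longleftrightarrow> \<sigma> < 2 * sqrt (2 * lam)" using \<sigma> by (simp add: field_simps)
  also have "\<dots> \<longleftrightarrow> \<sigma>\<^sup>2 < (2 * sqrt (2 * lam))\<^sup>2"
  proof -
    have "(2 * sqrt (2 * lam))\<^sup>2 \<le> \<sigma>\<^sup>2 \<longleftrightarrow> 2 * sqrt (2 * lam) \<le> \<sigma>"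
      using \<sigma> lam by (intro power_mono_iff) auto
    then show ?thesis by linarith
  qed
  also have "\<dots> \<longleftrightarrow> \<sigma>\<^sup>2 / 8 < lam" using lam by (simp add: power_mult_distrib mult.commute)
  finally show ?thesis .
qed

end

theorem corollary2:
  fixes M :: "'a measure" and F :: "real \<Rightarrow> 'a measure"
    and B P z :: "real \<Rightarrow> 'a \<Rightarrow> real" and z0 :: "'a \<Rightarrow> real"
    and N :: "real \<Rightarrow> 'a \<Rightarrow> nat" and \<tau> :: "nat \<Rightarrow> 'a \<Rightarrow> real"
    and \<sigma> lam \<gamma> \<mu> L p :: real
  assumes "prob_space M"
    and "\<sigma> > 0" "lam > 0" "\<gamma> > 0" "L > 0" "p > 0"
    and "\<mu> = \<sigma>\<^sup>2 / 2"
    and "brownian_motion M F B"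
    and "external_price M F B \<mu> \<sigma> P"
    and "\<forall>w\<in>space M. P 0 w = p"
    and "poisson_process M lam N"
    and "arrival_times M N \<tau>"
    and "indep_rvs M (restricted_path B) real_paths (restricted_path N) nat_paths"
    and "indep_rvs M z0 borel
           (\<lambda>w. (restricted_path B w, restricted_path N w)) (real_paths \<Otimes>\<^sub>M nat_paths)"
    and "distributed M lborel z0 (\<lambda>x. ennreal (stationary_density \<sigma> lam \<gamma> x))"
    and "mispricing M \<sigma> \<gamma> B \<tau> z0 z"
  shows "\<exists>arb_rate fee_rate.
     has_intensity M (cumulative (arb cpmm L \<gamma>) N \<tau> P z) arb_rate \<and>
     has_intensity M (cumulative (fee cpmm L \<gamma>) N \<tau> P z) fee_rate \<and>
     arb_rate / ereal (pool_value cpmm L p) =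
       (if \<sigma>\<^sup>2 / 8 < lam
        then ereal (\<sigma>\<^sup>2 / 8 * p_trade \<sigma> lam \<gamma> * (exp (\<gamma> / 2) / (1 - \<sigma>\<^sup>2 / (8 * lam))))
        else \<infinity>) \<and>
     fee_rate / ereal (pool_value cpmm L p) =
       ereal (\<sigma>\<^sup>2 / 8 * ((exp (\<gamma> / 2) - exp (- \<gamma> / 2)) / \<gamma>) *
         (1 / ((1 + \<sigma> / (sqrt (2 * lam) * \<gamma>)) * (1 + \<sigma> / (2 * sqrt (2 * lam))))))"
proof -
  interpret arbitrage_model M F B P \<sigma> \<mu> z z0 N \<tau> lam \<gamma> p
    using assms by (intro arbitrage_model.intro price_space.intro bm_space.intro bm_space_axioms.intro
        price_space_axioms.intro arbitrage_model_axioms.intro)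
  define r where "r = rate"
  define s where "s = sqrt p"
  define g where "g = exp (\<gamma> / 2)"
  define g' where "g' = exp (\<gamma> / 2) - exp (- \<gamma> / 2)"
  have r: "0 < r" unfolding r_def by (rule rate_pos)
  have s: "0 < s" using \<open>p > 0\<close> by (simp add: s_def)
  have half: "1 / 2 < r \<longleftrightarrow> \<sigma>\<^sup>2 / 8 < lam" unfolding r_def by (rule rate_gt_half_iff)
  have sq: "sqrt (2 * lam) = r * \<sigma>" using \<sigma> by (simp add: r_def)
  have "2 * lam = (r * \<sigma>)\<^sup>2" unfolding sq[symmetric] using lam by simp
  \<comment> \<open>Trading \<open>lam\<close> for r and \<sigma> removes the square roots, so both
    quotients reduce to rational identities.\<close>
  then have lam_eq: "lam = r\<^sup>2 * \<sigma>\<^sup>2 / 2" by (simp add: power_mult_distrib)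
  have V: "pool_value cpmm L p = 2 * L * s" using assms by (simp add: pool_value_cpmm s_def)
  have V0: "0 < 2 * L * s" using \<open>L > 0\<close> s by simp
  have rg: "1 + r * \<gamma> \<noteq> 0" using mult_pos_pos[OF r \<gamma>] by linarith
  have ediv: "ereal a / ereal (2 * L * s) = ereal (a / (2 * L * s))" for a using s \<open>L > 0\<close> by auto
  define fee_rate where "fee_rate = ereal (lam * (s * (r / (1 + r * \<gamma>) * (L * g' * (1 / r - 1 / (r + 1 / 2))))))"
  have fee1: "has_intensity M (cumulative (fee cpmm L \<gamma>) N \<tau> P z) fee_rate"
    unfolding fee_rate_def r_def s_def g'_def by (rule fee_intensity) fact
  have fee2: "fee_rate / ereal (2 * L * s) =
       ereal (\<sigma>\<^sup>2 / 8 * (g' / \<gamma>) * (1 / ((1 + \<sigma> / (r * \<sigma> * \<gamma>)) * (1 + \<sigma> / (2 * (r * \<sigma>))))))"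
  proof -
    have "r / (1 + r * \<gamma>) * (1 / r - 1 / (r + 1 / 2)) = 1 / ((1 + r * \<gamma>) * (2 * r + 1))"
      using r rg by (simp add: divide_simps)
    moreover have "lam * (s * (a * (L * g' * D))) / (2 * L * s) = lam * g' * (a * D) / 2" for a D
      using s \<open>L > 0\<close> by (simp add: field_simps)
    ultimately have "lam * (s * (r / (1 + r * \<gamma>) * (L * g' * (1 / r - 1 / (r + 1 / 2))))) / (2 * L * s) =
       lam * g' * (1 / ((1 + r * \<gamma>) * (2 * r + 1))) / 2"
      by (simp only:)
    also have "\<dots> = \<sigma>\<^sup>2 / 8 * (g' / \<gamma>) * (2 * r\<^sup>2 * \<gamma> / ((1 + r * \<gamma>) * (2 * r + 1)))"
      unfolding lam_eq using \<gamma> by simp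
    also have "2 * r\<^sup>2 * \<gamma> / ((1 + r * \<gamma>) * (2 * r + 1)) = 1 / ((1 + \<sigma> / (r * \<sigma> * \<gamma>)) * (1 + \<sigma> / (2 * (r * \<sigma>))))"
    proof -
      have "1 + \<sigma> / (r * \<sigma> * \<gamma>) = (1 + r * \<gamma>) / (r * \<gamma>)" "1 + \<sigma> / (2 * (r * \<sigma>)) = (2 * r + 1) / (2 * r)"
        using \<sigma> r \<gamma> by (simp_all add: field_simps)
      then show ?thesis by (simp add: power2_eq_square)
    qed
    finally show ?thesis unfolding fee_rate_def ediv by (rule arg_cong)
  qed
  define arb_rate where "arb_rate = (if 1 / 2 < r
     then ereal (lam * (s * (r / (1 + r * \<gamma>) * (L * g * (1 / (r - 1 / 2) + 1 / (r + 1 / 2) - 2 * (1 / r)))))) else \<infinity>)"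
  have arb1: "has_intensity M (cumulative (arb cpmm L \<gamma>) N \<tau> P z) arb_rate"
    unfolding arb_rate_def r_def s_def g_def
    using arb_intensity_finite[OF \<open>L > 0\<close>] arb_intensity_infinite[OF \<open>L > 0\<close>] by (simp add: not_less)
  have arb2: "arb_rate / ereal (2 * L * s) = (if 1 / 2 < r
        then ereal (\<sigma>\<^sup>2 / 8 * (1 / (1 + r * \<sigma> * \<gamma> / \<sigma>)) * (g / (1 - \<sigma>\<^sup>2 / (8 * lam)))) else \<infinity>)"
  proof (cases "1 / 2 < r")
    case True
    \<comment> \<open>The poles at 1/2 and -1/2 from the exponential integrals combine into r r -
      1/4, and \<open>1 - \<sigma>\<^sup>2 / (8 * lam)\<close> is this factor divided by r
      r.\<close>
    have q: "r * r - 1 / 4 = (r - 1 / 2) * (r + 1 / 2)" by (simp add: algebra_simps)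
    have q0: "r * r - 1 / 4 \<noteq> 0" unfolding q using True by simp
    have frac: "1 / (r - 1 / 2) + 1 / (r + 1 / 2) - 2 * (1 / r) = 1 / (2 * r * (r * r - 1 / 4))"
      unfolding q using True by (simp add: divide_simps) (simp add: algebra_simps)
    have "1 - \<sigma>\<^sup>2 / (8 * lam) = (r * r - 1 / 4) / (r * r)"
      unfolding lam_eq using \<sigma> r by (simp add: field_simps power2_eq_square)
    then have rhs: "g / (1 - \<sigma>\<^sup>2 / (8 * lam)) = g * (r * r) / (r * r - 1 / 4)" by simp
    have "lam * (s * (r / (1 + r * \<gamma>) * (L * g * (1 / (2 * r * (r * r - 1 / 4)))))) / (2 * L * s) =
       \<sigma>\<^sup>2 / 8 * (1 / (1 + r * \<sigma> * \<gamma> / \<sigma>)) * (g * (r * r) / (r * r - 1 / 4))"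
    proof -
      define a where "a = 1 + r * \<gamma>"
      define b where "b = r * r - 1 / 4"
      have "1 + r * \<sigma> * \<gamma> / \<sigma> = a" using \<sigma> by (simp add: a_def)
      then show ?thesis
        unfolding b_def[symmetric] a_def[symmetric] lam_eq using s \<open>L > 0\<close> r q0 rg
        by (simp add: field_simps power2_eq_square flip: a_def b_def)
    qed
    then show ?thesis using True unfolding arb_rate_def frac rhs by (simp only: if_True ediv)
  next
    case False
    then show ?thesis using V0 by (simp add: arb_rate_def)
  qed
  show ?thesis
  proof (intro exI conjI)
    show "arb_rate / ereal (pool_value cpmm L p) =
       (if \<sigma>\<^sup>2 / 8 < lam
        then ereal (\<sigma>\<^sup>2 / 8 * p_trade \<sigma> lam \<gamma> * (exp (\<gamma> / 2) / (1 - \<sigma>\<^sup>2 / (8 * lam))))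
        else \<infinity>)"
      unfolding V arb2 p_trade_def sq half[symmetric] g_def ..
    show "fee_rate / ereal (pool_value cpmm L p) =
       ereal (\<sigma>\<^sup>2 / 8 * ((exp (\<gamma> / 2) - exp (- \<gamma> / 2)) / \<gamma>) *
         (1 / ((1 + \<sigma> / (sqrt (2 * lam) * \<gamma>)) * (1 + \<sigma> / (2 * sqrt (2 * lam))))))"
      unfolding V fee2 sq g'_def ..
  qed (fact arb1 fee1)+
qed

end
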